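(* Let $p,s,\alpha$ be in the admissible range and let $(\varphi_t)_{t\ge0}$ be a non-trivial semigroup of holomorphic self-maps of $\mathbb D$. Then $$m_\alpha(D^p_s)\subset[\varphi_t,M_\alpha(D^p_s)]\subsetneq M_\alpha(D^p_s),$$ that is, $(\varphi_t)$ induces a strongly continuous semigroup of composition operators $C_tf=f\circ\varphi_t$ on $m_\alpha(D^p_s)$, and $[\varphi_t,M_\alpha(D^p_s)]$ is a proper closed subspace of $M_\alpha(D^p_s)$.
   Context: $\mathbb D$ is the open unit disk of $\mathbb C$, $\mathcal H(\mathbb D)$ the space of analytic functions on $\mathbb D$, $dA$ Lebesgue area measure. For $1<p<\infty$ and $-1<s<\infty$, $D^p_s$ is the Banach space of $f\in\mathcal H(\mathbb D)$ with $\|f\|_{D^p_s}=|f(0)|+\left(\int_{\mathbb D}|f'(z)|^p(1-|z|^2)^s\,dA(z)\right)^{1/p}<\infty$. For $a\in\mathbb D$ put $\sigma_a(z)=\frac{a-z}{1-\overline a z}$. For $1<p<\infty$, $p-2\le s<\infty$, $0\le\alpha<\infty$, $M_\alpha(D^p_s)$ is the space of $f\in D^p_s$ with $\rho_{\alpha,p,s}(f)=\sup_{a\in\mathbb D}(1-|a|^2)^\alpha\|f\circ\sigma_a-f(a)\|_{D^p_s}<\infty$, normed by $|f(0)|+\rho_{\alpha,p,s}(f)$, and $m_\alpha(D^p_s)$ is the subspace of those $f$ with $\lim_{|a|\to1^-}(1-|a|^2)^\alpha\|f\circ\sigma_a-f(a)\|_{D^p_s}=0$. The parameters $p,s,\alpha$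 are in the admissible range if $1<p<\infty$, $0\le\alpha<\frac{s-(p-2)}{p}$, and either ($p\ge2$ and $s>p-2$) or ($1<p<2$ and $s\ge0$). A semigroup of holomorphic self-maps of $\mathbb D$ is a family $(\varphi_t)_{t\ge0}$ of analytic maps $\varphi_t:\mathbb D\to\mathbb D$ with $\varphi_0(z)=z$, $\varphi_t\circ\varphi_s=\varphi_{t+s}$ for $t,s\ge0$, and $\varphi_t(z)\to z$ uniformly on compact subsets of $\mathbb D$ as $t\to0^+$; it is non-trivial if not every $\varphi_t$ is the identity. For a Banach space $X\subset\mathcal H(\mathbb D)$ (continuously embedded), $[\varphi_t,X]=\{f\in X:\lim_{t\to0^+}\|f\circ\varphi_t-f\|_X=0\}$. *)

theory Defs
  imports "HOL-Complex_Analysis.Complex_Analysis"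
begin

text \<open>
  Analytic functions on the unit disk are total functions of type complex to complex that are
  holomorphic on the open ball; values outside the ball are irrelevant. Accordingly,
  equality of functions is always stated pointwise on the disk. Norms are real-valued
  and carry their intended meaning only on the corresponding space, so membership in the space
  is required explicitly wherever the mathematics reads ``norm finite''.
\<close>

abbreviation disk :: "complex set" where
  "disk \<equiv> ball 0 1"

definition dirichlet_norm :: "real \<Rightarrow> real \<Rightarrow> (complex \<Rightarrow> complex) \<Rightarrow> real" where
  "dirichlet_norm p s f =
     norm (f 0) +
     (LINT z:disk|lborel. norm (deriv f z) powr p * (1 - (norm z)\<^sup>2) powr s) powr (1 / p)"

definition dirichlet_space :: "real \<Rightarrow> real \<Rightarrow> (complex \<Rightarrow> complex) set" where
  "dirichlet_space p s =
     {f. f holomorphic_on disk \<and>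
         set_integrable lborel disk (\<lambda>z. norm (deriv f z) powr p * (1 - (norm z)\<^sup>2) powr s)}"

definition disk_aut :: "complex \<Rightarrow> complex \<Rightarrow> complex" where
  "disk_aut a z = (a - z) / (1 - cnj a * z)"

definition moebius_shift :: "(complex \<Rightarrow> complex) \<Rightarrow> complex \<Rightarrow> complex \<Rightarrow> complex" where
  "moebius_shift f a = (\<lambda>z. f (disk_aut a z) - f a)"

definition moebius_weight ::
    "real \<Rightarrow> real \<Rightarrow> real \<Rightarrow> (complex \<Rightarrow> complex) \<Rightarrow> complex \<Rightarrow> real" where
  "moebius_weight \<alpha> p s f a = (1 - (norm a)\<^sup>2) powr \<alpha> * dirichlet_norm p s (moebius_shift f a)"

definition rho :: "real \<Rightarrow> real \<Rightarrow> real \<Rightarrow> (complex \<Rightarrow> complex) \<Rightarrow> real" where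
  "rho \<alpha> p s f = (SUP a\<in>disk. moebius_weight \<alpha> p s f a)"

definition M_space :: "real \<Rightarrow> real \<Rightarrow> real \<Rightarrow> (complex \<Rightarrow> complex) set" where
  "M_space \<alpha> p s =
     {f \<in> dirichlet_space p s.
        (\<forall>a\<in>disk. moebius_shift f a \<in> dirichlet_space p s) \<and>
        bdd_above (moebius_weight \<alpha> p s f ` disk)}"

definition M_norm :: "real \<Rightarrow> real \<Rightarrow> real \<Rightarrow> (complex \<Rightarrow> complex) \<Rightarrow> real" where
  "M_norm \<alpha> p s f = norm (f 0) + rho \<alpha> p s f"

text \<open>The filter below expresses that the modulus of \<open>a\<close> tends to 1 from below.\<close>

definition m_space :: "real \<Rightarrow> real \<Rightarrow> real \<Rightarrow> (complex \<Rightarrow> complex) set" where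
  "m_space \<alpha> p s =
     {f \<in> M_space \<alpha> p s.
        (moebius_weight \<alpha> p s f \<longlongrightarrow> 0) (filtercomap norm (at_left (1::real)))}"

definition admissible :: "real \<Rightarrow> real \<Rightarrow> real \<Rightarrow> bool" where
  "admissible p s \<alpha> \<longleftrightarrow>
     1 < p \<and> 0 \<le> \<alpha> \<and> \<alpha> < (s - (p - 2)) / p \<and>
     ((2 \<le> p \<and> p - 2 < s) \<or> (p < 2 \<and> 0 \<le> s))"

definition selfmap_semigroup :: "(real \<Rightarrow> complex \<Rightarrow> complex) \<Rightarrow> bool" where
  "selfmap_semigroup \<phi> \<longleftrightarrow>
     (\<forall>t\<ge>0. \<phi> t holomorphic_on disk \<and> \<phi> t ` disk \<subseteq> disk) \<and>
     (\<forall>z\<in>disk. \<phi> 0 z = z) \<and>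
     (\<forall>t\<ge>0. \<forall>u\<ge>0. \<forall>z\<in>disk. \<phi> (t + u) z = \<phi> t (\<phi> u z)) \<and>
     (\<forall>K. compact K \<and> K \<subseteq> disk \<longrightarrow> uniform_limit K \<phi> (\<lambda>z. z) (at_right 0))"

definition nontrivial_semigroup :: "(real \<Rightarrow> complex \<Rightarrow> complex) \<Rightarrow> bool" where
  "nontrivial_semigroup \<phi> \<longleftrightarrow> (\<exists>t\<ge>0. \<exists>z\<in>disk. \<phi> t z \<noteq> z)"

text \<open>
  The space \<open>[\<phi>\<^sub>t, X]\<close> for a space \<open>X\<close> with norm \<open>N\<close>. The membership condition
  for small \<open>t\<close> is the convention that the norm of a function outside \<open>X\<close> is infinite.
\<close>

definition strong_cont_space ::
    "(real \<Rightarrow> complex \<Rightarrow> complex) \<Rightarrow> (complex \<Rightarrow> complex) set \<Rightarrow>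
     ((complex \<Rightarrow> complex) \<Rightarrow> real) \<Rightarrow> (complex \<Rightarrow> complex) set" where
  "strong_cont_space \<phi> X N =
     {f \<in> X.
        (\<forall>\<^sub>F t in at_right 0. (\<lambda>z. f (\<phi> t z) - f z) \<in> X) \<and>
        ((\<lambda>t. N (\<lambda>z. f (\<phi> t z) - f z)) \<longlongrightarrow> 0) (at_right 0)}"

definition C0_semigroup_on ::
    "(complex \<Rightarrow> complex) set \<Rightarrow> ((complex \<Rightarrow> complex) \<Rightarrow> real) \<Rightarrow>
     (real \<Rightarrow> (complex \<Rightarrow> complex) \<Rightarrow> complex \<Rightarrow> complex) \<Rightarrow> bool" where
  "C0_semigroup_on X N T \<longleftrightarrow>
     (\<forall>t\<ge>0. \<forall>f\<in>X. T t f \<in> X) \<and>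
     (\<forall>t\<ge>0. \<forall>f\<in>X. \<forall>g\<in>X. \<forall>c d. \<forall>z\<in>disk.
        T t (\<lambda>w. c * f w + d * g w) z = c * T t f z + d * T t g z) \<and>
     (\<forall>t\<ge>0. \<exists>B. \<forall>f\<in>X. N (T t f) \<le> B * N f) \<and>
     (\<forall>f\<in>X. \<forall>z\<in>disk. T 0 f z = f z) \<and>
     (\<forall>t\<ge>0. \<forall>u\<ge>0. \<forall>f\<in>X. \<forall>z\<in>disk. T (t + u) f z = T t (T u f) z) \<and>
     (\<forall>f\<in>X. ((\<lambda>t. N (\<lambda>z. T t f z - f z)) \<longlongrightarrow> 0) (at_right 0))"

definition comp_op ::
    "(real \<Rightarrow> complex \<Rightarrow> complex) \<Rightarrow> real \<Rightarrow> (complex \<Rightarrow> complex) \<Rightarrow> complex \<Rightarrow> complex" where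
  "comp_op \<phi> t f = f \<circ> \<phi> t"

definition closed_subspace_of ::
    "(complex \<Rightarrow> complex) set \<Rightarrow> (complex \<Rightarrow> complex) set \<Rightarrow>
     ((complex \<Rightarrow> complex) \<Rightarrow> real) \<Rightarrow> bool" where
  "closed_subspace_of Y X N \<longleftrightarrow>
     Y \<subseteq> X \<and> (\<lambda>_. 0) \<in> Y \<and>
     (\<forall>f\<in>Y. \<forall>g\<in>Y. (\<lambda>z. f z + g z) \<in> Y) \<and>
     (\<forall>c. \<forall>f\<in>Y. (\<lambda>z. c * f z) \<in> Y) \<and>
     (\<forall>F f. (\<forall>n::nat. F n \<in> Y) \<and> f \<in> X \<and> (\<lambda>n. N (\<lambda>z. F n z - f z)) \<longlonglongrightarrow> 0 \<longrightarrow> f \<in> Y)"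

end

theory Submission
  imports Defs
begin

text \<open>
  Put \<open>q = s - p + 2\<close>. A change of variables by the automorphism of the disk exchanging \<open>0\<close> and \<open>a\<close> turns the
  \<open>p\<close>-th power of the Moebius weight of \<open>f\<close> at \<open>a\<close> into \<open>(1 - |a|\<^sup>2)\<close> to the power \<open>\<alpha> p\<close> times the integral of
  \<open>|f'|\<close> to the \<open>p\<close> against \<open>(1 - |z|\<^sup>2)\<close> to the \<open>s\<close> times the \<open>q\<close>-th power of the Jacobian of the automorphism.
  For a univalent self-map \<open>\<phi>\<close> this quantity at \<open>a\<close> for \<open>f \<circ> \<phi>\<close> is controlled by the one at \<open>\<phi> a\<close> for \<open>f\<close>, also
  when the integrals are localised to \<open>E\<close> and \<open>\<phi> ` E\<close>: for \<open>p \<ge> 2\<close> by the Schwarz--Pick lemma and the area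
  formula, for \<open>p < 2\<close> by splitting \<open>g\<close> to the \<open>p\<close> into a large multiple of \<open>g\<^sup>2\<close> (area formula again) and a
  small constant (Littlewood subordination). All maps of a semigroup are univalent, being compositions of maps
  that are close to the identity on a compact set containing the relevant orbits; and for small times they keep
  points near the circle near the circle. This gives the invariance of the little space and strong continuity
  on it.

  For properness, a non-trivial semigroup displaces suitable points \<open>a\<^sub>n\<close> near the circle by pseudohyperbolic
  distances close to \<open>1\<close> at times \<open>t\<^sub>n\<close> tending to \<open>0\<close>; otherwise the displacement would vanish on the circle and
  the maximum modulus principle would give the identity. A sum of normalised bumps concentrated at a
  pseudohyperbolically separated sequence of such points lies in the big space, while its Bloch-type density
  is about \<open>1\<close> at each \<open>a\<^sub>n\<close> and small at its image at time \<open>t\<^sub>n\<close>.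
\<close>

unbundle no fps_syntax

section \<open>Change of variables under univalent maps\<close>

text \<open>The norm carries the power \<open>p\<close> of \<open>f'\<close>, while a univalent
  change of variables supplies the square of the derivative of the map. For \<open>p < 2\<close>
  this mismatch forces a Littlewood term, which cannot be localised to \<open>E\<close>. Hence the
  form of the composition estimate: a possibly large constant times the local energy plus
  \<open>\<eta>\<close> times the full energy, with \<open>\<eta>\<close> at our disposal; only a
  small coefficient makes the non-local term harmless where decay near the circle is at stake. The
  estimates concern p-th powers in \<open>ennreal\<close>, each addition costing a factor
  \<open>2 powr p\<close>, which does no harm to boundedness and limits. The parameters enter thus:
  \<open>s \<ge> 0\<close> allows Schwarz-Pick to be raised to the power \<open>s\<close>,
  \<open>1 < p\<close> makes \<open>p - 2\<close> an integrable exponent for the bumps, and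
  \<open>\<alpha> * p < q\<close> makes their energies decay in the pseudohyperbolic distance. To
  refute strong continuity one point per time suffices, since a Bloch-type density at
  \<open>a\<close> is controlled by the scaled energy at \<open>a\<close>. The displaced points
  change with the time, so a single function has to defeat a whole sequence of times; this is why a
  series of bumps is needed.\<close>

definition complex_of_vec :: "real^2 \<Rightarrow> complex" where
  "complex_of_vec x = Complex (x $ 1) (x $ 2)"

definition vec_of_complex :: "complex \<Rightarrow> real^2" where
  "vec_of_complex z = vector [Re z, Im z]"

lemma vec_of_complex_nth [simp]: "vec_of_complex z $ 1 = Re z" "vec_of_complex z $ 2 = Im z"
  by (simp_all add: vec_of_complex_def)

lemma complex_of_vec_inverse [simp]: "vec_of_complex (complex_of_vec x) = x"
  by (simp add: vec_eq_iff forall_2 complex_of_vec_def)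

lemma vec_of_complex_inverse [simp]: "complex_of_vec (vec_of_complex z) = z"
  by (simp add: complex_of_vec_def)

lemma bounded_linear_complex_of_vec: "bounded_linear complex_of_vec"
  by (intro linear_conv_bounded_linear[THEN iffD1] linearI)
     (simp_all add: complex_of_vec_def complex_eq_iff)

lemma bounded_linear_vec_of_complex: "bounded_linear vec_of_complex"
  by (intro linear_conv_bounded_linear[THEN iffD1] linearI)
     (simp_all add: vec_eq_iff forall_2)

lemma complex_of_vec_measurable [measurable]: "complex_of_vec \<in> borel_measurable borel"
  by (intro borel_measurable_continuous_onI linear_continuous_on bounded_linear_complex_of_vec)

text \<open>Carries the change of variables formula over from \<open>real^2\<close> to
  \<open>complex\<close>; \<open>lborel\<close> is determined by its values on boxes.\<close>

lemma lborel_complex_eq_distr: "(lborel :: complex measure) = distr lborel borel complex_of_vec"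
proof (rule lborel_eqI)
  fix l u :: complex
  assume le: "\<And>b. b \<in> Basis \<Longrightarrow> l \<bullet> b \<le> u \<bullet> b"
  then have le': "Re l \<le> Re u" "Im l \<le> Im u"
    using le[of 1] le[of \<i>] by (simp_all add: Basis_complex_def)
  have "complex_of_vec -` box l u = box (vec_of_complex l) (vec_of_complex u)"
    by (auto simp: complex_of_vec_def mem_box_cart forall_2 Basis_complex_def mem_box)
  moreover have "emeasure lborel (box (vec_of_complex l) (vec_of_complex u)) =
        ennreal ((Re u - Re l) * (Im u - Im l))"
  proof -
    have "measure lborel (cbox (vec_of_complex l) (vec_of_complex u)) = (Re u - Re l) * (Im u - Im l)"
      using le' by (subst content_cbox_cart) (auto simp: UNIV_2 interval_ne_empty_cart forall_2)
    then show ?thesis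
      using emeasure_lborel_box_finite[of "vec_of_complex l" "vec_of_complex u"]
      by (simp add: emeasure_eq_ennreal_measure less_top[symmetric] measure_lborel_box_eq measure_lborel_cbox_eq)
  qed
  ultimately show "emeasure (distr lborel borel complex_of_vec) (box l u) = (\<Prod>b\<in>Basis. (u - l) \<bullet> b)"
    by (simp add: emeasure_distr Basis_complex_def)
qed simp

lemma inj_holomorphic_image_borel:
  assumes "open U" "\<psi> holomorphic_on U" "inj_on \<psi> U" "S \<in> sets borel" "S \<subseteq> U"
  shows "\<psi> ` S \<in> sets borel"
proof -
  obtain k where k: "k holomorphic_on (\<psi> ` U)" "\<And>z. z \<in> U \<Longrightarrow> k (\<psi> z) = z"
    using holomorphic_has_inverse[OF assms(2,1,3)] by metis
  have op: "open (\<psi> ` U)"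
    by (rule open_mapping_thm3) (use assms in auto)
  have "k \<in> borel_measurable (restrict_space borel (\<psi> ` U))"
    by (intro borel_measurable_continuous_on_restrict holomorphic_on_imp_continuous_on k)
  then have "k -` S \<inter> space (restrict_space borel (\<psi> ` U)) \<in> sets (restrict_space borel (\<psi> ` U))"
    using assms(4) by (rule measurable_sets)
  moreover have "k -` S \<inter> space (restrict_space borel (\<psi> ` U)) = \<psi> ` S"
    using k(2) assms(5) by (force simp: space_restrict_space)
  ultimately show ?thesis
    using op by (auto simp: sets_restrict_space_iff)
qed

text \<open>The real Jacobian of a holomorphic map is the squared modulus of its derivative. Stated
  in \<open>ennreal\<close>, so that images of infinite area are covered as well.\<close>

lemma emeasure_inj_holomorphic_image:
  assumes U: "open U" "\<psi> holomorphic_on U" "inj_on \<psi> U" and S: "S \<in> sets borel" "S \<subseteq> U"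
  shows "emeasure lborel (\<psi> ` S) = (\<integral>\<^sup>+z\<in>S. ennreal ((norm (deriv \<psi> z))\<^sup>2) \<partial>lborel)"
proof -
  define S' where "S' = complex_of_vec -` S"
  define G where "G = vec_of_complex \<circ> \<psi> \<circ> complex_of_vec"
  define G' where "G' x = vec_of_complex \<circ> (\<lambda>h. deriv \<psi> (complex_of_vec x) * h) \<circ> complex_of_vec" for x
  define J where "J x = (norm (deriv \<psi> (complex_of_vec x)))\<^sup>2" for x
  have S'[measurable]: "S' \<in> sets borel"
    using measurable_sets[OF complex_of_vec_measurable S(1)] by (simp add: S'_def)
  have der: "(G has_derivative G' x) (at x within S')" if "x \<in> S'" for x
  proof -
    have "(\<psi> has_field_derivative deriv \<psi> (complex_of_vec x)) (at (complex_of_vec x))"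
      using U(1,2) S(2) that by (intro holomorphic_derivI[of _ U]) (auto simp: S'_def)
    then have 1: "(\<psi> has_derivative (\<lambda>h. deriv \<psi> (complex_of_vec x) * h)) (at (complex_of_vec x))"
      by (simp add: has_field_derivative_def)
    have "(G has_derivative G' x) (at x)"
      unfolding G_def G'_def
      by (intro diff_chain_at bounded_linear_imp_has_derivative bounded_linear_complex_of_vec
            bounded_linear_vec_of_complex 1)
    then show ?thesis by (rule has_derivative_at_withinI)
  qed
  have inj: "inj_on G S'"
    using U(3) S(2) unfolding G_def S'_def inj_on_def
    by (metis comp_apply complex_of_vec_inverse subsetD vec_of_complex_inverse vimageE)
  \<comment> \<open>Multiplication by a complex number \<open>c\<close> is the real matrix with
    columns \<open>c\<close> and \<open>c * \<i>\<close>, whose determinant is the squared modulus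
    of \<open>c\<close>.\<close>
  have det: "\<bar>det (matrix (G' x))\<bar> = J x" for x
  proof -
    have [simp]: "complex_of_vec (axis 1 1) = 1" "complex_of_vec (axis 2 1) = \<i>"
      by (auto simp: complex_of_vec_def complex_eq_iff axis_def)
    show ?thesis
      by (simp add: det_2 matrix_def G'_def J_def cmod_power2 flip: power2_eq_square)
  qed
  have img: "\<psi> ` S \<in> sets borel"
    by (rule inj_holomorphic_image_borel[OF U S])
  have GS: "G ` S' = complex_of_vec -` (\<psi> ` S)"
  proof -
    have "G ` S' \<subseteq> complex_of_vec -` (\<psi> ` S)"
      by (auto simp: G_def S'_def)
    moreover have "x \<in> G ` S'" if "complex_of_vec x = \<psi> z" "z \<in> S" for x z
      using that by (intro image_eqI[of _ _ "vec_of_complex z"]) (auto simp: G_def S'_def simp flip: that(1))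
    ultimately show ?thesis by auto
  qed
  have [measurable]: "G ` S' \<in> sets borel"
    using measurable_sets[OF complex_of_vec_measurable img] by (simp add: GS)
  have e1: "emeasure lborel (\<psi> ` S) = emeasure lborel (G ` S')"
    by (subst lborel_complex_eq_distr) (simp add: emeasure_distr img GS)
  have contd: "continuous_on U (deriv \<psi>)"
    using U by (intro holomorphic_on_imp_continuous_on holomorphic_deriv)
  have meas: "(\<lambda>z. ennreal ((norm (deriv \<psi> z))\<^sup>2) * indicator S z) \<in> borel_measurable borel"
  proof -
    have "(\<lambda>z. indicator U z *\<^sub>R deriv \<psi> z) \<in> borel_measurable borel"
      using contd U(1) by (intro borel_measurable_continuous_on_indicator) auto
    then have "(\<lambda>z. ennreal ((norm (indicator U z *\<^sub>R deriv \<psi> z))\<^sup>2) * indicator S z) \<in> borel_measurable borel"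
      using S(1) by measurable
    also have "(\<lambda>z. ennreal ((norm (indicator U z *\<^sub>R deriv \<psi> z))\<^sup>2) * indicator S z) =
      (\<lambda>z. ennreal ((norm (deriv \<psi> z))\<^sup>2) * indicator S z)"
      using S(2) by (auto simp: fun_eq_iff indicator_def)
    finally show ?thesis .
  qed
  have "(\<integral>\<^sup>+z. ennreal ((norm (deriv \<psi> z))\<^sup>2) * indicator S z \<partial>lborel) =
        (\<integral>\<^sup>+x. ennreal (J x) * indicator S' x \<partial>lborel)"
    by (subst lborel_complex_eq_distr, subst nn_integral_distr)
       (use meas in \<open>auto simp: J_def S'_def indicator_def\<close>)
  also have "\<dots> = (\<integral>\<^sup>+x. indicator S' x * J x \<partial>lborel)"
    by (intro nn_integral_cong) (auto simp: indicator_def)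
  finally have e2: "(\<integral>\<^sup>+z. ennreal ((norm (deriv \<psi> z))\<^sup>2) * indicator S z \<partial>lborel) =
        (\<integral>\<^sup>+x. indicator S' x * J x \<partial>lborel)" .
  have measJ: "(\<lambda>x. indicator S' x * J x) \<in> borel_measurable borel"
  proof -
    have "(\<lambda>z. indicator U z *\<^sub>R deriv \<psi> z) \<in> borel_measurable borel"
      using contd U(1) by (intro borel_measurable_continuous_on_indicator) auto
    then have "(\<lambda>x. indicator S' x * (norm (indicator U (complex_of_vec x) *\<^sub>R deriv \<psi> (complex_of_vec x)))\<^sup>2)
        \<in> borel_measurable borel"
      by measurable
    also have "(\<lambda>x. indicator S' x * (norm (indicator U (complex_of_vec x) *\<^sub>R deriv \<psi> (complex_of_vec x)))\<^sup>2)
       = (\<lambda>x. indicator S' x * J x)"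
      using S(2) by (auto simp: fun_eq_iff indicator_def J_def S'_def)
    finally show ?thesis .
  qed
  have cov: "G ` S' \<in> lmeasurable \<and> measure lebesgue (G ` S') = m \<longleftrightarrow> (J has_integral m) S'" for m
    using has_measure_differentiable_image[of S' G G' m] S' der inj by (simp add: det)
  \<comment> \<open>\<open>cov\<close> speaks of finite measures only. Being an equivalence, it also
    settles the infinite case: a finite integral would force the image to have finite
    measure.\<close>
  have "emeasure lborel (G ` S') = (\<integral>\<^sup>+x. indicator S' x * J x \<partial>lborel)"
  proof (cases "G ` S' \<in> lmeasurable")
    case True
    then have "(J has_integral (measure lebesgue (G ` S'))) S'"
      using cov by blast
    then have "(\<integral>\<^sup>+x. indicator S' x * J x \<partial>lborel) = measure lebesgue (G ` S')"
      by (rule nn_integral_has_integral_lebesgue[rotated]) (simp add: J_def)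
    also have "\<dots> = emeasure lebesgue (G ` S')"
      using True by (simp add: emeasure_eq_measure2)
    finally show ?thesis by simp
  next
    case False
    then have "emeasure lborel (G ` S') = \<infinity>"
      by (auto simp: fmeasurable_def less_top[symmetric])
    moreover have "(\<integral>\<^sup>+x. indicator S' x * J x \<partial>lborel) = \<infinity>"
    proof (rule ccontr)
      assume fin: "(\<integral>\<^sup>+x. indicator S' x * J x \<partial>lborel) \<noteq> \<infinity>"
      obtain r where r: "(\<integral>\<^sup>+x. indicator S' x * J x \<partial>lborel) = ennreal r" "0 \<le> r"
        using fin by (cases "(\<integral>\<^sup>+x. ennreal (indicator S' x * J x) \<partial>lborel)") auto
      have "((\<lambda>x. indicator S' x * J x) has_integral r) UNIV"
        by (rule nn_integral_has_integral) (use measJ r in \<open>auto simp: J_def\<close>)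
      moreover have "(\<lambda>x. indicator S' x * J x) = (\<lambda>x. if x \<in> S' then J x else 0)"
        by (simp add: fun_eq_iff)
      ultimately have "(J has_integral r) S'"
        by (simp add: has_integral_restrict_UNIV)
      with cov False show False by blast
    qed
    ultimately show ?thesis by simp
  qed
  with e1 e2 show ?thesis by simp
qed

text \<open>The area formula for sets says that \<open>\<psi>\<close> pushes the measure with
  density \<open>J\<close> forward to Lebesgue measure on the image; integrating \<open>F\<close>
  against both sides gives the formula.\<close>

theorem nn_integral_inj_holomorphic_image:
  assumes U: "open U" "\<psi> holomorphic_on U" "inj_on \<psi> U"
    and F: "(\<lambda>w. F w * indicator (\<psi> ` U) w) \<in> borel_measurable borel"
  shows "(\<integral>\<^sup>+w\<in>\<psi> ` U. F w \<partial>lborel) =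
         (\<integral>\<^sup>+z\<in>U. F (\<psi> z) * ennreal ((norm (deriv \<psi> z))\<^sup>2) \<partial>lborel)"
proof -
  define F' where "F' w = F w * indicator (\<psi> ` U) w" for w
  define J where "J z = ennreal ((norm (deriv \<psi> z))\<^sup>2) * indicator U z" for z
  \<comment> \<open>\<open>T\<close> and \<open>J\<close> are cut off outside \<open>U\<close> to be
    Borel on the whole plane. \<open>J\<close> vanishes there, so the artificial value of
    \<open>T\<close> does not contribute.\<close>
  define T where "T z = indicator U z *\<^sub>R \<psi> z" for z
  have op: "open (\<psi> ` U)"
    by (rule open_mapping_thm3) (use assms in auto)
  have [measurable]: "F' \<in> borel_measurable borel" using F by (simp add: F'_def[abs_def])
  have [measurable]: "U \<in> sets borel" "\<psi> ` U \<in> sets borel" using U op by auto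
  have "continuous_on U (deriv \<psi>)"
    using U by (intro holomorphic_on_imp_continuous_on holomorphic_deriv)
  then have "(\<lambda>z. indicator U z *\<^sub>R deriv \<psi> z) \<in> borel_measurable borel"
    using U(1) by (intro borel_measurable_continuous_on_indicator) auto
  then have "(\<lambda>z. ennreal ((norm (indicator U z *\<^sub>R deriv \<psi> z))\<^sup>2) * indicator U z) \<in> borel_measurable borel"
    by measurable
  also have "(\<lambda>z. ennreal ((norm (indicator U z *\<^sub>R deriv \<psi> z))\<^sup>2) * indicator U z) = J"
    by (auto simp: fun_eq_iff indicator_def J_def)
  finally have [measurable]: "J \<in> borel_measurable borel" .
  have [measurable]: "T \<in> borel_measurable borel"
    unfolding T_def[abs_def]
    using U by (intro borel_measurable_continuous_on_indicator holomorphic_on_imp_continuous_on) auto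
  have "distr (density lborel J) borel T = density lborel (indicator (\<psi> ` U))"
  proof (rule measure_eqI)
    fix A assume "A \<in> sets (distr (density lborel J) borel T)"
    then have [measurable]: "A \<in> sets borel" by simp
    have [measurable]: "T -` A \<in> sets borel"
      using measurable_sets[of T borel borel A] by simp
    have TA: "\<psi> ` (T -` A \<inter> U) = A \<inter> \<psi> ` U"
      by (auto simp: T_def indicator_def)
    have "emeasure (distr (density lborel J) borel T) A = (\<integral>\<^sup>+z. J z * indicator (T -` A) z \<partial>lborel)"
      by (simp add: emeasure_distr emeasure_density)
    also have "\<dots> = (\<integral>\<^sup>+z\<in>T -` A \<inter> U. ennreal ((norm (deriv \<psi> z))\<^sup>2) \<partial>lborel)"
      by (intro nn_integral_cong) (auto simp: J_def indicator_def)
    also have "\<dots> = emeasure lborel (\<psi> ` (T -` A \<inter> U))"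
      by (rule emeasure_inj_holomorphic_image[symmetric, OF U]) auto
    also have "\<dots> = emeasure (density lborel (indicator (\<psi> ` U))) A"
      unfolding TA by (simp add: emeasure_density indicator_inter_arith[symmetric] Int_commute)
    finally show "emeasure (distr (density lborel J) borel T) A = emeasure (density lborel (indicator (\<psi> ` U))) A" .
  qed simp
  then have "(\<integral>\<^sup>+w. F' w \<partial>distr (density lborel J) borel T) = (\<integral>\<^sup>+w. F' w \<partial>density lborel (indicator (\<psi> ` U)))"
    by simp
  then have "(\<integral>\<^sup>+z. J z * F' (T z) \<partial>lborel) = (\<integral>\<^sup>+w. indicator (\<psi> ` U) w * F' w \<partial>lborel)"
    by (simp add: nn_integral_distr nn_integral_density)
  also have "(\<integral>\<^sup>+w. indicator (\<psi> ` U) w * F' w \<partial>lborel) = (\<integral>\<^sup>+w\<in>\<psi> ` U. F w \<partial>lborel)"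
    by (intro nn_integral_cong) (auto simp: F'_def indicator_def)
  also have "(\<integral>\<^sup>+z. J z * F' (T z) \<partial>lborel) = (\<integral>\<^sup>+z\<in>U. F (\<psi> z) * ennreal ((norm (deriv \<psi> z))\<^sup>2) \<partial>lborel)"
    by (intro nn_integral_cong) (auto simp: F'_def J_def T_def indicator_def mult.commute)
  finally show ?thesis by simp
qed

section \<open>Area measure on the disk, with measurability required on the disk only\<close>

definition dA :: "complex measure" where
  "dA = restrict_space lborel disk"

lemma space_disk_measure [simp]: "space dA = disk"
  by (simp add: dA_def space_restrict_space)

lemma sets_disk_measure [measurable_cong]: "sets dA = sets (restrict_space borel disk)"
  by (simp add: dA_def sets_restrict_space)

lemma measurable_disk_measureI: "continuous_on disk f \<Longrightarrow> f \<in> borel_measurable dA"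
  using borel_measurable_continuous_on_restrict[of disk f]
  by (simp add: measurable_cong_sets[OF sets_disk_measure refl])

lemma measurable_borel_disk_measure:
  "f \<in> borel_measurable borel \<Longrightarrow> f \<in> borel_measurable dA"
  by (auto simp: measurable_cong_sets[OF sets_disk_measure refl] measurable_restrict_space1)

lemma measurable_disk_measure_selfmap:
  assumes "continuous_on disk \<psi>" "\<psi> ` disk \<subseteq> disk"
  shows "\<psi> \<in> measurable dA dA"
proof -
  have "\<psi> \<in> measurable dA (restrict_space borel disk)"
    using assms by (intro measurable_restrict_space2 measurable_disk_measureI) auto
  then show ?thesis
    by (simp add: measurable_cong_sets[OF refl sets_disk_measure])
qed

lemma nn_integral_disk_measure: "(\<integral>\<^sup>+z. F z \<partial>dA) = (\<integral>\<^sup>+z\<in>disk. F z \<partial>lborel)"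
  by (simp add: dA_def nn_integral_restrict_space)

lemma disk_measure_measurable_iff:
  fixes F :: "complex \<Rightarrow> ennreal"
  shows "F \<in> borel_measurable dA \<longleftrightarrow> (\<lambda>z. F z * indicator disk z) \<in> borel_measurable borel"
proof -
  have "borel_measurable dA = (borel_measurable (restrict_space borel disk) :: (complex \<Rightarrow> ennreal) set)"
    by (rule measurable_cong_sets[OF sets_disk_measure refl])
  then show ?thesis
    by (simp only:) (rule borel_measurable_restrict_space_iff_ennreal, simp)
qed

lemma nn_integral_disk_selfmap:
  assumes \<psi>: "\<psi> holomorphic_on disk" "inj_on \<psi> disk" "\<psi> ` disk \<subseteq> disk"
    and F: "F \<in> borel_measurable dA"
  shows "(\<integral>\<^sup>+z. F (\<psi> z) * ennreal ((norm (deriv \<psi> z))\<^sup>2) \<partial>dA) =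
         (\<integral>\<^sup>+w. F w * indicator (\<psi> ` disk) w \<partial>dA)"
proof -
  have "open (\<psi> ` disk)"
    by (rule open_mapping_thm3[OF \<psi>(1) open_ball \<psi>(2)])
  then have [measurable]: "\<psi> ` disk \<in> sets borel" by simp
  have "(\<lambda>z. (F z * indicator disk z) * indicator (\<psi> ` disk) z) \<in> borel_measurable borel"
    using F[unfolded disk_measure_measurable_iff] by measurable
  also have "(\<lambda>z. (F z * indicator disk z) * indicator (\<psi> ` disk) z) =
      (\<lambda>z. F z * indicator (\<psi> ` disk) z)"
    by (intro ext) (use \<psi>(3) in \<open>force simp: indicator_def\<close>)
  finally have m: "(\<lambda>z. F z * indicator (\<psi> ` disk) z) \<in> borel_measurable borel" .
  have "(\<integral>\<^sup>+z. F (\<psi> z) * ennreal ((norm (deriv \<psi> z))\<^sup>2) \<partial>dA) = (\<integral>\<^sup>+w\<in>\<psi> ` disk. F w \<partial>lborel)"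
    unfolding nn_integral_disk_measure
    by (rule nn_integral_inj_holomorphic_image[symmetric, OF _ \<psi>(1,2) m]) simp
  also have "\<dots> = (\<integral>\<^sup>+w. F w * indicator (\<psi> ` disk) w \<partial>dA)"
    unfolding nn_integral_disk_measure
    by (rule nn_integral_cong) (use \<psi>(3) in \<open>force simp: indicator_def\<close>)
  finally show ?thesis .
qed

section \<open>Disk automorphisms and the Schwarz--Pick lemma\<close>

text \<open>The modulus of the derivative of \<open>disk_aut a\<close> at \<open>z\<close>.\<close>

definition aut_jac :: "complex \<Rightarrow> complex \<Rightarrow> real" where
  "aut_jac a z = (1 - (norm a)\<^sup>2) / (norm (1 - cnj a * z))\<^sup>2"

lemma one_minus_norm_sq_pos: "a \<in> disk \<Longrightarrow> 0 < 1 - (norm a)\<^sup>2"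
  by (simp add: power_less_one_iff)

lemma norm_one_minus_cnj_mult:
  assumes "norm a \<le> 1" "norm z \<le> 1"
  shows "1 - norm a \<le> norm (1 - cnj a * z)" "1 - norm z \<le> norm (1 - cnj a * z)" "norm (1 - cnj a * z) \<le> 2"
proof -
  have "norm a * norm z \<le> norm a" "norm a * norm z \<le> norm z"
    using assms by (auto simp: mult_left_le mult_left_le_one_le)
  moreover have "1 - norm a * norm z \<le> norm (1 - cnj a * z)"
    using norm_triangle_ineq2[of 1 "cnj a * z"] by (simp add: norm_mult)
  moreover have "norm (1 - cnj a * z) \<le> 1 + norm a * norm z"
    using norm_triangle_ineq4[of 1 "cnj a * z"] by (simp add: norm_mult)
  ultimately show "1 - norm a \<le> norm (1 - cnj a * z)" "1 - norm z \<le> norm (1 - cnj a * z)" "norm (1 - cnj a * z) \<le> 2"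
    using assms by auto
qed

lemma one_minus_cnj_mult_nz: "a \<in> disk \<Longrightarrow> z \<in> disk \<Longrightarrow> 1 - cnj a * z \<noteq> 0"
  using norm_one_minus_cnj_mult[of a z] by auto

text \<open>The identity \<open>(norm (1 - cnj a * z))\<^sup>2 - (norm (a - z))\<^sup>2 = (1 - (norm
  a)\<^sup>2) * (1 - (norm z)\<^sup>2)\<close>, divided by the first square.\<close>

lemma one_minus_disk_aut_sq:
  assumes "1 - cnj a * z \<noteq> 0"
  shows "1 - (norm (disk_aut a z))\<^sup>2 = (1 - (norm z)\<^sup>2) * aut_jac a z"
proof -
  have "of_real ((norm (1 - cnj a * z))\<^sup>2 - (norm (a - z))\<^sup>2) =
        (of_real ((1 - (norm a)\<^sup>2) * (1 - (norm z)\<^sup>2)) :: complex)"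
    unfolding of_real_diff of_real_mult of_real_1 complex_norm_square
    by (simp add: algebra_simps)
  then have "(norm (1 - cnj a * z))\<^sup>2 - (norm (a - z))\<^sup>2 = (1 - (norm a)\<^sup>2) * (1 - (norm z)\<^sup>2)"
    by (simp only: of_real_eq_iff)
  then show ?thesis
    using assms by (simp add: disk_aut_def aut_jac_def norm_divide power_divide field_simps)
qed

lemma aut_jac_pos:
  assumes "a \<in> disk" "z \<in> disk"
  shows "0 < aut_jac a z"
  using one_minus_norm_sq_pos[OF assms(1)] one_minus_cnj_mult_nz[OF assms]
  by (auto simp: aut_jac_def)

lemma aut_jac_le:
  assumes "a \<in> disk" "z \<in> disk"
  shows "aut_jac a z \<le> (1 - (norm a)\<^sup>2) / (1 - norm z)\<^sup>2" "aut_jac a z \<le> (1 - (norm a)\<^sup>2) / (1 - norm a)\<^sup>2"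
  using assms norm_one_minus_cnj_mult[of a z] one_minus_norm_sq_pos[OF assms(1)]
  unfolding aut_jac_def
  by (auto intro!: divide_left_mono power_mono mult_pos_pos zero_less_power)

text \<open>Symmetry of the pseudohyperbolic distance: on the disk both sides are
  \<open>1 - (norm (disk_aut a z))\<^sup>2\<close>.\<close>

lemma aut_jac_commute:
  "(1 - (norm z)\<^sup>2) * aut_jac a z = (1 - (norm a)\<^sup>2) * aut_jac z a"
proof -
  have "norm (1 - cnj a * z) = norm (1 - cnj z * a)"
    by (metis complex_cnj_cnj complex_cnj_diff complex_cnj_mult complex_cnj_one complex_mod_cnj mult.commute)
  then show ?thesis by (simp add: aut_jac_def)
qed

lemma aut_jac_simps [simp]: "aut_jac 0 z = 1" "aut_jac a 0 = 1 - (norm a)\<^sup>2"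
  by (simp_all add: aut_jac_def)

lemma disk_aut_in_disk:
  assumes "a \<in> disk" "z \<in> disk"
  shows "disk_aut a z \<in> disk"
proof -
  have "0 < 1 - (norm (disk_aut a z))\<^sup>2"
    using one_minus_disk_aut_sq[OF one_minus_cnj_mult_nz[OF assms]] aut_jac_pos[OF assms]
      one_minus_norm_sq_pos[OF assms(2)] by simp
  then show ?thesis
    by (simp add: power_less_one_iff)
qed

lemma disk_aut_simps [simp]: "disk_aut a 0 = a" "disk_aut a a = 0"
  by (simp_all add: disk_aut_def)

lemma disk_aut_involution:
  assumes "a \<in> disk" "z \<in> disk"
  shows "disk_aut a (disk_aut a z) = z"
proof -
  define c where "c = 1 - cnj a * z"
  have c: "c \<noteq> 0" using one_minus_cnj_mult_nz[OF assms] by (simp add: c_def)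
  have d: "1 - cnj a * a \<noteq> 0" using one_minus_cnj_mult_nz[OF assms(1) assms(1)] .
  have "disk_aut a z = (a - z) / c" by (simp add: disk_aut_def c_def)
  then have "disk_aut a (disk_aut a z) = (a - (a - z) / c) / (1 - cnj a * ((a - z) / c))"
    unfolding disk_aut_def[of a "disk_aut a z"] by (simp only:)
  also have "a - (a - z) / c = z * (1 - cnj a * a) / c"
    using c by (simp add: field_simps c_def)
  also have "1 - cnj a * ((a - z) / c) = (1 - cnj a * a) / c"
    using c by (simp add: field_simps c_def)
  finally show ?thesis using c d by simp
qed

lemma disk_aut_image: "a \<in> disk \<Longrightarrow> disk_aut a ` disk = disk"
  using disk_aut_in_disk disk_aut_involution by (metis image_eqI image_subsetI subsetI subset_antisym)

lemma inj_on_disk_aut: "a \<in> disk \<Longrightarrow> inj_on (disk_aut a) disk"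
  using disk_aut_involution by (metis inj_onI)

lemma disk_aut_has_derivative:
  assumes "a \<in> disk" "z \<in> disk"
  shows "(disk_aut a has_field_derivative - of_real (1 - (norm a)\<^sup>2) / (1 - cnj a * z)\<^sup>2) (at z)"
proof -
  have "(disk_aut a has_field_derivative ((-1) * (1 - cnj a * z) - (a - z) * (- cnj a)) / ((1 - cnj a * z) * (1 - cnj a * z))) (at z)"
    unfolding disk_aut_def[abs_def]
    by (rule DERIV_divide) (use one_minus_cnj_mult_nz[OF assms] in \<open>auto intro!: derivative_eq_intros\<close>)
  moreover have "(-1) * (1 - cnj a * z) - (a - z) * (- cnj a) = - of_real (1 - (norm a)\<^sup>2)"
    unfolding of_real_diff of_real_1 complex_norm_square by (simp add: algebra_simps)
  ultimately show ?thesis by (simp only: power2_eq_square)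
qed

lemma disk_aut_holomorphic: "a \<in> disk \<Longrightarrow> disk_aut a holomorphic_on disk"
  using disk_aut_has_derivative by (meson field_differentiable_def field_differentiable_at_within holomorphic_onI)

lemma norm_deriv_disk_aut:
  assumes "a \<in> disk" "z \<in> disk"
  shows "norm (deriv (disk_aut a) z) = aut_jac a z"
proof -
  have "norm (of_real (1 - (norm a)\<^sup>2) :: complex) = 1 - (norm a)\<^sup>2"
    using one_minus_norm_sq_pos[OF assms(1)] by (subst norm_of_real) simp
  then show ?thesis
    by (simp add: DERIV_imp_deriv[OF disk_aut_has_derivative[OF assms]] norm_divide norm_power aut_jac_def
      del: of_real_diff)
qed

text \<open>The chain rule for an involution, obtained by using \<open>one_minus_disk_aut_sq\<close>
  twice.\<close>

lemma aut_jac_disk_aut: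
  assumes "a \<in> disk" "z \<in> disk"
  shows "aut_jac a (disk_aut a z) * aut_jac a z = 1"
proof -
  have "(1 - (norm z)\<^sup>2) = (1 - (norm (disk_aut a z))\<^sup>2) * aut_jac a (disk_aut a z)"
    using one_minus_disk_aut_sq[OF one_minus_cnj_mult_nz[OF assms(1) disk_aut_in_disk[OF assms]]]
    by (simp add: disk_aut_involution[OF assms])
  also have "\<dots> = (1 - (norm z)\<^sup>2) * (aut_jac a (disk_aut a z) * aut_jac a z)"
    by (simp add: one_minus_disk_aut_sq[OF one_minus_cnj_mult_nz[OF assms]])
  finally show ?thesis using one_minus_norm_sq_pos[OF assms(2)] by simp
qed

section \<open>Schwarz-Pick inequalities for arbitrary self-maps of the disk\<close>

locale disk_selfmap =
  fixes \<phi> :: "complex \<Rightarrow> complex"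
  assumes holo: "\<phi> holomorphic_on disk" and maps: "\<phi> ` disk \<subseteq> disk"
begin

lemma in_disk [simp]: "norm z < 1 \<Longrightarrow> norm (\<phi> z) < 1"
  using maps by (auto simp: image_subset_iff)

lemma has_deriv: "z \<in> disk \<Longrightarrow> (\<phi> has_field_derivative deriv \<phi> z) (at z)"
  using holo by (intro holomorphic_derivI[of _ disk]) auto

text \<open>Automorphisms on both sides move \<open>a\<close> and \<open>\<phi> a\<close> to the
  origin, which makes the Schwarz lemma and Littlewood's theorem applicable at any base
  point.\<close>

lemma conjugate_selfmap:
  assumes "a \<in> disk"
  defines "\<psi> \<equiv> \<lambda>u. disk_aut (\<phi> a) (\<phi> (disk_aut a u))"
  shows "disk_selfmap \<psi>" "\<psi> 0 = 0"
    "\<And>u. u \<in> disk \<Longrightarrow> \<phi> (disk_aut a u) = disk_aut (\<phi> a) (\<psi> u)"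
proof -
  have a: "\<phi> a \<in> disk" using assms maps by auto
  have h1: "(\<phi> \<circ> disk_aut a) holomorphic_on disk"
    by (rule holomorphic_on_compose_gen[OF disk_aut_holomorphic[OF assms(1)] holo])
       (simp add: disk_aut_image[OF assms(1)])
  have h2: "(disk_aut (\<phi> a) \<circ> (\<phi> \<circ> disk_aut a)) holomorphic_on disk"
    by (rule holomorphic_on_compose_gen[OF h1 disk_aut_holomorphic[OF a]])
       (use disk_aut_in_disk[OF assms(1)] in \<open>auto\<close>)
  have in': "\<phi> (disk_aut a u) \<in> disk" if "u \<in> disk" for u
    using disk_aut_in_disk[OF assms(1) that] maps by auto
  have "\<psi> = disk_aut (\<phi> a) \<circ> (\<phi> \<circ> disk_aut a)" by (simp add: \<psi>_def fun_eq_iff)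
  with h2 have "\<psi> holomorphic_on disk" by simp
  moreover have "\<psi> ` disk \<subseteq> disk"
    unfolding \<psi>_def using disk_aut_in_disk[OF a in'] by blast
  ultimately show "disk_selfmap \<psi>" by unfold_locales
  show "\<psi> 0 = 0" by (simp add: \<psi>_def)
  show "\<And>u. u \<in> disk \<Longrightarrow> \<phi> (disk_aut a u) = disk_aut (\<phi> a) (\<psi> u)"
    unfolding \<psi>_def by (simp add: disk_aut_involution[OF a in'])
qed

lemma schwarz_pick_dist:
  assumes "a \<in> disk" "z \<in> disk"
  shows "norm (disk_aut (\<phi> a) (\<phi> z)) \<le> norm (disk_aut a z)"
proof -
  define \<psi> where "\<psi> = (\<lambda>u. disk_aut (\<phi> a) (\<phi> (disk_aut a u)))"
  have s: "disk_selfmap \<psi>" and 0: "\<psi> 0 = 0"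
    using conjugate_selfmap[OF assms(1)] by (simp_all add: \<psi>_def)
  have "norm (\<psi> (disk_aut a z)) \<le> norm (disk_aut a z)"
    by (rule Schwarz_Lemma(1)) (use s 0 disk_aut_in_disk[OF assms] in \<open>auto simp: disk_selfmap_def image_subset_iff\<close>)
  then show ?thesis by (simp add: \<psi>_def disk_aut_involution[OF assms])
qed

text \<open>The distance form of Schwarz-Pick, rewritten by \<open>one_minus_disk_aut_sq\<close>
  into the quantities that occur in the energies.\<close>

lemma schwarz_pick_jac:
  assumes "a \<in> disk" "z \<in> disk"
  shows "(1 - (norm z)\<^sup>2) * aut_jac a z \<le> (1 - (norm (\<phi> z))\<^sup>2) * aut_jac (\<phi> a) (\<phi> z)"
proof -
  have "\<phi> a \<in> disk" "\<phi> z \<in> disk" using assms maps by auto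
  then have "1 - (norm (disk_aut a z))\<^sup>2 \<le> 1 - (norm (disk_aut (\<phi> a) (\<phi> z)))\<^sup>2"
    using schwarz_pick_dist[OF assms] by (simp add: power_mono)
  then show ?thesis
    by (simp only: one_minus_disk_aut_sq[OF one_minus_cnj_mult_nz[OF assms]]
      one_minus_disk_aut_sq[OF one_minus_cnj_mult_nz[OF \<open>\<phi> a \<in> disk\<close> \<open>\<phi> z \<in> disk\<close>]])
qed

lemma schwarz_pick_deriv:
  assumes "z \<in> disk"
  shows "norm (deriv \<phi> z) * (1 - (norm z)\<^sup>2) \<le> 1 - (norm (\<phi> z))\<^sup>2"
proof -
  define \<psi> where "\<psi> = (\<lambda>u. disk_aut (\<phi> z) (\<phi> (disk_aut z u)))"
  have s: "disk_selfmap \<psi>" and 0: "\<psi> 0 = 0"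
    using conjugate_selfmap[OF assms(1)] by (simp_all add: \<psi>_def)
  have b: "\<phi> z \<in> disk" using assms maps by auto
  have d: "norm (deriv \<psi> 0) \<le> 1"
    by (rule Schwarz_Lemma(2)[of _ 0]) (use s 0 in \<open>auto simp: disk_selfmap_def image_subset_iff\<close>)
  have d1: "(disk_aut z has_field_derivative deriv (disk_aut z) 0) (at 0)"
    by (rule holomorphic_derivI[of _ disk]) (use disk_aut_holomorphic[OF assms] in auto)
  have d2: "(disk_aut (\<phi> z) has_field_derivative deriv (disk_aut (\<phi> z)) (\<phi> z)) (at (\<phi> z))"
    by (rule holomorphic_derivI[of _ disk]) (use disk_aut_holomorphic[OF b] b in auto)
  have "((\<phi> \<circ> disk_aut z) has_field_derivative (deriv \<phi> z * deriv (disk_aut z) 0)) (at 0)"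
    by (rule DERIV_chain) (use has_deriv[OF assms] d1 in auto)
  then have "((disk_aut (\<phi> z) \<circ> (\<phi> \<circ> disk_aut z)) has_field_derivative
     (deriv (disk_aut (\<phi> z)) (\<phi> z) * (deriv \<phi> z * deriv (disk_aut z) 0))) (at 0)"
    by (intro DERIV_chain[of "disk_aut (\<phi> z)"]) (use d2 in auto)
  then have "deriv \<psi> 0 = deriv (disk_aut (\<phi> z)) (\<phi> z) * (deriv \<phi> z * deriv (disk_aut z) 0)"
    by (intro DERIV_imp_deriv) (simp add: \<psi>_def comp_def)
  then have n: "norm (deriv \<psi> 0) = aut_jac (\<phi> z) (\<phi> z) * (norm (deriv \<phi> z) * (1 - (norm z)\<^sup>2))"
    using assms b norm_deriv_disk_aut[of z 0] norm_deriv_disk_aut[of "\<phi> z" "\<phi> z"] by (simp add: norm_mult)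
  have "(1 - (norm (\<phi> z))\<^sup>2) * aut_jac (\<phi> z) (\<phi> z) = 1"
    using one_minus_disk_aut_sq[OF one_minus_cnj_mult_nz[OF b b]] by simp
  moreover have "(1 - (norm (\<phi> z))\<^sup>2) * norm (deriv \<psi> 0) \<le> (1 - (norm (\<phi> z))\<^sup>2) * 1"
    using d one_minus_norm_sq_pos[OF b] by (intro mult_left_mono) auto
  ultimately show ?thesis
    unfolding n by (metis mult.assoc mult.right_neutral mult.left_neutral)
qed

text \<open>A bound for the ratio of \<open>1 - (norm a)\<^sup>2\<close> to
  \<open>1 - (norm (\<phi> a))\<^sup>2\<close>. It depends on \<open>\<phi>\<close> through
  \<open>\<phi> 0\<close> alone, hence is uniform over the small times of a semigroup.\<close>

definition distortion :: real where
  "distortion = (1 + norm (\<phi> 0)) / (1 - norm (\<phi> 0))"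

lemma distortion_ge_1: "1 \<le> distortion"
  using in_disk[of 0] by (simp add: distortion_def field_simps)

lemma one_minus_norm_sq_distortion:
  assumes "a \<in> disk"
  shows "1 - (norm a)\<^sup>2 \<le> distortion * (1 - (norm (\<phi> a))\<^sup>2)"
proof -
  have b: "\<phi> a \<in> disk" "\<phi> 0 \<in> disk" using assms maps by auto
  have "1 - (norm a)\<^sup>2 \<le> (1 - (norm (\<phi> 0))\<^sup>2) * aut_jac (\<phi> a) (\<phi> 0)"
    using schwarz_pick_jac[OF assms, of 0] by simp
  also have "\<dots> \<le> (1 - (norm (\<phi> 0))\<^sup>2) * ((1 - (norm (\<phi> a))\<^sup>2) / (1 - norm (\<phi> 0))\<^sup>2)"
    using one_minus_norm_sq_pos[OF b(2)] aut_jac_le(1)[OF b] by (intro mult_left_mono) auto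
  also have "1 - (norm (\<phi> 0))\<^sup>2 = (1 - norm (\<phi> 0)) * (1 + norm (\<phi> 0))"
    by (simp add: power2_eq_square algebra_simps)
  also have "(1 - norm (\<phi> 0)) * (1 + norm (\<phi> 0)) * ((1 - (norm (\<phi> a))\<^sup>2) / (1 - norm (\<phi> 0))\<^sup>2) =
     distortion * (1 - (norm (\<phi> a))\<^sup>2)"
    using b(2) by (simp add: distortion_def power2_eq_square)
  finally show ?thesis .
qed

lemma distortion_le_3: "norm (\<phi> 0) \<le> 1/2 \<Longrightarrow> distortion \<le> 3"
  by (simp add: distortion_def divide_le_eq)

end

section \<open>Littlewood subordination in weighted Bergman spaces\<close>

definition circle_param :: "real \<Rightarrow> complex" where
  "circle_param t = exp (of_real (2 * pi * t) * \<i>)"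

lemma norm_circle_param [simp]: "norm (circle_param t) = 1"
  by (simp add: circle_param_def)

lemma continuous_circle_param [continuous_intros]: "continuous_on A circle_param"
  unfolding circle_param_def[abs_def] by (intro continuous_intros)

lemma circle_param_measurable [measurable]: "circle_param \<in> borel_measurable borel"
  by (intro borel_measurable_continuous_onI continuous_intros)

text \<open>Cauchy's formula for \<open>h\<close> times a factor that is holomorphic on the closed
  disk and equals 1 at \<open>w\<close>. On the circle, where \<open>r\<^sup>2\<close> is
  \<open>z * cnj z\<close>, this factor turns the Cauchy kernel into the Poisson kernel.\<close>

lemma poisson_formula:
  assumes h: "h holomorphic_on cball 0 r" and w: "norm w < r"
  shows "((\<lambda>t. of_real ((r\<^sup>2 - (norm w)\<^sup>2) / (norm (of_real r * circle_param t - w))\<^sup>2)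
            * h (of_real r * circle_param t)) has_integral h w) {0..1}"
proof -
  have r: "0 < r" using w norm_ge_zero le_less_trans by blast
  define c :: complex where "c = of_real (r\<^sup>2 - (norm w)\<^sup>2)"
  define F where "F u = h u * c / (of_real (r\<^sup>2) - cnj w * u)" for u
  have nz: "of_real (r\<^sup>2) - cnj w * u \<noteq> 0" if "norm u \<le> r" for u
  proof -
    have "norm (cnj w * u) \<le> norm w * r"
      using that by (simp add: norm_mult mult_left_mono)
    also have "\<dots> < r * r" using w r by (intro mult_strict_right_mono) auto
    finally have "norm (cnj w * u) < norm (of_real (r\<^sup>2) :: complex)"
      by (simp add: power2_eq_square norm_mult)
    then show ?thesis by auto
  qed
  have "F holomorphic_on cball 0 r"
    unfolding F_def[abs_def] by (intro holomorphic_intros h) (use nz in auto)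
  then have "((\<lambda>u. F u / (u - w)) has_contour_integral (2 * of_real pi * \<i> * F w)) (circlepath 0 r)"
    by (rule Cauchy_integral_circlepath_simple) (use w in auto)
  then have *: "((\<lambda>t. F (circlepath 0 r t) / (circlepath 0 r t - w) * vector_derivative (circlepath 0 r) (at t)) has_integral
      (2 * of_real pi * \<i> * F w)) {0..1}"
    by (simp add: has_contour_integral)
  have **: "F (circlepath 0 r t) / (circlepath 0 r t - w) * vector_derivative (circlepath 0 r) (at t) =
     (2 * of_real pi * \<i>) * (of_real ((r\<^sup>2 - (norm w)\<^sup>2) / (norm (of_real r * circle_param t - w))\<^sup>2)
            * h (of_real r * circle_param t))" for t
  proof -
    define z where "z = of_real r * circle_param t"
    have z: "circlepath 0 r t = z" "vector_derivative (circlepath 0 r) (at t) = 2 * of_real pi * \<i> * z"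
      by (simp add: circlepath z_def circle_param_def mult_ac)
         (simp add: vector_derivative_circlepath z_def circle_param_def mult_ac)
    have nzr: "norm z = r" using r by (simp add: z_def norm_mult)
    have zz: "of_real (r\<^sup>2) = z * cnj z"
      unfolding nzr[symmetric] by (rule complex_norm_square)
    have "z \<noteq> 0" "z - w \<noteq> 0" using nzr r w by auto
    have "of_real (r\<^sup>2) - cnj w * z = z * cnj (z - w)"
      unfolding zz by (simp add: algebra_simps)
    then have "F z / (z - w) * (2 * of_real pi * \<i> * z) =
        (2 * of_real pi * \<i>) * (c / ((z - w) * cnj (z - w)) * h z)"
      using \<open>z \<noteq> 0\<close> \<open>z - w \<noteq> 0\<close> by (simp add: F_def mult_ac)
    also have "(z - w) * cnj (z - w) = of_real ((norm (z - w))\<^sup>2)"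
      by (simp only: complex_norm_square)
    finally show ?thesis
      by (simp only: z z_def[symmetric] c_def of_real_divide)
  qed
  have Fw: "F w = h w"
  proof -
    have "cnj w * w = of_real ((norm w)\<^sup>2)"
      unfolding complex_norm_square by (rule mult.commute)
    then show ?thesis
      using nz[of w] w unfolding F_def c_def by simp
  qed
  have "((\<lambda>t. (2 * of_real pi * \<i>) * (of_real ((r\<^sup>2 - (norm w)\<^sup>2) / (norm (of_real r * circle_param t - w))\<^sup>2)
            * h (of_real r * circle_param t))) has_integral (2 * of_real pi * \<i>) * h w) {0..1}"
    using * unfolding ** Fw .
  from has_integral_mult_right[OF this, of "inverse (2 * of_real pi * \<i>)"]
  moreover have "inverse (2 * of_real pi * \<i>) * (2 * of_real pi * \<i> * x) = x" for x :: complex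
    by (subst mult.assoc[symmetric], subst left_inverse) auto
  ultimately show ?thesis by (simp only:)
qed

text \<open>The graph of the convex power lies above its tangent at \<open>c\<close>; for positive
  \<open>c\<close> this is Young's inequality rearranged.\<close>

lemma powr_tangent_le:
  fixes x c p :: real
  assumes "0 \<le> x" "0 \<le> c" "1 < p"
  shows "c powr p + p * c powr (p - 1) * (x - c) \<le> x powr p"
proof (cases "c = 0")
  case False
  define q where "q = p / (p - 1)"
  have q: "1 < q" "1 / p + 1 / q = 1" using assms by (auto simp: q_def field_simps)
  have "x * c powr (p - 1) \<le> x powr p / p + (c powr (p - 1)) powr q / q"
    by (rule Youngs_inequality) (use assms q in auto)
  also have "(c powr (p - 1)) powr q = c powr p"
    using assms by (simp add: powr_powr q_def)
  finally have "p * (x * c powr (p - 1)) \<le> p * (x powr p / p + c powr p / q)"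
    using assms by (intro mult_left_mono) auto
  also have "\<dots> = x powr p + (p - 1) * c powr p"
    using assms by (simp add: q_def field_simps)
  finally have 1: "p * x * c powr (p - 1) \<le> x powr p + (p - 1) * c powr p"
    by (simp add: mult.assoc)
  have "c * c powr (p - 1) = c powr p"
    using assms False by (simp add: powr_diff)
  then have "p * c powr (p - 1) * (x - c) = p * x * c powr (p - 1) - p * c powr p"
    by (simp add: algebra_simps)
  moreover have "(p - 1) * c powr p = p * c powr p - c powr p"
    by (simp add: left_diff_distrib)
  ultimately show ?thesis using 1 by linarith
qed simp

text \<open>Jensen's inequality for the Poisson kernel: the tangent inequality at
  \<open>c = norm (h w)\<close> is integrated against a kernel of total mass 1. The linear term is
  nonnegative because \<open>norm (h w)\<close> is at most the Poisson integral of the modulus of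
  \<open>h\<close>.\<close>

lemma poisson_jensen:
  assumes h: "h holomorphic_on cball 0 r" and w: "norm w < r" and p: "1 < p"
  shows "ennreal (norm (h w) powr p) \<le>
    (\<integral>\<^sup>+t\<in>{0..1}. ennreal ((r\<^sup>2 - (norm w)\<^sup>2) / (norm (of_real r * circle_param t - w))\<^sup>2
            * norm (h (of_real r * circle_param t)) powr p) \<partial>lborel)"
proof -
  have r: "0 < r" using w norm_ge_zero le_less_trans by blast
  define z where "z t = of_real r * circle_param t" for t
  define P where "P t = (r\<^sup>2 - (norm w)\<^sup>2) / (norm (z t - w))\<^sup>2" for t
  define c where "c = norm (h w)"
  have nz: "norm (z t) = r" for t using r by (simp add: z_def norm_mult)
  have zw: "z t \<noteq> w" for t using nz[of t] w by auto
  have P0: "0 \<le> P t" for t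
    unfolding P_def using w r by (intro divide_nonneg_nonneg) (auto intro: power_mono)
  have cz: "continuous_on A z" for A
    unfolding z_def[abs_def] by (intro continuous_intros)
  have cP: "continuous_on A P" for A
    unfolding P_def[abs_def] using zw by (intro continuous_intros cz) auto
  have ch: "continuous_on A (\<lambda>t. h (z t))" for A
    by (rule continuous_on_compose2[OF holomorphic_on_imp_continuous_on[OF h] cz]) (use nz in auto)
  have chn: "continuous_on A (\<lambda>t. norm (h (z t)) powr p)" for A
    using p by (intro continuous_on_powr' continuous_intros ch) auto
  have one: "(P has_integral 1) {0..1}"
  proof -
    have "((\<lambda>t. of_real (P t) * (1::complex)) has_integral 1) {0..1}"
      unfolding P_def z_def by (rule poisson_formula) (use w in auto)
    from has_integral_Re[OF this] show ?thesis by simp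
  qed
  have hw: "((\<lambda>t. of_real (P t) * h (z t)) has_integral h w) {0..1}"
    unfolding P_def z_def by (rule poisson_formula[OF h w])
  have i1: "(\<lambda>t. P t * norm (h (z t))) integrable_on {0..1}"
    by (intro integrable_continuous_real continuous_intros cP ch)
  have i2: "(\<lambda>t. P t * norm (h (z t)) powr p) integrable_on {0..1}"
    by (intro integrable_continuous_real continuous_on_mult cP chn)
  have "c \<le> integral {0..1} (\<lambda>t. P t * norm (h (z t)))"
    unfolding c_def integral_unique[OF hw, symmetric]
    by (rule integral_norm_bound_integral) (use i1 hw P0 in \<open>auto simp: norm_mult\<close>)
  then have le: "0 \<le> p * c powr (p - 1) * (integral {0..1} (\<lambda>t. P t * norm (h (z t))) - c)"
    using p by simp
  define I1 where "I1 = integral {0..1} (\<lambda>t. P t * norm (h (z t)))"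
  have j: "((\<lambda>t. P t * norm (h (z t))) has_integral I1) {0..1}"
    using i1 by (simp add: I1_def has_integral_integral)
  have "((\<lambda>t. (c powr p - p * c powr (p - 1) * c) * P t + p * c powr (p - 1) * (P t * norm (h (z t)))) has_integral
      ((c powr p - p * c powr (p - 1) * c) * 1 + p * c powr (p - 1) * I1)) {0..1}"
    by (intro has_integral_add has_integral_mult_right one j)
  moreover have "((\<lambda>t. P t * norm (h (z t)) powr p) has_integral integral {0..1} (\<lambda>t. P t * norm (h (z t)) powr p)) {0..1}"
    using i2 by (simp add: has_integral_integral)
  moreover have "(c powr p - p * c powr (p - 1) * c) * P t + p * c powr (p - 1) * (P t * norm (h (z t)))
        \<le> P t * norm (h (z t)) powr p" for t
  proof -
    have "P t * (c powr p + p * c powr (p - 1) * (norm (h (z t)) - c)) \<le> P t * norm (h (z t)) powr p"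
      using P0 p by (intro mult_left_mono powr_tangent_le) (auto simp: c_def)
    then show ?thesis by (simp add: algebra_simps)
  qed
  ultimately have "(c powr p - p * c powr (p - 1) * c) * 1 + p * c powr (p - 1) * I1 \<le>
      integral {0..1} (\<lambda>t. P t * norm (h (z t)) powr p)"
    by (rule has_integral_le)
  then have "c powr p \<le> integral {0..1} (\<lambda>t. P t * norm (h (z t)) powr p)"
    using le by (simp add: I1_def algebra_simps)
  moreover have "(\<integral>\<^sup>+t. ennreal (indicator {0..1} t * (P t * norm (h (z t)) powr p)) \<partial>lborel) =
     ennreal (integral {0..1} (\<lambda>t. P t * norm (h (z t)) powr p))"
    by (rule nn_integral_has_integral_lebesgue) (use i2 P0 in \<open>auto simp: has_integral_integral\<close>)
  moreover have "(\<integral>\<^sup>+t. ennreal (indicator {0..1} t * (P t * norm (h (z t)) powr p)) \<partial>lborel) =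
     (\<integral>\<^sup>+t\<in>{0..1}. ennreal (P t * norm (h (z t)) powr p) \<partial>lborel)"
    by (intro nn_integral_cong) (simp add: indicator_def)
  ultimately have "ennreal (c powr p) \<le> (\<integral>\<^sup>+t\<in>{0..1}. ennreal (P t * norm (h (z t)) powr p) \<partial>lborel)"
    by (metis ennreal_leI)
  then show ?thesis
    unfolding P_def z_def c_def .
qed

text \<open>The left integrand is bounded by the Poisson integral evaluated at the point
  \<open>\<psi> (z s)\<close>; after exchanging the integrals the kernel has to be averaged over
  \<open>s\<close>. The strict contraction keeps \<open>\<psi> (z s)\<close> inside the circle of
  radius \<open>r\<close>, where the kernel is regular.\<close>

lemma circle_subordination:
  assumes h: "h holomorphic_on disk" and \<psi>: "\<psi> holomorphic_on disk" "\<psi> 0 = 0"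
    and l: "\<And>z. z \<in> disk \<Longrightarrow> norm (\<psi> z) \<le> l * norm z" "0 \<le> l" "l < 1"
    and r: "0 < r" "r < 1" and p: "1 < p"
  shows "(\<integral>\<^sup>+t\<in>{0..1}. ennreal (norm (h (\<psi> (of_real r * circle_param t))) powr p) \<partial>lborel) \<le>
         (\<integral>\<^sup>+t\<in>{0..1}. ennreal (norm (h (of_real r * circle_param t)) powr p) \<partial>lborel)"
proof -
  define z where "z t = of_real r * circle_param t" for t
  have nz: "norm (z t) = r" for t using r by (simp add: z_def norm_mult)
  have zd: "z t \<in> disk" for t using nz r by simp
  have small: "norm (\<psi> u) < r" if "norm u \<le> r" for u
  proof -
    have "norm (\<psi> u) \<le> l * norm u" using that r by (intro l) auto
    also have "\<dots> \<le> l * r" using that l by (intro mult_left_mono) auto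
    also have "\<dots> < r" using l r by simp
    finally show ?thesis .
  qed
  define K where "K s t = (r\<^sup>2 - (norm (\<psi> (z s)))\<^sup>2) / (norm (z t - \<psi> (z s)))\<^sup>2" for s t
  have K0: "0 \<le> K s t" for s t
    unfolding K_def using small[of "z s"] nz r by (intro divide_nonneg_nonneg) (auto intro: power_mono less_imp_le)
  have cz: "continuous_on A z" for A
    unfolding z_def[abs_def] by (intro continuous_intros)
  have ch: "continuous_on A (\<lambda>t. h (z t))" for A
    by (rule continuous_on_compose2[OF holomorphic_on_imp_continuous_on[OF h] cz]) (use zd in auto)
  have c\<psi>: "continuous_on A (\<lambda>t. \<psi> (z t))" for A
    by (rule continuous_on_compose2[OF holomorphic_on_imp_continuous_on[OF \<psi>(1)] cz]) (use zd in auto)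
  have [measurable]: "z \<in> borel_measurable borel" "(\<lambda>t. h (z t)) \<in> borel_measurable borel"
     "(\<lambda>t. \<psi> (z t)) \<in> borel_measurable borel"
    by (intro borel_measurable_continuous_onI cz ch c\<psi>)+
  have hc: "h holomorphic_on cball 0 r"
    using h by (rule holomorphic_on_subset) (use r in auto)
  define f where "f s t = ennreal (K s t * norm (h (z t)) powr p) * indicator {0..1} t * indicator {0..1} s" for s t
  have meas: "(\<lambda>(s, t). f s t) \<in> borel_measurable (lborel \<Otimes>\<^sub>M lborel)"
    unfolding f_def K_def by measurable
  have "(\<integral>\<^sup>+s\<in>{0..1}. ennreal (norm (h (\<psi> (z s))) powr p) \<partial>lborel) \<le> (\<integral>\<^sup>+s. (\<integral>\<^sup>+t. f s t \<partial>lborel) \<partial>lborel)"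
  proof (rule nn_integral_mono)
    fix s :: real
    have "ennreal (norm (h (\<psi> (z s))) powr p) \<le> (\<integral>\<^sup>+t\<in>{0..1}. ennreal (K s t * norm (h (z t)) powr p) \<partial>lborel)"
      unfolding K_def z_def[of t for t]
      by (rule poisson_jensen[OF hc _ p]) (use small[of "z s"] nz in \<open>simp add: z_def\<close>)
    then show "ennreal (norm (h (\<psi> (z s))) powr p) * indicator {0..1} s \<le> (\<integral>\<^sup>+t. f s t \<partial>lborel)"
      by (auto simp: f_def indicator_def)
  qed
  also have "\<dots> = (\<integral>\<^sup>+t. (\<integral>\<^sup>+s. f s t \<partial>lborel) \<partial>lborel)"
    by (rule lborel_pair.Fubini'[symmetric]) (rule meas)
  also have "\<dots> = (\<integral>\<^sup>+t\<in>{0..1}. ennreal (norm (h (z t)) powr p) \<partial>lborel)"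
  proof (rule nn_integral_cong)
    fix t :: real
    \<comment> \<open>The Herglotz kernel composed with \<open>\<psi>\<close>. Its real part is the
      Poisson kernel, and its mean over the circle is its value at the origin, which is 1 because
      \<open>\<psi> 0 = 0\<close>.\<close>
    define k where "k u = (z t + \<psi> u) / (z t - \<psi> u)" for u
    have zp: "z t - \<psi> u \<noteq> 0" if "norm u \<le> r" for u
      using small[OF that] nz[of t] by auto
    have "k holomorphic_on cball 0 r"
      unfolding k_def[abs_def]
      by (intro holomorphic_intros holomorphic_on_subset[OF \<psi>(1)]) (use zp r in auto)
    then have "((\<lambda>s. of_real ((r\<^sup>2 - (norm (0::complex))\<^sup>2) / (norm (of_real r * circle_param s - 0))\<^sup>2)
            * k (of_real r * circle_param s)) has_integral k 0) {0..1}"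
      by (rule poisson_formula) (use r in auto)
    moreover have "k 0 = 1" using nz[of t] r by (auto simp: k_def \<psi>(2))
    ultimately have "((\<lambda>s. k (z s)) has_integral 1) {0..1}"
      using r by (simp add: norm_mult z_def)
    from has_integral_Re[OF this] have "((\<lambda>s. Re (k (z s))) has_integral 1) {0..1}" by simp
    moreover have "Re (k (z s)) = K s t" for s
    proof -
      define v where "v = \<psi> (z s)"
      have "Re ((z t + v) / (z t - v)) = Re ((z t + v) * cnj (z t - v)) / (norm (z t - v))\<^sup>2"
        by (subst complex_div_cnj) (simp only: of_real_power[symmetric] Re_divide_of_real)
      also have "Re ((z t + v) * cnj (z t - v)) = (norm (z t))\<^sup>2 - (norm v)\<^sup>2"
        unfolding cmod_power2 by (simp add: algebra_simps power2_eq_square)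
      finally show ?thesis by (simp add: k_def K_def v_def nz)
    qed
    ultimately have "((\<lambda>s. K s t) has_integral 1) {0..1}" by simp
    then have "(\<integral>\<^sup>+s. ennreal (indicator {0..1} s * K s t) \<partial>lborel) = ennreal 1"
      by (intro nn_integral_has_integral_lebesgue) (use K0 in auto)
    moreover have "(\<integral>\<^sup>+s. f s t \<partial>lborel) = (\<integral>\<^sup>+s. ennreal (norm (h (z t)) powr p) * indicator {0..1} t * ennreal (indicator {0..1} s * K s t) \<partial>lborel)"
      by (intro nn_integral_cong) (auto simp: f_def indicator_def ennreal_mult'' K0 mult.commute)
    moreover have "\<dots> = ennreal (norm (h (z t)) powr p) * indicator {0..1} t * (\<integral>\<^sup>+s. ennreal (indicator {0..1} s * K s t) \<partial>lborel)"
      unfolding K_def by (intro nn_integral_cmult) measurable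
    ultimately show "(\<integral>\<^sup>+s. f s t \<partial>lborel) = ennreal (norm (h (z t)) powr p) * indicator {0..1} t"
      by simp
  qed
  finally show ?thesis by (simp add: z_def)
qed

lemma rotation_disk_selfmap:
  assumes "norm u = 1"
  shows "(\<lambda>z. u * z) holomorphic_on disk" "inj_on (\<lambda>z. u * z) disk" "(\<lambda>z. u * z) ` disk = disk"
    "deriv (\<lambda>z. u * z) z = u"
proof -
  have "u \<noteq> 0" using assms by auto
  show "(\<lambda>z. u * z) holomorphic_on disk" by (intro holomorphic_intros)
  show "inj_on (\<lambda>z. u * z) disk" using \<open>u \<noteq> 0\<close> by (auto simp: inj_on_def)
  have "w \<in> (\<lambda>z. u * z) ` disk" if "w \<in> disk" for w
    using that \<open>u \<noteq> 0\<close> assms by (intro image_eqI[of _ _ "w / u"]) (auto simp: norm_divide)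
  then show "(\<lambda>z. u * z) ` disk = disk" using assms by (auto simp: norm_mult)
  show "deriv (\<lambda>z. u * z) z = u"
    by (rule DERIV_imp_deriv) (auto intro!: derivative_eq_intros)
qed

lemma nn_integral_disk_rotate:
  assumes "norm u = 1" "F \<in> borel_measurable dA"
  shows "(\<integral>\<^sup>+z. F (u * z) \<partial>dA) = (\<integral>\<^sup>+z. F z \<partial>dA)"
proof -
  have "(\<integral>\<^sup>+z. F (u * z) \<partial>dA) =
    (\<integral>\<^sup>+z. F (u * z) * ennreal ((norm (deriv (\<lambda>z. u * z) z))\<^sup>2) \<partial>dA)"
    using rotation_disk_selfmap[OF assms(1)] assms(1) by simp
  also have "\<dots> = (\<integral>\<^sup>+w. F w * indicator ((\<lambda>z. u * z) ` disk) w \<partial>dA)"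
    by (rule nn_integral_disk_selfmap) (use rotation_disk_selfmap[OF assms(1)] assms(2) in auto)
  also have "\<dots> = (\<integral>\<^sup>+z. F z \<partial>dA)"
    using rotation_disk_selfmap[OF assms(1)] by (intro nn_integral_cong) simp
  finally show ?thesis .
qed

lemma sigma_finite_disk_measure: "sigma_finite_measure dA"
  unfolding dA_def
  by (rule sigma_finite_measure_restrict_space) (auto intro: lborel.sigma_finite_measure_axioms)

text \<open>Plays the part of polar coordinates: averaging over rotations turns an inequality on
  every circle into one for area integrals with a radial weight. Only rotation invariance and Fubini
  are involved.\<close>

lemma nn_integral_disk_average:
  assumes F: "F \<in> borel_measurable dA"
  shows "(\<integral>\<^sup>+z. F z \<partial>dA) = (\<integral>\<^sup>+z. (\<integral>\<^sup>+t\<in>{0..1}. F (circle_param t * z) \<partial>lborel) \<partial>dA)"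
proof -
  interpret D: sigma_finite_measure dA by (rule sigma_finite_disk_measure)
  interpret P: pair_sigma_finite dA "lborel :: real measure" ..
  have rot: "(\<lambda>(z, t). circle_param t * z) \<in> measurable (dA \<Otimes>\<^sub>M lborel) dA"
  proof -
    have "(\<lambda>x. x) \<in> borel_measurable dA"
      by (intro measurable_disk_measureI continuous_intros)
    then have "fst \<in> borel_measurable (dA \<Otimes>\<^sub>M (lborel :: real measure))"
      using measurable_compose[OF measurable_fst] by blast
    moreover have "(\<lambda>x. circle_param (snd x)) \<in> borel_measurable (dA \<Otimes>\<^sub>M lborel)"
      by measurable
    ultimately have "(\<lambda>x. circle_param (snd x) * fst x) \<in> borel_measurable (dA \<Otimes>\<^sub>M lborel)"
      by (intro borel_measurable_times)
    then have "(\<lambda>x. circle_param (snd x) * fst x) \<in> measurable (dA \<Otimes>\<^sub>M lborel) (restrict_space borel disk)"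
      by (intro measurable_restrict_space2) (auto simp: space_pair_measure norm_mult)
    then show ?thesis
      by (simp add: case_prod_beta measurable_cong_sets[OF refl sets_disk_measure])
  qed
  have m: "(\<lambda>(z, t). F (circle_param t * z) * indicator {0..1} t) \<in> borel_measurable (dA \<Otimes>\<^sub>M lborel)"
  proof -
    have "(\<lambda>x. F (circle_param (snd x) * fst x)) \<in> borel_measurable (dA \<Otimes>\<^sub>M lborel)"
      using measurable_compose[OF rot F] by (simp add: case_prod_beta)
    then show ?thesis unfolding case_prod_beta by measurable
  qed
  have "(\<integral>\<^sup>+z. (\<integral>\<^sup>+t. F (circle_param t * z) * indicator {0..1} t \<partial>lborel) \<partial>dA) =
    (\<integral>\<^sup>+t. (\<integral>\<^sup>+z. F (circle_param t * z) * indicator {0..1} t \<partial>dA) \<partial>lborel)"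
    using P.Fubini'[OF m] by simp
  also have "\<dots> = (\<integral>\<^sup>+t. (\<integral>\<^sup>+z. F z \<partial>dA) * indicator {0..1} t \<partial>(lborel :: real measure))"
    using nn_integral_disk_rotate[OF norm_circle_param F]
    by (intro nn_integral_cong) (auto simp: indicator_def)
  also have "\<dots> = (\<integral>\<^sup>+z. F z \<partial>dA)"
    by (subst nn_integral_cmult_indicator) auto
  finally show ?thesis by simp
qed

lemma bergman_measurable:
  assumes "continuous_on disk g" "v \<in> borel_measurable borel"
  shows "(\<lambda>z. ennreal (norm (g z) powr p * v (norm z))) \<in> borel_measurable dA"
proof -
  have [measurable]: "g \<in> borel_measurable dA" "norm \<in> borel_measurable dA"
    by (intro measurable_disk_measureI assms(1) continuous_intros)+
  note [measurable] = assms(2)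
  show ?thesis by measurable
qed

lemma littlewood_strict:
  assumes h: "h holomorphic_on disk" and \<psi>: "\<psi> holomorphic_on disk" "\<psi> 0 = 0"
    and l: "\<And>z. z \<in> disk \<Longrightarrow> norm (\<psi> z) \<le> l * norm z" "0 \<le> l" "l < 1"
    and p: "1 < p" and v: "v \<in> borel_measurable borel" "\<And>x. 0 \<le> v x"
  shows "(\<integral>\<^sup>+z. ennreal (norm (h (\<psi> z)) powr p * v (norm z)) \<partial>dA) \<le>
         (\<integral>\<^sup>+z. ennreal (norm (h z) powr p * v (norm z)) \<partial>dA)"
proof -
  have sub: "\<psi> z \<in> disk" if "z \<in> disk" for z
  proof -
    have "norm (\<psi> z) \<le> l * norm z" by (rule l(1)[OF that])
    also have "\<dots> \<le> norm z" using l by (intro mult_left_le_one_le) auto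
    finally show ?thesis using that by simp
  qed
  have ch: "continuous_on disk h" "continuous_on disk \<psi>"
    using h \<psi> by (auto intro: holomorphic_on_imp_continuous_on)
  have ch\<psi>: "continuous_on disk (\<lambda>z. h (\<psi> z))"
    by (rule continuous_on_compose2[OF ch]) (use sub in auto)
  have circ: "(\<integral>\<^sup>+t\<in>{0..1}. ennreal (norm (h (\<psi> (circle_param t * z))) powr p) \<partial>lborel) \<le>
      (\<integral>\<^sup>+t\<in>{0..1}. ennreal (norm (h (circle_param t * z)) powr p) \<partial>lborel)" if z: "z \<in> disk" for z
  proof (cases "z = 0")
    case False
    \<comment> \<open>The averaged circle starts at \<open>z\<close>, the one in
      \<open>circle_subordination\<close> at \<open>norm z\<close>. Conjugation by the rotation
      \<open>u\<close> matches the starting points and keeps the contraction bound.\<close>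
    define u where "u = z / of_real (norm z)"
    have u: "norm u = 1" "z = u * of_real (norm z)" using False by (auto simp: u_def norm_divide)
    have u0: "u \<noteq> 0" using u by auto
    note R = rotation_disk_selfmap[OF u(1)]
    have "(\<integral>\<^sup>+t\<in>{0..1}. ennreal (norm ((\<lambda>x. h (u * x)) ((\<lambda>x. \<psi> (u * x) / u) (of_real (norm z) * circle_param t))) powr p) \<partial>lborel) \<le>
         (\<integral>\<^sup>+t\<in>{0..1}. ennreal (norm ((\<lambda>x. h (u * x)) (of_real (norm z) * circle_param t)) powr p) \<partial>lborel)"
    proof (rule circle_subordination)
      have "(h \<circ> (\<lambda>x. u * x)) holomorphic_on disk"
        by (rule holomorphic_on_compose_gen[OF R(1) h]) (use R(3) in auto)
      then show "(\<lambda>x. h (u * x)) holomorphic_on disk" by (simp add: comp_def)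
      have "(\<psi> \<circ> (\<lambda>x. u * x)) holomorphic_on disk"
        by (rule holomorphic_on_compose_gen[OF R(1) \<psi>(1)]) (use R(3) in auto)
      then show "(\<lambda>x. \<psi> (u * x) / u) holomorphic_on disk"
        using u0 by (auto simp: comp_def intro!: holomorphic_intros)
      show "norm (\<psi> (u * x) / u) \<le> l * norm x" if "x \<in> disk" for x
        using l(1)[of "u * x"] that u by (auto simp: norm_divide norm_mult)
    qed (use \<psi> l p z False in auto)
    moreover have "u * (of_real (norm z) * circle_param t) = circle_param t * z" for t
      by (subst (2) u(2)) (simp add: mult_ac)
    ultimately show ?thesis using u0 by simp
  qed (simp add: \<psi>)
  have "(\<integral>\<^sup>+z. ennreal (norm (h (\<psi> z)) powr p * v (norm z)) \<partial>dA) =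
    (\<integral>\<^sup>+z. (\<integral>\<^sup>+t\<in>{0..1}. ennreal (norm (h (\<psi> (circle_param t * z))) powr p * v (norm (circle_param t * z))) \<partial>lborel) \<partial>dA)"
    by (rule nn_integral_disk_average) (rule bergman_measurable[OF ch\<psi> v(1)])
  also have "\<dots> \<le> (\<integral>\<^sup>+z. (\<integral>\<^sup>+t\<in>{0..1}. ennreal (norm (h (circle_param t * z)) powr p * v (norm (circle_param t * z))) \<partial>lborel) \<partial>dA)"
  proof (rule nn_integral_mono)
    fix z assume "z \<in> space dA"
    then have z: "z \<in> disk" by simp
    have inD: "circle_param t * z \<in> disk" for t using z by (simp add: norm_mult)
    have cc: "continuous_on UNIV (\<lambda>t. circle_param t * z)" by (intro continuous_intros)
    have [measurable]: "(\<lambda>t. h (circle_param t * z)) \<in> borel_measurable borel"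
      "(\<lambda>t. h (\<psi> (circle_param t * z))) \<in> borel_measurable borel"
      by (intro borel_measurable_continuous_onI continuous_on_compose2[OF ch(1) cc]
          continuous_on_compose2[OF ch\<psi> cc]; use inD in auto)+
    have *: "(\<integral>\<^sup>+t\<in>{0..1}. ennreal (norm (k t) powr p * v (norm (circle_param t * z))) \<partial>lborel) =
       ennreal (v (norm z)) * (\<integral>\<^sup>+t\<in>{0..1}. ennreal (norm (k t) powr p) \<partial>lborel)"
      if [measurable]: "k \<in> borel_measurable borel" for k :: "real \<Rightarrow> complex"
      by (subst nn_integral_cmult[symmetric])
         (auto intro!: nn_integral_cong simp: norm_mult ennreal_mult v indicator_def mult.commute)
    show "(\<integral>\<^sup>+t\<in>{0..1}. ennreal (norm (h (\<psi> (circle_param t * z))) powr p * v (norm (circle_param t * z))) \<partial>lborel) \<le>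
       (\<integral>\<^sup>+t\<in>{0..1}. ennreal (norm (h (circle_param t * z)) powr p * v (norm (circle_param t * z))) \<partial>lborel)"
      by (subst (1 2) *) (auto intro!: mult_left_mono circ z)
  qed
  also have "\<dots> = (\<integral>\<^sup>+z. ennreal (norm (h z) powr p * v (norm z)) \<partial>dA)"
    by (rule nn_integral_disk_average[symmetric]) (rule bergman_measurable[OF ch(1) v(1)])
  finally show ?thesis .
qed

text \<open>Multiplying \<open>\<psi>\<close> by \<open>l n < 1\<close> gives the strict contraction
  needed on circles, since the Schwarz lemma alone allows equality; Fatou's lemma then removes the
  factor.\<close>

theorem littlewood_subordination:
  assumes h: "h holomorphic_on disk" and \<psi>: "disk_selfmap \<psi>" "\<psi> 0 = 0"
    and p: "1 < p" and v: "v \<in> borel_measurable borel" "\<And>x. 0 \<le> v x"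
  shows "(\<integral>\<^sup>+z. ennreal (norm (h (\<psi> z)) powr p * v (norm z)) \<partial>dA) \<le>
         (\<integral>\<^sup>+z. ennreal (norm (h z) powr p * v (norm z)) \<partial>dA)"
    (is "_ \<le> ?R")
proof -
  interpret disk_selfmap \<psi> by (rule \<psi>)
  define l where "l n = 1 - 1 / real (n + 2)" for n
  have l: "0 \<le> l n" "l n < 1" for n by (auto simp: l_def field_simps)
  have lim_l: "l \<longlonglongrightarrow> 1"
    unfolding l_def using tendsto_diff[OF tendsto_const LIMSEQ_ignore_initial_segment[OF lim_1_over_n, of 2], of 1]
    by simp
  define F where "F n z = ennreal (norm (h (of_real (l n) * \<psi> z)) powr p * v (norm z))" for n z
  have sch: "norm (\<psi> z) \<le> norm z" if "z \<in> disk" for z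
    by (rule Schwarz_Lemma(1)[OF holo \<psi>(2)]) (use that in auto)
  have sub: "of_real (l n) * \<psi> z \<in> disk" if "z \<in> disk" for z n
  proof -
    have "norm (of_real (l n) * \<psi> z) \<le> norm (\<psi> z)"
      using l[of n] by (simp add: norm_mult mult_left_le_one_le)
    also have "\<dots> < 1" using that in_disk by simp
    finally show ?thesis by simp
  qed
  have ch: "continuous_on disk h"
    using h by (rule holomorphic_on_imp_continuous_on)
  have c\<psi>: "continuous_on disk \<psi>"
    using holo by (rule holomorphic_on_imp_continuous_on)
  have meas: "F n \<in> borel_measurable dA" for n
    unfolding F_def
    by (intro bergman_measurable v continuous_on_compose2[OF ch] continuous_intros c\<psi>) (use sub in auto)
  have le: "(\<integral>\<^sup>+z. F n z \<partial>dA) \<le> ?R" for n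
    unfolding F_def
  proof (rule littlewood_strict[OF h _ _ _ _ _ p v])
    show "(\<lambda>z. of_real (l n) * \<psi> z) holomorphic_on disk" by (intro holomorphic_intros holo)
    show "norm (of_real (l n) * \<psi> z) \<le> l n * norm z" if "z \<in> disk" for z
      using l[of n] sch[OF that] by (auto simp: norm_mult intro!: mult_left_mono)
  qed (use \<psi> l in auto)
  have lim: "liminf (\<lambda>n. F n z) = ennreal (norm (h (\<psi> z)) powr p * v (norm z))" if z: "z \<in> disk" for z
  proof (rule lim_imp_Liminf)
    have "(\<lambda>n. of_real (l n) * \<psi> z) \<longlonglongrightarrow> of_real 1 * \<psi> z"
      by (intro tendsto_intros lim_l)
    then have "(\<lambda>n. h (of_real (l n) * \<psi> z)) \<longlonglongrightarrow> h (\<psi> z)"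
      using ch z sub by (intro continuous_on_tendsto_compose[OF ch]) (auto intro!: always_eventually)
    then show "(\<lambda>n. F n z) \<longlonglongrightarrow> ennreal (norm (h (\<psi> z)) powr p * v (norm z))"
      unfolding F_def using p by (intro tendsto_intros) auto
  qed simp
  have "(\<integral>\<^sup>+z. ennreal (norm (h (\<psi> z)) powr p * v (norm z)) \<partial>dA) = (\<integral>\<^sup>+z. liminf (\<lambda>n. F n z) \<partial>dA)"
    by (intro nn_integral_cong) (simp add: lim)
  also have "\<dots> \<le> liminf (\<lambda>n. \<integral>\<^sup>+z. F n z \<partial>dA)"
    by (rule nn_integral_liminf) (rule meas)
  also have "\<dots> \<le> liminf (\<lambda>n. ?R)"
    by (intro Liminf_mono always_eventually allI le)
  also have "\<dots> = ?R" by (simp add: Liminf_const)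
  finally show ?thesis .
qed

section \<open>Weighted energies\<close>

locale admissible_params =
  fixes p s \<alpha> :: real
  assumes adm: "admissible p s \<alpha>"
begin

definition q :: real where "q = s - p + 2"

lemma params: "1 < p" "0 < p" "0 \<le> s" "0 < q" "0 \<le> \<alpha>" "\<alpha> * p < q"
proof -
  show "1 < p" and a: "0 \<le> \<alpha>" and p: "0 < p" using adm by (auto simp: admissible_def)
  have "\<alpha> < (s - (p - 2)) / p" using adm by (auto simp: admissible_def)
  then show *: "\<alpha> * p < q"
    using p by (simp add: q_def field_simps)
  show "0 \<le> s" using adm by (auto simp: admissible_def)
  have "0 \<le> \<alpha> * p" using a p by simp
  then show "0 < q" using * by linarith
qed

definition density :: "(complex \<Rightarrow> complex) \<Rightarrow> complex \<Rightarrow> complex \<Rightarrow> real" where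
  "density f a z = norm (deriv f z) powr p * (1 - (norm z)\<^sup>2) powr s * aut_jac a z powr q"

text \<open>Taking values in \<open>ennreal\<close> frees the estimates from integrability
  conditions; the set \<open>E\<close> serves to separate the part near the circle from the part
  inside.\<close>

definition energy_on :: "complex set \<Rightarrow> (complex \<Rightarrow> complex) \<Rightarrow> complex \<Rightarrow> ennreal" where
  "energy_on E f a = (\<integral>\<^sup>+z\<in>E. ennreal (density f a z) \<partial>dA)"

abbreviation energy :: "(complex \<Rightarrow> complex) \<Rightarrow> complex \<Rightarrow> ennreal" where
  "energy \<equiv> energy_on UNIV"

lemma density_nonneg [simp]: "0 \<le> density f a z"
  by (simp add: density_def)

lemma continuous_density:
  assumes "f holomorphic_on disk" "a \<in> disk"
  shows "continuous_on disk (density f a)"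
proof -
  have 1: "continuous_on disk (deriv f)"
    using assms(1) by (intro holomorphic_on_imp_continuous_on holomorphic_deriv) auto
  have 2: "continuous_on disk (aut_jac a)"
    unfolding aut_jac_def[abs_def]
    by (intro continuous_intros) (use one_minus_cnj_mult_nz[OF assms(2)] in auto)
  show ?thesis
    unfolding density_def[abs_def]
  proof (intro continuous_on_mult)
    show "continuous_on disk (\<lambda>z. norm (deriv f z) powr p)"
      using params by (intro continuous_on_powr' continuous_intros 1) auto
    show "continuous_on disk (\<lambda>z. (1 - (norm z)\<^sup>2) powr s)"
      using one_minus_norm_sq_pos by (intro continuous_on_powr continuous_intros) force+
    show "continuous_on disk (\<lambda>z. aut_jac a z powr q)"
      using aut_jac_pos[OF assms(2)] by (intro continuous_on_powr continuous_intros 2) force+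
  qed
qed

lemma density_measurable:
  assumes "f holomorphic_on disk" "a \<in> disk"
  shows "density f a \<in> borel_measurable dA"
  by (intro measurable_disk_measureI continuous_density assms)

lemma indicator_disk_measurable:
  "E \<in> sets borel \<Longrightarrow> (indicator E :: complex \<Rightarrow> ennreal) \<in> borel_measurable dA"
  by (rule measurable_borel_disk_measure) simp

lemma energy_on_measurable:
  assumes "f holomorphic_on disk" "a \<in> disk" "E \<in> sets borel"
  shows "(\<lambda>z. ennreal (density f a z) * indicator E z) \<in> borel_measurable dA"
  using density_measurable[OF assms(1,2)] indicator_disk_measurable[OF assms(3)] by measurable

lemma energy_on_mono:
  assumes "E \<inter> disk \<subseteq> E'"
  shows "energy_on E f a \<le> energy_on E' f a"
  unfolding energy_on_def
  by (rule nn_integral_mono) (use assms in \<open>auto simp: indicator_def\<close>)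

lemma energy_on_le_energy: "energy_on E f a \<le> energy f a"
  by (rule energy_on_mono) auto

lemma energy_on_split:
  assumes "f holomorphic_on disk" "a \<in> disk" "E \<in> sets borel"
  shows "energy f a = energy_on E f a + energy_on (- E) f a"
proof -
  have "energy f a = (\<integral>\<^sup>+z. (ennreal (density f a z) * indicator E z + ennreal (density f a z) * indicator (- E) z) \<partial>dA)"
    unfolding energy_on_def by (intro nn_integral_cong) (simp add: indicator_def)
  also have "\<dots> = energy_on E f a + energy_on (- E) f a"
    unfolding energy_on_def using assms by (intro nn_integral_add energy_on_measurable) auto
  finally show ?thesis .
qed

text \<open>The crude \<open>(x + y) powr p \<le> 2 powr p * (x powr p + y powr p)\<close> stands in
  for Minkowski's inequality; the constant is harmless for boundedness and for limits.\<close>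

lemma energy_on_add:
  assumes "f holomorphic_on disk" "g holomorphic_on disk" "a \<in> disk" "E \<in> sets borel"
  shows "energy_on E (\<lambda>z. f z + g z) a \<le> ennreal (2 powr p) * (energy_on E f a + energy_on E g a)"
proof -
  have "energy_on E (\<lambda>z. f z + g z) a \<le>
     (\<integral>\<^sup>+z. ennreal (2 powr p) * (ennreal (density f a z) * indicator E z + ennreal (density g a z) * indicator E z) \<partial>dA)"
    unfolding energy_on_def
  proof (rule nn_integral_mono)
    fix z assume "z \<in> space dA"
    then have z: "z \<in> disk" by simp
    have d: "deriv (\<lambda>z. f z + g z) z = deriv f z + deriv g z"
      using assms(1,2) z by (intro deriv_add holomorphic_on_imp_differentiable_at[of _ disk]) auto
    define x where "x = norm (deriv f z)"
    define y where "y = norm (deriv g z)"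
    have xy: "0 \<le> x" "0 \<le> y" by (auto simp: x_def y_def)
    have "norm (deriv f z + deriv g z) powr p \<le> (2 * max x y) powr p"
      using norm_triangle_ineq[of "deriv f z" "deriv g z"] params
      by (intro powr_mono2) (auto simp: x_def y_def)
    also have "\<dots> = 2 powr p * max x y powr p"
      using xy by (simp add: powr_mult)
    also have "\<dots> \<le> 2 powr p * (x powr p + y powr p)"
      by (intro mult_left_mono) (auto simp: max_def)
    finally have "density (\<lambda>z. f z + g z) a z \<le> 2 powr p * (x powr p + y powr p) * (1 - (norm z)\<^sup>2) powr s * aut_jac a z powr q"
      unfolding density_def d by (intro mult_right_mono) auto
    also have "\<dots> = 2 powr p * (density f a z + density g a z)"
      by (simp add: density_def x_def y_def algebra_simps)
    finally have "ennreal (density (\<lambda>z. f z + g z) a z) \<le> ennreal (2 powr p) * (ennreal (density f a z) + ennreal (density g a z))"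
      by (simp add: ennreal_leI flip: ennreal_mult ennreal_plus)
    then show "ennreal (density (\<lambda>z. f z + g z) a z) * indicator E z \<le>
      ennreal (2 powr p) * (ennreal (density f a z) * indicator E z + ennreal (density g a z) * indicator E z)"
      by (auto simp: indicator_def)
  qed
  also have "\<dots> = ennreal (2 powr p) * (energy_on E f a + energy_on E g a)"
    unfolding energy_on_def
    using energy_on_measurable[OF assms(1,3,4)] energy_on_measurable[OF assms(2,3,4)]
    by (simp add: nn_integral_cmult nn_integral_add)
  finally show ?thesis .
qed

lemma energy_on_cmult:
  assumes "f holomorphic_on disk" "a \<in> disk" "E \<in> sets borel"
  shows "energy_on E (\<lambda>z. c * f z) a = ennreal (norm c powr p) * energy_on E f a"
proof -
  have "energy_on E (\<lambda>z. c * f z) a = (\<integral>\<^sup>+z. ennreal (norm c powr p) * (ennreal (density f a z) * indicator E z) \<partial>dA)"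
    unfolding energy_on_def
  proof (rule nn_integral_cong)
    fix z assume "z \<in> space dA"
    then have "deriv (\<lambda>z. c * f z) z = c * deriv f z"
      using assms(1) by (intro deriv_cmult holomorphic_on_imp_differentiable_at[of _ disk]) auto
    then have "density (\<lambda>z. c * f z) a z = norm c powr p * density f a z"
      by (simp add: density_def norm_mult powr_mult)
    then show "ennreal (density (\<lambda>z. c * f z) a z) * indicator E z = ennreal (norm c powr p) * (ennreal (density f a z) * indicator E z)"
      by (simp add: ennreal_mult mult.assoc)
  qed
  also have "\<dots> = ennreal (norm c powr p) * energy_on E f a"
    unfolding energy_on_def by (rule nn_integral_cmult[OF energy_on_measurable[OF assms]])
  finally show ?thesis .
qed

lemma energy_on_cong:
  assumes "\<And>z. z \<in> disk \<Longrightarrow> f z = g z"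
  shows "energy_on E f a = energy_on E g a"
  unfolding energy_on_def density_def
proof (intro nn_integral_cong)
  fix z assume "z \<in> space dA"
  then have "eventually (\<lambda>w. w \<in> disk) (nhds z)" by (intro eventually_nhds_in_open) auto
  then have "deriv f z = deriv g z"
    by (intro deriv_cong_ev) (auto elim!: eventually_mono simp: assms)
  then show "ennreal (norm (deriv f z) powr p * (1 - (norm z)\<^sup>2) powr s * aut_jac a z powr q) * indicator E z =
      ennreal (norm (deriv g z) powr p * (1 - (norm z)\<^sup>2) powr s * aut_jac a z powr q) * indicator E z"
    by simp
qed

section \<open>Energies under composition with automorphisms and univalent maps\<close>

lemma deriv_compose_selfmap:
  assumes "disk_selfmap \<phi>" "f holomorphic_on disk" "z \<in> disk"
  shows "deriv (\<lambda>z. f (\<phi> z)) z = deriv f (\<phi> z) * deriv \<phi> z"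
proof -
  interpret disk_selfmap \<phi> by (rule assms(1))
  have "(f has_field_derivative deriv f (\<phi> z)) (at (\<phi> z))"
    using assms by (intro holomorphic_derivI[of _ disk]) auto
  then have "((f \<circ> \<phi>) has_field_derivative deriv f (\<phi> z) * deriv \<phi> z) (at z)"
    using has_deriv[OF assms(3)] by (rule DERIV_chain)
  then show ?thesis by (simp add: DERIV_imp_deriv comp_def)
qed

lemma holomorphic_compose_selfmap:
  assumes "disk_selfmap \<phi>" "f holomorphic_on disk"
  shows "(\<lambda>z. f (\<phi> z)) holomorphic_on disk"
proof -
  interpret disk_selfmap \<phi> by (rule assms(1))
  have "(f \<circ> \<phi>) holomorphic_on disk"
    by (rule holomorphic_on_compose_gen[OF holo assms(2) maps])
  then show ?thesis by (simp add: comp_def)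
qed

lemma disk_aut_selfmap: "a \<in> disk \<Longrightarrow> disk_selfmap (disk_aut a)"
  by unfold_locales (auto simp: disk_aut_holomorphic disk_aut_image)

lemma energy_shift:
  assumes f: "f holomorphic_on disk" and b: "b \<in> disk"
  shows "(\<integral>\<^sup>+z. ennreal (norm (deriv f (disk_aut b z) * deriv (disk_aut b) z) powr p * (1 - (norm z)\<^sup>2) powr s) \<partial>dA) = energy f b"
proof -
  have "(\<integral>\<^sup>+z. ennreal (norm (deriv f (disk_aut b z) * deriv (disk_aut b) z) powr p * (1 - (norm z)\<^sup>2) powr s) \<partial>dA)
    = (\<integral>\<^sup>+z. ennreal (density f b (disk_aut b z)) * ennreal ((norm (deriv (disk_aut b) z))\<^sup>2) \<partial>dA)"
  proof (rule nn_integral_cong)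
    fix z assume "z \<in> space dA"
    then have z: "z \<in> disk" by simp
    define J where "J = aut_jac b z"
    have J: "0 < J" using aut_jac_pos[OF b z] by (simp add: J_def)
    have J': "aut_jac b (disk_aut b z) = 1 / J"
      using aut_jac_disk_aut[OF b z] J by (simp add: J_def field_simps)
    have y: "1 - (norm (disk_aut b z))\<^sup>2 = (1 - (norm z)\<^sup>2) * J"
      using one_minus_disk_aut_sq[OF one_minus_cnj_mult_nz[OF b z]] by (simp add: J_def)
    \<comment> \<open>The exponent \<open>q\<close> is chosen exactly so that
      \<open>s - q + 2 = p\<close>; the 2 comes from the area element.\<close>
    have e: "J powr s * (1 / J) powr q * J\<^sup>2 = J powr p"
    proof -
      have "(1 / J) powr q = J powr (- q)" using J by (simp add: powr_minus_divide powr_divide)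
      moreover have "J\<^sup>2 = J powr 2" using J by (simp add: powr_numeral)
      ultimately have "J powr s * (1 / J) powr q * J\<^sup>2 = J powr (s + - q + 2)"
        by (simp only: powr_add)
      then show ?thesis by (simp add: q_def)
    qed
    have "density f b (disk_aut b z) * J\<^sup>2 =
      norm (deriv f (disk_aut b z)) powr p * (1 - (norm z)\<^sup>2) powr s * (J powr s * (1 / J) powr q * J\<^sup>2)"
      using J one_minus_norm_sq_pos[OF z] by (simp add: density_def y J' powr_mult mult_ac)
    also have "\<dots> = norm (deriv f (disk_aut b z) * deriv (disk_aut b) z) powr p * (1 - (norm z)\<^sup>2) powr s"
      unfolding e using J by (simp add: norm_mult norm_deriv_disk_aut[OF b z] powr_mult J_def mult_ac)
    finally show "ennreal (norm (deriv f (disk_aut b z) * deriv (disk_aut b) z) powr p * (1 - (norm z)\<^sup>2) powr s) =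
      ennreal (density f b (disk_aut b z)) * ennreal ((norm (deriv (disk_aut b) z))\<^sup>2)"
      by (simp add: norm_deriv_disk_aut[OF b z] J_def flip: ennreal_mult)
  qed
  also have "\<dots> = (\<integral>\<^sup>+w. ennreal (density f b w) * indicator (disk_aut b ` disk) w \<partial>dA)"
    by (rule nn_integral_disk_selfmap)
       (use b f disk_aut_holomorphic inj_on_disk_aut disk_aut_image density_measurable in auto)
  also have "\<dots> = energy f b"
    unfolding energy_on_def by (intro nn_integral_cong) (simp add: disk_aut_image[OF b])
  finally show ?thesis .
qed

text \<open>Since \<open>s = (p - 2) + q\<close>, the weight splits into the factors
  \<open>(d * y) powr (p - 2)\<close> and \<open>(y * J) powr q\<close>, with
  \<open>d\<^sup>2\<close> left over for the area formula. Each factor is governed by one form of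
  Schwarz-Pick, the first because \<open>p - 2\<close> is not negative.\<close>

lemma density_compose_ge_2:
  assumes \<phi>: "disk_selfmap \<phi>" and f: "f holomorphic_on disk" and az: "a \<in> disk" "z \<in> disk" and p2: "2 \<le> p"
  shows "density (\<lambda>z. f (\<phi> z)) a z \<le> density f (\<phi> a) (\<phi> z) * (norm (deriv \<phi> z))\<^sup>2"
proof -
  interpret disk_selfmap \<phi> by (rule \<phi>)
  define A where "A = norm (deriv f (\<phi> z)) powr p"
  define d where "d = norm (deriv \<phi> z)"
  define y where "y = 1 - (norm z)\<^sup>2"
  define Y where "Y = 1 - (norm (\<phi> z))\<^sup>2"
  define J where "J = aut_jac a z"
  define J' where "J' = aut_jac (\<phi> a) (\<phi> z)"
  have d: "\<phi> a \<in> disk" "\<phi> z \<in> disk" using az by auto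
  have pos: "0 \<le> A" "0 \<le> d" "0 < y" "0 < Y" "0 < J" "0 < J'"
    using az d one_minus_norm_sq_pos aut_jac_pos by (auto simp: A_def d_def y_def Y_def J_def J'_def)
  have le: "d * y \<le> Y" "y * J \<le> Y * J'"
    using schwarz_pick_deriv[OF az(2)] schwarz_pick_jac[OF az]
    by (auto simp: d_def y_def Y_def J_def J'_def)
  have ps: "x powr s = x powr (p - 2) * x powr q" if "0 < x" for x
    by (simp add: powr_add[symmetric] q_def)
  have dp: "d powr p = d\<^sup>2 * d powr (p - 2)"
  proof (cases "d = 0")
    case False
    then have "d powr p = d powr 2 * d powr (p - 2)" by (simp add: powr_add[symmetric])
    also have "d powr 2 = d\<^sup>2" using False pos by (simp add: powr_numeral)
    finally show ?thesis .
  qed simp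
  have "density (\<lambda>z. f (\<phi> z)) a z = A * d powr p * y powr s * J powr q"
    by (simp add: density_def deriv_compose_selfmap[OF \<phi> f az(2)] norm_mult powr_mult A_def d_def y_def J_def)
  also have "\<dots> = A * d\<^sup>2 * ((d * y) powr (p - 2) * (y * J) powr q)"
    using pos unfolding dp by (simp add: powr_mult ps mult_ac)
  also have "\<dots> \<le> A * d\<^sup>2 * (Y powr (p - 2) * (Y * J') powr q)"
  proof (intro mult_left_mono mult_mono)
    show "(d * y) powr (p - 2) \<le> Y powr (p - 2)" "(y * J) powr q \<le> (Y * J') powr q"
      using pos le p2 params by (auto intro!: powr_mono2)
  qed (use pos in auto)
  also have "\<dots> = density f (\<phi> a) (\<phi> z) * d\<^sup>2"
    using pos unfolding density_def Y_def[symmetric] J'_def[symmetric] A_def[symmetric]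
    by (simp add: powr_mult ps mult_ac)
  finally show ?thesis by (simp add: d_def)
qed

text \<open>The error term \<open>transfer\<close> carries the part of the integrand where \<open>norm (deriv \<phi> z)\<close> is too small
  for its \<open>p\<close>-th power to be dominated by its square when \<open>p < 2\<close>.\<close>

definition transfer :: "(complex \<Rightarrow> complex) \<Rightarrow> (complex \<Rightarrow> complex) \<Rightarrow> complex \<Rightarrow> complex \<Rightarrow> real" where
  "transfer \<phi> f a z = norm (deriv f (\<phi> z)) powr p * ((1 - (norm z)\<^sup>2) * aut_jac a z) powr s
     * aut_jac (\<phi> a) (\<phi> z) powr (- p) * (aut_jac a z)\<^sup>2"

text \<open>The power \<open>g powr p\<close> is at most \<open>L powr p\<close> where
  \<open>g \<le> L\<close>, and at most \<open>L powr (p - 2) * g\<^sup>2\<close> where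
  \<open>g > L\<close>, because the exponent \<open>p - 2\<close> is negative. The second
  alternative is ready for the area formula, the first for Littlewood.\<close>

lemma density_compose_less_2:
  assumes \<phi>: "disk_selfmap \<phi>" and f: "f holomorphic_on disk" and az: "a \<in> disk" "z \<in> disk"
    and p2: "p < 2" and L: "0 < L"
  shows "density (\<lambda>z. f (\<phi> z)) a z \<le>
    L powr (p - 2) * (density f (\<phi> a) (\<phi> z) * (norm (deriv \<phi> z))\<^sup>2) + L powr p * transfer \<phi> f a z"
proof -
  interpret disk_selfmap \<phi> by (rule \<phi>)
  define A where "A = norm (deriv f (\<phi> z)) powr p"
  define d where "d = norm (deriv \<phi> z)"
  define y where "y = 1 - (norm z)\<^sup>2"
  define Y where "Y = 1 - (norm (\<phi> z))\<^sup>2"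
  define J where "J = aut_jac a z"
  define J' where "J' = aut_jac (\<phi> a) (\<phi> z)"
  have d: "\<phi> a \<in> disk" "\<phi> z \<in> disk" using az by auto
  have pos: "0 \<le> A" "0 \<le> d" "0 < y" "0 < Y" "0 < J" "0 < J'"
    using az d one_minus_norm_sq_pos aut_jac_pos by (auto simp: A_def d_def y_def Y_def J_def J'_def)
  have le: "y * J \<le> Y * J'"
    using schwarz_pick_jac[OF az] by (auto simp: d_def y_def Y_def J_def J'_def)
  have xq: "x powr q = x powr s * x\<^sup>2 / x powr p" if "0 < x" for x
    using that by (simp add: q_def powr_add powr_diff powr_numeral)
  \<comment> \<open>By the chain rule, the modulus of the derivative at \<open>disk_aut a z\<close>
    of the map conjugated to fix the origin.\<close>
  define g where "g = d * J' / J"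
  have g: "0 \<le> g" using pos by (simp add: g_def)
  define B where "B = A * (y * J) powr s * J' powr (- p) * J\<^sup>2"
  have B: "0 \<le> B" using pos by (simp add: B_def)
  have J2: "x\<^sup>2 = x powr 2" if "0 < x" for x :: real using that by (simp add: powr_numeral)
  have "density (\<lambda>z. f (\<phi> z)) a z = A * d powr p * y powr s * J powr q"
    by (simp add: density_def deriv_compose_selfmap[OF \<phi> f az(2)] norm_mult powr_mult A_def d_def y_def J_def)
  also have "\<dots> = B * g powr p"
    using pos unfolding B_def g_def xq[OF pos(5)]
    by (simp add: powr_mult powr_divide powr_minus_divide)
  also have "\<dots> \<le> B * (L powr (p - 2) * g\<^sup>2 + L powr p)"
  proof (intro mult_left_mono B)
    show "g powr p \<le> L powr (p - 2) * g\<^sup>2 + L powr p"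
    proof (cases "g \<le> L")
      case True
      then have "g powr p \<le> L powr p" using g params by (intro powr_mono2) auto
      then show ?thesis by (simp add: add_increasing)
    next
      case False
      then have "g powr p = g powr (p - 2) * g\<^sup>2"
        using L by (simp add: J2 powr_add[symmetric] del: powr_numeral)
      also have "\<dots> \<le> L powr (p - 2) * g\<^sup>2"
        using False L p2 by (intro mult_right_mono powr_mono2') auto
      finally show ?thesis by (simp add: add_increasing2)
    qed
  qed
  also have "\<dots> = L powr (p - 2) * (B * g\<^sup>2) + L powr p * transfer \<phi> f a z"
    by (simp add: transfer_def B_def A_def y_def J_def J'_def algebra_simps)
  also have "B * g\<^sup>2 \<le> density f (\<phi> a) (\<phi> z) * d\<^sup>2"
  proof -
    have "B * g\<^sup>2 = A * (y * J) powr s * (J' powr (- p) * J'\<^sup>2) * d\<^sup>2"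
      using pos by (simp add: B_def g_def field_simps)
    also have "\<dots> \<le> A * (Y * J') powr s * (J' powr (- p) * J'\<^sup>2) * d\<^sup>2"
      using pos le params by (intro mult_right_mono mult_left_mono powr_mono2) auto
    also have "\<dots> = A * Y powr s * J' powr q * d\<^sup>2"
      using pos by (simp add: powr_mult xq powr_minus_divide)
    also have "\<dots> = density f (\<phi> a) (\<phi> z) * d\<^sup>2"
      by (simp add: density_def A_def Y_def J'_def)
    finally show ?thesis .
  qed
  finally show ?thesis
    using L by (simp add: d_def mult_left_mono)
qed

text \<open>In the coordinate \<open>disk_aut a z\<close> the term \<open>transfer\<close> becomes a
  power of \<open>h \<circ> \<psi>\<close> against a radial weight, with \<open>\<psi>\<close>
  fixing the origin. Littlewood drops \<open>\<psi>\<close>, and \<open>energy_shift\<close>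
  recognises what is left as the energy at \<open>\<phi> a\<close>.\<close>

lemma nn_integral_transfer_le:
  assumes \<phi>: "disk_selfmap \<phi>" and f: "f holomorphic_on disk" and a: "a \<in> disk"
  shows "(\<integral>\<^sup>+z. ennreal (transfer \<phi> f a z) \<partial>dA) \<le> energy f (\<phi> a)"
    and "(\<lambda>z. ennreal (transfer \<phi> f a z)) \<in> borel_measurable dA"
proof -
  interpret disk_selfmap \<phi> by (rule \<phi>)
  define b where "b = \<phi> a"
  have b: "b \<in> disk" using a by (auto simp: b_def)
  define \<psi> where "\<psi> = (\<lambda>u. disk_aut (\<phi> a) (\<phi> (disk_aut a u)))"
  note conj = conjugate_selfmap[OF a, folded \<psi>_def b_def]
  interpret \<psi>: disk_selfmap \<psi> by (rule conj)
  define h where "h v = deriv f (disk_aut b v) * deriv (disk_aut b) v" for v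
  have h: "h holomorphic_on disk"
  proof -
    have "(\<lambda>v. deriv f (disk_aut b v)) holomorphic_on disk"
      by (rule holomorphic_compose_selfmap[OF disk_aut_selfmap[OF b]]) (intro holomorphic_deriv f open_ball)
    then show ?thesis unfolding h_def
      by (intro holomorphic_intros holomorphic_deriv disk_aut_holomorphic b open_ball)
  qed
  define v where "v x = (1 - x\<^sup>2) powr s" for x :: real
  have v: "v \<in> borel_measurable borel" "\<And>x. 0 \<le> v x" unfolding v_def by auto
  define H where "H u = ennreal (norm (h (\<psi> u)) powr p * v (norm u))" for u
  have H_meas: "H \<in> borel_measurable dA"
    unfolding H_def[abs_def]
    by (intro bergman_measurable v continuous_on_compose2[OF holomorphic_on_imp_continuous_on[OF h]]
        holomorphic_on_imp_continuous_on[OF \<psi>.holo] \<psi>.maps)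
  have eq: "ennreal (transfer \<phi> f a z) = H (disk_aut a z) * ennreal ((norm (deriv (disk_aut a) z))\<^sup>2)"
    if z: "z \<in> disk" for z
  proof -
    have u: "disk_aut a z \<in> disk" by (rule disk_aut_in_disk[OF a z])
    have \<psi>u: "\<psi> (disk_aut a z) \<in> disk" using u \<psi>.maps by blast
    have \<phi>z: "\<phi> z = disk_aut b (\<psi> (disk_aut a z))"
      using conj(3)[OF u] by (simp add: \<psi>_def b_def disk_aut_involution[OF a z])
    define J where "J = aut_jac b (\<psi> (disk_aut a z))"
    have J: "0 < J" using aut_jac_pos[OF b \<psi>u] by (simp add: J_def)
    have J': "aut_jac b (\<phi> z) = 1 / J"
      using aut_jac_disk_aut[OF b \<psi>u] J by (simp add: J_def \<phi>z field_simps)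
    have "norm (h (\<psi> (disk_aut a z))) powr p = norm (deriv f (\<phi> z)) powr p * aut_jac b (\<phi> z) powr (- p)"
      using J unfolding h_def \<phi>z[symmetric] J'
      by (simp add: norm_mult norm_deriv_disk_aut[OF b \<psi>u] powr_mult J_def[symmetric] powr_minus powr_divide)
    then have "transfer \<phi> f a z = norm (h (\<psi> (disk_aut a z))) powr p * v (norm (disk_aut a z)) * (norm (deriv (disk_aut a) z))\<^sup>2"
      by (simp add: transfer_def v_def b_def one_minus_disk_aut_sq[OF one_minus_cnj_mult_nz[OF a z]]
          norm_deriv_disk_aut[OF a z])
    then show ?thesis by (simp add: H_def ennreal_mult v)
  qed
  have aut: "(\<lambda>z. disk_aut a z) \<in> measurable dA dA"
    using disk_aut_image[OF a] disk_aut_holomorphic[OF a]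
    by (intro measurable_disk_measure_selfmap holomorphic_on_imp_continuous_on) auto
  have dm: "deriv (disk_aut a) \<in> borel_measurable dA"
    by (intro measurable_disk_measureI holomorphic_on_imp_continuous_on holomorphic_deriv disk_aut_holomorphic a open_ball)
  have "(\<lambda>z. H (disk_aut a z) * ennreal ((norm (deriv (disk_aut a) z))\<^sup>2)) \<in> borel_measurable dA"
    using measurable_compose[OF aut H_meas] dm by measurable
  also have "?this \<longleftrightarrow> (\<lambda>z. ennreal (transfer \<phi> f a z)) \<in> borel_measurable dA"
    by (rule measurable_cong) (simp add: eq)
  finally show "(\<lambda>z. ennreal (transfer \<phi> f a z)) \<in> borel_measurable dA" .
  have "(\<integral>\<^sup>+z. ennreal (transfer \<phi> f a z) \<partial>dA) = (\<integral>\<^sup>+z. H (disk_aut a z) * ennreal ((norm (deriv (disk_aut a) z))\<^sup>2) \<partial>dA)"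
    by (intro nn_integral_cong) (simp add: eq)
  also have "\<dots> = (\<integral>\<^sup>+u. H u * indicator (disk_aut a ` disk) u \<partial>dA)"
    by (rule nn_integral_disk_selfmap)
       (use a disk_aut_holomorphic inj_on_disk_aut disk_aut_image H_meas in auto)
  also have "\<dots> = (\<integral>\<^sup>+u. H u \<partial>dA)"
    by (intro nn_integral_cong) (simp add: disk_aut_image[OF a])
  also have "\<dots> \<le> (\<integral>\<^sup>+u. ennreal (norm (h u) powr p * v (norm u)) \<partial>dA)"
    unfolding H_def
    by (rule littlewood_subordination[OF h conj(1) _ _ v]) (use params in \<open>auto simp: \<psi>_def\<close>)
  also have "\<dots> = energy f b"
    unfolding h_def v_def by (rule energy_shift[OF f b])
  finally show "(\<integral>\<^sup>+z. ennreal (transfer \<phi> f a z) \<partial>dA) \<le> energy f (\<phi> a)"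
    by (simp add: b_def)
qed

lemma nn_integral_density_compose:
  assumes \<phi>: "disk_selfmap \<phi>" "inj_on \<phi> disk" and f: "f holomorphic_on disk" and a: "a \<in> disk"
    and E: "E \<in> sets borel" "G \<in> sets borel" "\<phi> ` (E \<inter> disk) \<subseteq> G"
  shows "(\<integral>\<^sup>+z\<in>E. ennreal (density f (\<phi> a) (\<phi> z) * (norm (deriv \<phi> z))\<^sup>2) \<partial>dA) \<le> energy_on G f (\<phi> a)"
proof -
  interpret disk_selfmap \<phi> by (rule \<phi>)
  have b: "\<phi> a \<in> disk" using a by auto
  have "(\<integral>\<^sup>+z\<in>E. ennreal (density f (\<phi> a) (\<phi> z) * (norm (deriv \<phi> z))\<^sup>2) \<partial>dA) \<le>
     (\<integral>\<^sup>+z. (ennreal (density f (\<phi> a) (\<phi> z)) * indicator G (\<phi> z)) * ennreal ((norm (deriv \<phi> z))\<^sup>2) \<partial>dA)"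
    using E(3) by (intro nn_integral_mono) (force simp: indicator_def ennreal_mult image_subset_iff)
  also have "\<dots> = (\<integral>\<^sup>+w. (ennreal (density f (\<phi> a) w) * indicator G w) * indicator (\<phi> ` disk) w \<partial>dA)"
    by (rule nn_integral_disk_selfmap) (use holo maps \<phi>(2) energy_on_measurable[OF f b E(2)] in auto)
  also have "\<dots> \<le> energy_on G f (\<phi> a)"
    unfolding energy_on_def by (intro nn_integral_mono) (auto simp: indicator_def)
  finally show ?thesis .
qed

text \<open>\<open>L\<close> may be large, but it depends on \<open>\<eta>\<close> alone and not on
  the map, the function or the point. This uniformity is what makes the estimate usable for all
  small times at once.\<close>

lemma energy_on_compose_exists:
  assumes "0 < \<eta>"
  obtains L where "0 < L"
    "\<And>\<phi> f a E G. disk_selfmap \<phi> \<Longrightarrow> inj_on \<phi> disk \<Longrightarrow> f holomorphic_on disk \<Longrightarrow> a \<in> disk \<Longrightarrow>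
      E \<in> sets borel \<Longrightarrow> G \<in> sets borel \<Longrightarrow> \<phi> ` (E \<inter> disk) \<subseteq> G \<Longrightarrow>
      energy_on E (\<lambda>z. f (\<phi> z)) a \<le> ennreal L * energy_on G f (\<phi> a) + ennreal \<eta> * energy f (\<phi> a)"
proof (cases "2 \<le> p")
  case True
  show ?thesis
  proof (rule that[of 1])
    fix \<phi> f a E G
    assume *: "disk_selfmap \<phi>" "inj_on \<phi> disk" "f holomorphic_on disk" "a \<in> disk"
      "E \<in> sets borel" "G \<in> sets borel" "\<phi> ` (E \<inter> disk) \<subseteq> G"
    have "energy_on E (\<lambda>z. f (\<phi> z)) a \<le> (\<integral>\<^sup>+z\<in>E. ennreal (density f (\<phi> a) (\<phi> z) * (norm (deriv \<phi> z))\<^sup>2) \<partial>dA)"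
      unfolding energy_on_def
      by (intro nn_integral_mono mult_right_mono ennreal_leI density_compose_ge_2[OF *(1,3,4) _ True]) auto
    also have "\<dots> \<le> energy_on G f (\<phi> a)"
      by (rule nn_integral_density_compose[OF *])
    finally show "energy_on E (\<lambda>z. f (\<phi> z)) a \<le> ennreal 1 * energy_on G f (\<phi> a) + ennreal \<eta> * energy f (\<phi> a)"
      by (simp add: add_increasing2)
  qed simp
next
  case False
  then have p2: "p < 2" by simp
  \<comment> \<open>Makes the coefficient \<open>l powr p\<close> of the Littlewood term equal to
    \<open>\<eta>\<close>.\<close>
  define l where "l = \<eta> powr (1 / p)"
  have l: "0 < l" "l powr p = \<eta>" using assms params by (auto simp: l_def powr_powr)
  show ?thesis
  proof (rule that[of "l powr (p - 2)"])
    fix \<phi> f a E G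
    assume *: "disk_selfmap \<phi>" "inj_on \<phi> disk" "f holomorphic_on disk" "a \<in> disk"
      "E \<in> sets borel" "G \<in> sets borel" "\<phi> ` (E \<inter> disk) \<subseteq> G"
    interpret disk_selfmap \<phi> by (rule *)
    define X where "X z = ennreal (density f (\<phi> a) (\<phi> z) * (norm (deriv \<phi> z))\<^sup>2)" for z
    define T where "T z = ennreal (transfer \<phi> f a z)" for z
    have T_meas: "T \<in> borel_measurable dA"
      unfolding T_def[abs_def] by (rule nn_integral_transfer_le(2)[OF *(1,3,4)])
    have "(\<lambda>z. density f (\<phi> a) (\<phi> z)) \<in> borel_measurable dA"
      by (rule measurable_compose[OF measurable_disk_measure_selfmap density_measurable])
         (use holo maps *(3,4) in \<open>auto intro: holomorphic_on_imp_continuous_on\<close>)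
    moreover have "deriv \<phi> \<in> borel_measurable dA"
      by (intro measurable_disk_measureI holomorphic_on_imp_continuous_on holomorphic_deriv holo open_ball)
    ultimately have X_meas: "(\<lambda>z. X z * indicator E z) \<in> borel_measurable dA"
      unfolding X_def using indicator_disk_measurable[OF *(5)] by measurable
    have "energy_on E (\<lambda>z. f (\<phi> z)) a \<le> (\<integral>\<^sup>+z. (ennreal (l powr (p - 2)) * (X z * indicator E z) + ennreal \<eta> * T z) \<partial>dA)"
      unfolding energy_on_def
    proof (rule nn_integral_mono)
      fix z assume "z \<in> space dA"
      then have z: "z \<in> disk" by simp
      have t0: "0 \<le> transfer \<phi> f a z" by (simp add: transfer_def)
      have "density (\<lambda>z. f (\<phi> z)) a z \<le>
        l powr (p - 2) * (density f (\<phi> a) (\<phi> z) * (norm (deriv \<phi> z))\<^sup>2) + \<eta> * transfer \<phi> f a z"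
        using density_compose_less_2[OF *(1,3,4) z p2 l(1)] by (simp add: l)
      then have "ennreal (density (\<lambda>z. f (\<phi> z)) a z) \<le>
        ennreal (l powr (p - 2) * (density f (\<phi> a) (\<phi> z) * (norm (deriv \<phi> z))\<^sup>2) + \<eta> * transfer \<phi> f a z)"
        by (rule ennreal_leI)
      also have "\<dots> = ennreal (l powr (p - 2)) * X z + ennreal \<eta> * T z"
        using t0 assms by (simp add: X_def T_def ennreal_mult)
      finally show "ennreal (density (\<lambda>z. f (\<phi> z)) a z) * indicator E z \<le>
        ennreal (l powr (p - 2)) * (X z * indicator E z) + ennreal \<eta> * T z"
        by (auto simp: indicator_def)
    qed
    also have "\<dots> = ennreal (l powr (p - 2)) * (\<integral>\<^sup>+z. X z * indicator E z \<partial>dA) + ennreal \<eta> * (\<integral>\<^sup>+z. T z \<partial>dA)"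
      using X_meas T_meas by (simp add: nn_integral_add nn_integral_cmult)
    also have "\<dots> \<le> ennreal (l powr (p - 2)) * energy_on G f (\<phi> a) + ennreal \<eta> * energy f (\<phi> a)"
      unfolding X_def T_def
      by (intro add_mono mult_left_mono nn_integral_density_compose[OF *] nn_integral_transfer_le[OF *(1,3,4)]) auto
    finally show "energy_on E (\<lambda>z. f (\<phi> z)) a \<le> ennreal (l powr (p - 2)) * energy_on G f (\<phi> a) + ennreal \<eta> * energy f (\<phi> a)" .
  qed (use l in auto)
qed

text \<open>Fixed once by choice, so that it is visibly a function of \<open>\<eta>\<close> only and
  can be named before the other objects are chosen.\<close>

definition split_const :: "real \<Rightarrow> real" where
  "split_const \<eta> = (SOME L. 0 < L \<and> (\<forall>\<phi> f a E G. disk_selfmap \<phi> \<longrightarrow> inj_on \<phi> disk \<longrightarrow>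
      f holomorphic_on disk \<longrightarrow> a \<in> disk \<longrightarrow> E \<in> sets borel \<longrightarrow> G \<in> sets borel \<longrightarrow> \<phi> ` (E \<inter> disk) \<subseteq> G \<longrightarrow>
      energy_on E (\<lambda>z. f (\<phi> z)) a \<le> ennreal L * energy_on G f (\<phi> a) + ennreal \<eta> * energy f (\<phi> a)))"

theorem
  assumes "0 < \<eta>"
  shows split_const_pos: "0 < split_const \<eta>"
    and energy_on_compose: "disk_selfmap \<phi> \<Longrightarrow> inj_on \<phi> disk \<Longrightarrow> f holomorphic_on disk \<Longrightarrow> a \<in> disk \<Longrightarrow>
      E \<in> sets borel \<Longrightarrow> G \<in> sets borel \<Longrightarrow> \<phi> ` (E \<inter> disk) \<subseteq> G \<Longrightarrow>
      energy_on E (\<lambda>z. f (\<phi> z)) a \<le> ennreal (split_const \<eta>) * energy_on G f (\<phi> a) + ennreal \<eta> * energy f (\<phi> a)"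
proof -
  have "\<exists>L. 0 < L \<and> (\<forall>\<phi> f a E G. disk_selfmap \<phi> \<longrightarrow> inj_on \<phi> disk \<longrightarrow>
      f holomorphic_on disk \<longrightarrow> a \<in> disk \<longrightarrow> E \<in> sets borel \<longrightarrow> G \<in> sets borel \<longrightarrow> \<phi> ` (E \<inter> disk) \<subseteq> G \<longrightarrow>
      energy_on E (\<lambda>z. f (\<phi> z)) a \<le> ennreal L * energy_on G f (\<phi> a) + ennreal \<eta> * energy f (\<phi> a))"
    by (rule energy_on_compose_exists[OF assms]) blast
  note L = someI_ex[OF this, folded split_const_def]
  show "0 < split_const \<eta>" using L by blast
  show "energy_on E (\<lambda>z. f (\<phi> z)) a \<le> ennreal (split_const \<eta>) * energy_on G f (\<phi> a) + ennreal \<eta> * energy f (\<phi> a)"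
    if "disk_selfmap \<phi>" "inj_on \<phi> disk" "f holomorphic_on disk" "a \<in> disk"
      "E \<in> sets borel" "G \<in> sets borel" "\<phi> ` (E \<inter> disk) \<subseteq> G"
    using L that by blast
qed

end

section \<open>The spaces \<open>M_space\<close> and \<open>m_space\<close> in terms of energies\<close>

lemma set_integrable_disk_iff:
  fixes h :: "complex \<Rightarrow> real"
  assumes "continuous_on disk h" "\<And>z. z \<in> disk \<Longrightarrow> 0 \<le> h z"
  shows "set_integrable lborel disk h \<longleftrightarrow> (\<integral>\<^sup>+z. ennreal (h z) \<partial>dA) < \<infinity>"
proof -
  have "set_integrable lborel disk h \<longleftrightarrow> integrable dA h"
    unfolding set_integrable_def dA_def by (subst integrable_restrict_space) auto
  also have "\<dots> \<longleftrightarrow> (\<integral>\<^sup>+z. ennreal (norm (h z)) \<partial>dA) < \<infinity>"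
    using measurable_disk_measureI[OF assms(1)] by (simp add: integrable_iff_bounded)
  also have "(\<integral>\<^sup>+z. ennreal (norm (h z)) \<partial>dA) = (\<integral>\<^sup>+z. ennreal (h z) \<partial>dA)"
    using assms(2) by (intro nn_integral_cong) simp
  finally show ?thesis .
qed

lemma set_lebesgue_integral_disk:
  fixes h :: "complex \<Rightarrow> real"
  assumes "continuous_on disk h" "\<And>z. z \<in> disk \<Longrightarrow> 0 \<le> h z"
  shows "(LINT z:disk|lborel. h z) = enn2real (\<integral>\<^sup>+z. ennreal (h z) \<partial>dA)"
proof -
  have "(LINT z:disk|lborel. h z) = integral\<^sup>L dA h"
    unfolding set_lebesgue_integral_def dA_def by (subst integral_restrict_space) auto
  also have "\<dots> = enn2real (\<integral>\<^sup>+z. ennreal (h z) \<partial>dA)"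
    using measurable_disk_measureI[OF assms(1)] assms(2)
    by (intro integral_eq_nn_integral AE_I2) auto
  finally show ?thesis .
qed

lemma emeasure_disk_measure_finite: "emeasure dA disk < \<infinity>"
  using emeasure_lborel_ball_finite[of "0::complex" 1]
  by (auto simp: dA_def emeasure_restrict_space)

text \<open>Selects a factor that makes a finite extended number small, alone and after
  multiplication by \<open>c\<close>. The summands 1 in the denominator of \<open>d\<close> exclude
  division by zero.\<close>

lemma ennreal_le_fraction:
  assumes "x < (\<infinity>::ennreal)" "0 < c" "0 < e"
  obtains d :: real where "0 < d" "ennreal d * x \<le> ennreal e" "ennreal c * (ennreal d * x) \<le> ennreal e"
proof -
  obtain r where r: "x = ennreal r" "0 \<le> r" using assms(1) by (cases x) auto
  define d where "d = e / ((1 + c) * (1 + r))"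
  have d: "0 < d" using assms r by (simp add: d_def)
  have "d * r \<le> e" "c * (d * r) \<le> e"
  proof -
    have pos: "0 < (1 + c) * (1 + r)" using assms r by simp
    have "r \<le> (1 + c) * (1 + r)" "c * r \<le> (1 + c) * (1 + r)"
      using assms r by (auto simp: algebra_simps)
    then have "r / ((1 + c) * (1 + r)) \<le> 1" "c * r / ((1 + c) * (1 + r)) \<le> 1"
      using pos by (simp_all only: divide_le_eq_1_pos)
    then have "e * (r / ((1 + c) * (1 + r))) \<le> e * 1" "e * (c * r / ((1 + c) * (1 + r))) \<le> e * 1"
      using assms(3) by (simp_all only: mult_le_cancel_left_pos)
    then show "d * r \<le> e" "c * (d * r) \<le> e"
      by (simp_all add: d_def mult_ac)
  qed
  then show ?thesis
    using d r assms by (intro that[of d]) (auto simp flip: ennreal_mult intro!: ennreal_leI)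
qed

text \<open>Dominated convergence. The sets will be annuli near the circle or their univalent
  images, which are only required to lose every single point eventually.\<close>

lemma nn_integral_vanishing_sets:
  assumes F: "F \<in> borel_measurable dA" "(\<integral>\<^sup>+z. F z \<partial>dA) < \<infinity>"
    and E: "\<And>n. E n \<in> sets borel" "\<And>z. z \<in> disk \<Longrightarrow> eventually (\<lambda>n. z \<notin> E n) sequentially"
    and e: "0 < (e::real)"
  obtains n where "(\<integral>\<^sup>+z\<in>E n. F z \<partial>dA) \<le> ennreal e"
proof -
  have ind: "(indicator (E n) :: complex \<Rightarrow> ennreal) \<in> borel_measurable dA" for n
    by (rule measurable_borel_disk_measure) (use E in simp)
  have "(\<lambda>n. \<integral>\<^sup>+z. F z * indicator (E n) z \<partial>dA) \<longlonglongrightarrow> (\<integral>\<^sup>+z. 0 \<partial>dA)"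
  proof (rule nn_integral_dominated_convergence[where w = F])
    show "(\<lambda>z. F z * indicator (E n) z) \<in> borel_measurable dA" for n
      using F(1) ind by measurable
    show "AE z in dA. F z * indicator (E n) z \<le> F z" for n
      by (intro AE_I2) (simp add: indicator_def)
    have "eventually (\<lambda>n. F z * indicator (E n) z = 0) sequentially" if "z \<in> disk" for z
      using E(2)[OF that] by (rule eventually_mono) simp
    then show "AE z in dA. (\<lambda>n. F z * indicator (E n) z) \<longlonglongrightarrow> 0"
      by (intro AE_I2 tendsto_eventually) simp
  qed (use F in auto)
  then have "eventually (\<lambda>n. (\<integral>\<^sup>+z. F z * indicator (E n) z \<partial>dA) < ennreal e) sequentially"
    using e by (intro order_tendstoD(2)[of _ 0]) auto
  then obtain n where "(\<integral>\<^sup>+z. F z * indicator (E n) z \<partial>dA) < ennreal e"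
    by (auto simp: eventually_sequentially)
  then show ?thesis by (intro that[of n]) simp
qed

definition exhaust_radius :: "nat \<Rightarrow> real" where
  "exhaust_radius n = 1 - 1 / real (n + 2)"

lemma exhaust_radius: "0 < exhaust_radius n" "exhaust_radius n < 1"
  by (auto simp: exhaust_radius_def field_simps)

lemma eventually_exhaust_radius: "r < 1 \<Longrightarrow> eventually (\<lambda>n. r < exhaust_radius n) sequentially"
proof -
  assume "r < 1"
  have "exhaust_radius \<longlonglongrightarrow> 1"
    unfolding exhaust_radius_def[abs_def]
    using tendsto_diff[OF tendsto_const LIMSEQ_ignore_initial_segment[OF lim_1_over_n, of 2], of 1]
    by simp
  then show ?thesis using \<open>r < 1\<close> by (rule order_tendstoD)
qed

section \<open>Membership and norms expressed by energies\<close>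

context admissible_params
begin

lemma energy_0: "energy g 0 = (\<integral>\<^sup>+z. ennreal (norm (deriv g z) powr p * (1 - (norm z)\<^sup>2) powr s) \<partial>dA)"
  by (simp add: energy_on_def density_def)

lemma continuous_density_0:
  assumes "g holomorphic_on disk"
  shows "continuous_on disk (\<lambda>z. norm (deriv g z) powr p * (1 - (norm z)\<^sup>2) powr s)"
  using continuous_density[OF assms, of 0] by (simp add: density_def[abs_def])

lemma dirichlet_space_iff:
  "g \<in> dirichlet_space p s \<longleftrightarrow> g holomorphic_on disk \<and> energy g 0 < \<infinity>"
  using set_integrable_disk_iff[OF continuous_density_0]
  by (auto simp: dirichlet_space_def energy_0)

lemma dirichlet_norm_eq:
  assumes "g holomorphic_on disk"
  shows "dirichlet_norm p s g = norm (g 0) + enn2real (energy g 0) powr (1 / p)"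
  using set_lebesgue_integral_disk[OF continuous_density_0[OF assms]]
  by (simp add: dirichlet_norm_def energy_0)

lemma moebius_shift_props:
  assumes f: "f holomorphic_on disk" and a: "a \<in> disk"
  shows "moebius_shift f a holomorphic_on disk" "energy (moebius_shift f a) 0 = energy f a" "moebius_shift f a 0 = 0"
proof -
  have h: "(\<lambda>z. f (disk_aut a z)) holomorphic_on disk"
    by (rule holomorphic_compose_selfmap[OF disk_aut_selfmap[OF a] f])
  then show "moebius_shift f a holomorphic_on disk"
    unfolding moebius_shift_def by (intro holomorphic_intros)
  show "moebius_shift f a 0 = 0" by (simp add: moebius_shift_def)
  have "deriv (moebius_shift f a) z = deriv f (disk_aut a z) * deriv (disk_aut a) z" if z: "z \<in> disk" for z
  proof -
    have "(\<lambda>z. f (disk_aut a z)) field_differentiable at z"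
      using h z by (intro holomorphic_on_imp_differentiable_at[of _ disk]) auto
    then have "deriv (moebius_shift f a) z = deriv (\<lambda>z. f (disk_aut a z)) z"
      unfolding moebius_shift_def by (subst deriv_diff) auto
    then show ?thesis
      using deriv_compose_selfmap[OF disk_aut_selfmap[OF a] f z] by simp
  qed
  then have "energy (moebius_shift f a) 0 =
    (\<integral>\<^sup>+z. ennreal (norm (deriv f (disk_aut a z) * deriv (disk_aut a) z) powr p * (1 - (norm z)\<^sup>2) powr s) \<partial>dA)"
    unfolding energy_0 by (intro nn_integral_cong) simp
  then show "energy (moebius_shift f a) 0 = energy f a"
    using energy_shift[OF f a] by simp
qed

text \<open>For holomorphic \<open>f\<close> the extended version of the p-th power of
  \<open>moebius_weight\<close>. It keeps the value infinity, which the real-valued integral in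
  \<open>dirichlet_norm\<close> would replace by a default value.\<close>

definition scaled_energy :: "(complex \<Rightarrow> complex) \<Rightarrow> complex \<Rightarrow> ennreal" where
  "scaled_energy f a = ennreal ((1 - (norm a)\<^sup>2) powr (\<alpha> * p)) * energy f a"

lemma scaled_energy_le_energy: "a \<in> disk \<Longrightarrow> scaled_energy f a \<le> energy f a"
proof -
  assume a: "a \<in> disk"
  have "(1 - (norm a)\<^sup>2) powr (\<alpha> * p) \<le> 1"
    using one_minus_norm_sq_pos[OF a] params by (intro powr_le1) auto
  then have "ennreal ((1 - (norm a)\<^sup>2) powr (\<alpha> * p)) * energy f a \<le> ennreal 1 * energy f a"
    by (intro mult_right_mono ennreal_leI) auto
  then show ?thesis by (simp add: scaled_energy_def)
qed

lemma energy_finite_iff: "a \<in> disk \<Longrightarrow> energy f a < \<infinity> \<longleftrightarrow> scaled_energy f a < \<infinity>"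
  using one_minus_norm_sq_pos[of a] by (auto simp: scaled_energy_def ennreal_mult_less_top)

lemma moebius_weight_eq:
  assumes f: "f holomorphic_on disk" and a: "a \<in> disk"
  shows "moebius_weight \<alpha> p s f a = enn2real (scaled_energy f a) powr (1 / p)"
proof -
  have "moebius_weight \<alpha> p s f a = (1 - (norm a)\<^sup>2) powr \<alpha> * enn2real (energy f a) powr (1 / p)"
    using dirichlet_norm_eq[OF moebius_shift_props(1)[OF f a]]
    by (simp add: moebius_weight_def moebius_shift_props[OF f a])
  also have "(1 - (norm a)\<^sup>2) powr \<alpha> = ((1 - (norm a)\<^sup>2) powr (\<alpha> * p)) powr (1 / p)"
    using params by (simp add: powr_powr)
  also have "\<dots> * enn2real (energy f a) powr (1 / p) = enn2real (scaled_energy f a) powr (1 / p)"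
    by (simp add: scaled_energy_def enn2real_mult powr_mult)
  finally show ?thesis .
qed

lemma scaled_energy_add:
  assumes "f holomorphic_on disk" "g holomorphic_on disk" "a \<in> disk"
  shows "scaled_energy (\<lambda>z. f z + g z) a \<le> ennreal (2 powr p) * (scaled_energy f a + scaled_energy g a)"
proof -
  have "scaled_energy (\<lambda>z. f z + g z) a \<le> ennreal ((1 - (norm a)\<^sup>2) powr (\<alpha> * p)) * (ennreal (2 powr p) * (energy f a + energy g a))"
    unfolding scaled_energy_def by (intro mult_left_mono energy_on_add assms) auto
  then show ?thesis by (simp add: scaled_energy_def algebra_simps)
qed

lemma scaled_energy_cmult:
  assumes "f holomorphic_on disk" "a \<in> disk"
  shows "scaled_energy (\<lambda>z. c * f z) a = ennreal (norm c powr p) * scaled_energy f a"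
  using energy_on_cmult[OF assms, of UNIV c] by (simp add: scaled_energy_def mult_ac)

lemma scaled_energy_diff:
  assumes "f holomorphic_on disk" "g holomorphic_on disk" "a \<in> disk"
  shows "scaled_energy (\<lambda>z. f z - g z) a \<le> ennreal (2 powr p) * (scaled_energy f a + scaled_energy g a)"
proof -
  have "(\<lambda>z. (-1) * g z) holomorphic_on disk" using assms by (intro holomorphic_intros)
  from scaled_energy_add[OF assms(1) this assms(3)] show ?thesis
    using scaled_energy_cmult[OF assms(2,3), of "-1"] by simp
qed

lemma scaled_energy_cong:
  "(\<And>z. z \<in> disk \<Longrightarrow> f z = g z) \<Longrightarrow> scaled_energy f a = scaled_energy g a"
  using energy_on_cong[of f g UNIV a] by (simp add: scaled_energy_def)

text \<open>Finiteness matters here: \<open>enn2real\<close> sends infinity to 0.\<close>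

lemma enn2real_powr_le_iff:
  assumes "x < \<infinity>" "0 \<le> B"
  shows "enn2real x powr (1 / p) \<le> B \<longleftrightarrow> x \<le> ennreal (B powr p)"
proof -
  obtain r where r: "x = ennreal r" "0 \<le> r" using assms(1) by (cases x) auto
  have "r powr (1 / p) \<le> B \<longleftrightarrow> (r powr (1 / p)) powr p \<le> B powr p"
    using powr_mono2[of p "r powr (1 / p)" B] powr_less_mono2[of p B "r powr (1 / p)"] assms(2) params
    by (auto simp: not_le[symmetric])
  also have "(r powr (1 / p)) powr p = r" using r params by (simp add: powr_powr)
  finally show ?thesis using r by simp
qed

text \<open>A uniform \<open>ennreal\<close> bound already contains finiteness at every point, so
  the three membership clauses collapse into one condition; the value at \<open>a = 0\<close> gives
  membership in the Dirichlet space.\<close>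

lemma M_space_iff:
  "f \<in> M_space \<alpha> p s \<longleftrightarrow> f holomorphic_on disk \<and> (\<exists>B. \<forall>a\<in>disk. scaled_energy f a \<le> ennreal B)"
    (is "?L \<longleftrightarrow> ?R")
proof
  assume L: ?L
  then have f: "f holomorphic_on disk" by (auto simp: M_space_def dirichlet_space_def)
  have fin: "scaled_energy f a < \<infinity>" if "a \<in> disk" for a
  proof -
    have "energy (moebius_shift f a) 0 < \<infinity>"
      using L that by (simp add: M_space_def dirichlet_space_iff)
    then show ?thesis
      using moebius_shift_props(2)[OF f that] energy_finite_iff[OF that, of f] by simp
  qed
  obtain B where B: "\<And>a. a \<in> disk \<Longrightarrow> moebius_weight \<alpha> p s f a \<le> B"
    using L unfolding M_space_def bdd_above_def by blast
  have "scaled_energy f a \<le> ennreal (max 0 B powr p)" if a: "a \<in> disk" for a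
    using B[OF a] by (subst enn2real_powr_le_iff[symmetric]) (auto simp: fin[OF a, simplified] moebius_weight_eq[OF f a])
  then show ?R using f by blast
next
  assume R: ?R
  then obtain B where f: "f holomorphic_on disk" and B: "\<And>a. a \<in> disk \<Longrightarrow> scaled_energy f a \<le> ennreal B" by blast
  have fin: "scaled_energy f a < \<infinity>" if "a \<in> disk" for a
    using B[OF that] by (simp add: le_less_trans)
  have "moebius_weight \<alpha> p s f a \<le> (max 0 B) powr (1 / p)" if a: "a \<in> disk" for a
  proof -
    have "scaled_energy f a \<le> ennreal (max 0 B)" using B[OF a] by (rule order_trans) (simp add: ennreal_leI)
    then have "enn2real (scaled_energy f a) \<le> max 0 B" by (rule enn2real_leI[rotated]) simp
    then show ?thesis using params by (simp add: moebius_weight_eq[OF f a] powr_mono2)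
  qed
  then have "bdd_above (moebius_weight \<alpha> p s f ` disk)" by (intro bdd_aboveI2)
  moreover have "f \<in> dirichlet_space p s"
    using f energy_finite_iff[of 0 f] fin[of 0] by (auto simp: dirichlet_space_iff)
  moreover have "moebius_shift f a \<in> dirichlet_space p s" if "a \<in> disk" for a
    using moebius_shift_props[OF f that] energy_finite_iff[OF that] fin[OF that] by (auto simp: dirichlet_space_iff)
  ultimately show ?L by (auto simp: M_space_def)
qed

lemma M_space_holomorphic: "f \<in> M_space \<alpha> p s \<Longrightarrow> f holomorphic_on disk"
  by (simp add: M_space_iff)

lemma M_space_finite: "f \<in> M_space \<alpha> p s \<Longrightarrow> a \<in> disk \<Longrightarrow> scaled_energy f a < \<infinity>"
  unfolding M_space_iff by (metis ennreal_less_top infinity_ennreal_def le_less_trans)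

lemma M_spaceI:
  assumes "f holomorphic_on disk" "\<And>a. a \<in> disk \<Longrightarrow> scaled_energy f a \<le> ennreal B"
  shows "f \<in> M_space \<alpha> p s"
  unfolding M_space_iff using assms by blast

lemma M_norm_le:
  assumes f: "f \<in> M_space \<alpha> p s" and B: "\<And>a. a \<in> disk \<Longrightarrow> scaled_energy f a \<le> ennreal (B powr p)" "0 \<le> B"
  shows "M_norm \<alpha> p s f \<le> norm (f 0) + B"
proof -
  have "moebius_weight \<alpha> p s f a \<le> B" if a: "a \<in> disk" for a
    using B M_space_finite[OF f a] a
    by (simp add: moebius_weight_eq[OF M_space_holomorphic[OF f] a] enn2real_powr_le_iff)
  then have "rho \<alpha> p s f \<le> B"
    unfolding rho_def by (intro cSUP_least) auto
  then show ?thesis by (simp add: M_norm_def)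
qed

lemma
  assumes f: "f \<in> M_space \<alpha> p s"
  shows norm_0_le_M_norm: "norm (f 0) \<le> M_norm \<alpha> p s f"
    and scaled_energy_le_M_norm: "a \<in> disk \<Longrightarrow> scaled_energy f a \<le> ennreal (M_norm \<alpha> p s f powr p)"
    and M_norm_nonneg: "0 \<le> M_norm \<alpha> p s f"
proof -
  have bdd: "bdd_above (moebius_weight \<alpha> p s f ` disk)"
    using f by (simp add: M_space_def)
  have up: "moebius_weight \<alpha> p s f a \<le> rho \<alpha> p s f" if "a \<in> disk" for a
    unfolding rho_def by (rule cSUP_upper[OF that bdd])
  have "0 \<le> moebius_weight \<alpha> p s f 0"
    by (simp add: moebius_weight_eq[OF M_space_holomorphic[OF f]])
  then have "0 \<le> rho \<alpha> p s f" using up[of 0] by simp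
  then show "norm (f 0) \<le> M_norm \<alpha> p s f" and nn: "0 \<le> M_norm \<alpha> p s f"
    by (auto simp: M_norm_def)
  show "scaled_energy f a \<le> ennreal (M_norm \<alpha> p s f powr p)" if a: "a \<in> disk"
  proof -
    have "moebius_weight \<alpha> p s f a \<le> M_norm \<alpha> p s f"
      using up[OF a] by (simp add: M_norm_def add_increasing)
    then show ?thesis
      using M_space_finite[OF f a] nn
      by (simp add: moebius_weight_eq[OF M_space_holomorphic[OF f] a] enn2real_powr_le_iff)
  qed
qed

lemma m_space_iff:
  "f \<in> m_space \<alpha> p s \<longleftrightarrow> f \<in> M_space \<alpha> p s \<and>
     (\<forall>e>0. \<exists>R<1. \<forall>a\<in>disk. R < norm a \<longrightarrow> scaled_energy f a \<le> ennreal e)"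
proof -
  have "(moebius_weight \<alpha> p s f \<longlongrightarrow> 0) (filtercomap norm (at_left (1::real))) \<longleftrightarrow>
     (\<forall>e>0. \<exists>R<1. \<forall>a\<in>disk. R < norm a \<longrightarrow> scaled_energy f a \<le> ennreal e)" (is "?L \<longleftrightarrow> ?R")
    if f: "f \<in> M_space \<alpha> p s"
  proof -
    note w = moebius_weight_eq[OF M_space_holomorphic[OF f]]
    have ev: "eventually P (filtercomap norm (at_left (1::real))) \<longleftrightarrow> (\<exists>R<1. \<forall>a\<in>disk. R < norm a \<longrightarrow> P a)"
      for P :: "complex \<Rightarrow> bool"
      unfolding eventually_filtercomap eventually_at_left_field
    proof
      assume "\<exists>Q. (\<exists>b<1. \<forall>y>b. y < 1 \<longrightarrow> Q y) \<and> (\<forall>x. Q (norm x) \<longrightarrow> P x)"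
      then show "\<exists>R<1. \<forall>a\<in>disk. R < norm a \<longrightarrow> P a" by (metis mem_ball_0)
    next
      assume "\<exists>R<1. \<forall>a\<in>disk. R < norm a \<longrightarrow> P a"
      then obtain R where "R < 1" "\<forall>a\<in>disk. R < norm a \<longrightarrow> P a" by blast
      then show "\<exists>Q. (\<exists>b<1. \<forall>y>b. y < 1 \<longrightarrow> Q y) \<and> (\<forall>x. Q (norm x) \<longrightarrow> P x)"
        by (intro exI[of _ "\<lambda>y. R < y \<and> y < 1"]) auto
    qed
    show ?thesis
    proof
      assume L: ?L
      show ?R
      proof (intro allI impI)
        fix e :: real assume "0 < e"
        then have "0 < e powr (1 / p)" by simp
        from tendstoD[OF L this] obtain R where R: "R < 1"
          "\<And>a. a \<in> disk \<Longrightarrow> R < norm a \<Longrightarrow> dist (moebius_weight \<alpha> p s f a) 0 < e powr (1 / p)"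
          unfolding ev by blast
        have "scaled_energy f a \<le> ennreal e" if a: "a \<in> disk" "R < norm a" for a
        proof -
          have "enn2real (scaled_energy f a) powr (1 / p) \<le> e powr (1 / p)"
            using R(2)[OF a] by (simp add: w[OF a(1)])
          then have "scaled_energy f a \<le> ennreal ((e powr (1 / p)) powr p)"
            using M_space_finite[OF f a(1)] by (simp add: enn2real_powr_le_iff)
          then show ?thesis using \<open>0 < e\<close> params by (simp add: powr_powr)
        qed
        with R(1) show "\<exists>R<1. \<forall>a\<in>disk. R < norm a \<longrightarrow> scaled_energy f a \<le> ennreal e" by blast
      qed
    next
      assume R: ?R
      show ?L
      proof (rule tendstoI)
        fix e :: real assume e: "0 < e"
        then have "0 < (e / 2) powr p" by simp
        with R obtain R where R: "R < 1" "\<And>a. a \<in> disk \<Longrightarrow> R < norm a \<Longrightarrow> scaled_energy f a \<le> ennreal ((e / 2) powr p)"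
          by meson
        have "dist (moebius_weight \<alpha> p s f a) 0 < e" if a: "a \<in> disk" "R < norm a" for a
        proof -
          have "enn2real (scaled_energy f a) powr (1 / p) \<le> e / 2"
            by (rule iffD2[OF enn2real_powr_le_iff]) (use R(2)[OF a] e M_space_finite[OF f a(1)] in auto)
          then show ?thesis using e by (simp add: w[OF a(1)])
        qed
        with R(1) show "eventually (\<lambda>a. dist (moebius_weight \<alpha> p s f a) 0 < e) (filtercomap norm (at_left 1))"
          unfolding ev by blast
      qed
    qed
  qed
  then show ?thesis by (auto simp: m_space_def)
qed

text \<open>Replaces limits of a norm defined by a supremum and a root by inequalities between
  energies, the form in which they are proved.\<close>

lemma M_norm_tendsto_0_iff:
  assumes "eventually (\<lambda>t. g t \<in> M_space \<alpha> p s) F"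
  shows "((\<lambda>t. M_norm \<alpha> p s (g t)) \<longlongrightarrow> 0) F \<longleftrightarrow>
     ((\<lambda>t. g t 0) \<longlongrightarrow> 0) F \<and> (\<forall>e>0. eventually (\<lambda>t. \<forall>a\<in>disk. scaled_energy (g t) a \<le> ennreal e) F)"
    (is "?L \<longleftrightarrow> ?R")
proof
  assume L: ?L
  have "((\<lambda>t. g t 0) \<longlongrightarrow> 0) F"
    by (rule Lim_null_comparison[OF _ L]) (use assms in \<open>auto elim!: eventually_mono intro: norm_0_le_M_norm\<close>)
  moreover have "eventually (\<lambda>t. \<forall>a\<in>disk. scaled_energy (g t) a \<le> ennreal e) F" if e: "0 < e" for e
  proof -
    have "0 < e powr (1 / p)" using e by simp
    from tendstoD[OF L this] assms show ?thesis
    proof eventually_elim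
      case (elim t)
      have "M_norm \<alpha> p s (g t) powr p \<le> (e powr (1 / p)) powr p"
        using elim params M_norm_nonneg[OF elim(2)] by (intro powr_mono2) auto
      then have "M_norm \<alpha> p s (g t) powr p \<le> e" using e params by (simp add: powr_powr)
      then show ?case
        using scaled_energy_le_M_norm[OF elim(2)] by (meson ennreal_leI order_trans)
    qed
  qed
  ultimately show ?R by blast
next
  assume R: ?R
  show ?L
  proof (rule tendstoI)
    fix e :: real assume e: "0 < e"
    have "eventually (\<lambda>t. dist (g t 0) 0 < e / 2) F" using R e by (intro tendstoD) auto
    moreover have "eventually (\<lambda>t. \<forall>a\<in>disk. scaled_energy (g t) a \<le> ennreal ((e / 3) powr p)) F"
      using R e by simp
    ultimately show "eventually (\<lambda>t. dist (M_norm \<alpha> p s (g t)) 0 < e) F"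
      using assms
    proof eventually_elim
      case (elim t)
      have "M_norm \<alpha> p s (g t) \<le> norm (g t 0) + e / 3"
        using elim e by (intro M_norm_le) auto
      then show ?case using elim(1) e M_norm_nonneg[OF elim(3)] by simp
    qed
  qed
qed

section \<open>Linear structure and composition operators\<close>

lemma M_space_cmult: "f \<in> M_space \<alpha> p s \<Longrightarrow> (\<lambda>z. c * f z) \<in> M_space \<alpha> p s"
proof -
  assume f: "f \<in> M_space \<alpha> p s"
  then obtain B where B: "\<And>a. a \<in> disk \<Longrightarrow> scaled_energy f a \<le> ennreal B" "f holomorphic_on disk"
    unfolding M_space_iff by blast
  have "scaled_energy (\<lambda>z. c * f z) a \<le> ennreal (norm c powr p * B)" if "a \<in> disk" for a
  proof -
    have "scaled_energy (\<lambda>z. c * f z) a \<le> ennreal (norm c powr p) * ennreal B"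
      using B that by (auto simp: scaled_energy_cmult intro!: mult_left_mono)
    then show ?thesis by (simp add: ennreal_mult')
  qed
  then show ?thesis using B by (intro M_spaceI) (auto intro!: holomorphic_intros)
qed

lemma M_space_add: "f \<in> M_space \<alpha> p s \<Longrightarrow> g \<in> M_space \<alpha> p s \<Longrightarrow> (\<lambda>z. f z + g z) \<in> M_space \<alpha> p s"
proof -
  assume f: "f \<in> M_space \<alpha> p s" and g: "g \<in> M_space \<alpha> p s"
  note h = M_space_holomorphic[OF f] M_space_holomorphic[OF g]
  show ?thesis
  proof (rule M_spaceI)
    fix a assume a: "a \<in> disk"
    have "scaled_energy (\<lambda>z. f z + g z) a \<le> ennreal (2 powr p) * (scaled_energy f a + scaled_energy g a)"
      by (rule scaled_energy_add[OF h a])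
    also have "\<dots> \<le> ennreal (2 powr p) * (ennreal (M_norm \<alpha> p s f powr p) + ennreal (M_norm \<alpha> p s g powr p))"
      using a by (intro mult_left_mono add_mono scaled_energy_le_M_norm f g) auto
    finally show "scaled_energy (\<lambda>z. f z + g z) a \<le> ennreal (2 powr p * (M_norm \<alpha> p s f powr p + M_norm \<alpha> p s g powr p))"
      by (simp add: ennreal_mult)
  qed (intro holomorphic_intros h)
qed

lemma M_space_diff: "f \<in> M_space \<alpha> p s \<Longrightarrow> g \<in> M_space \<alpha> p s \<Longrightarrow> (\<lambda>z. f z - g z) \<in> M_space \<alpha> p s"
  using M_space_add[OF _ M_space_cmult[of g "-1"], of f] by simp

definition compose_const :: real where
  "compose_const = split_const 1 + 1"

lemma compose_const_pos: "0 < compose_const"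
  using split_const_pos[of 1] by (simp add: compose_const_def)

text \<open>The splitting estimate with \<open>E\<close> and \<open>G\<close> everything and
  \<open>\<eta> = 1\<close>, where both terms are multiples of the same energy. The power of
  \<open>distortion\<close> pays for replacing the scaling factor at \<open>a\<close> by the one at
  \<open>\<phi> a\<close>.\<close>

lemma scaled_energy_compose:
  assumes \<phi>: "disk_selfmap \<phi>" "inj_on \<phi> disk" and f: "f holomorphic_on disk" and a: "a \<in> disk"
  shows "scaled_energy (\<lambda>z. f (\<phi> z)) a \<le>
    ennreal (compose_const * disk_selfmap.distortion \<phi> powr (\<alpha> * p)) * scaled_energy f (\<phi> a)"
proof -
  interpret disk_selfmap \<phi> by (rule \<phi>)
  have b: "\<phi> a \<in> disk" using a by auto
  have "energy (\<lambda>z. f (\<phi> z)) a \<le> ennreal (split_const 1) * energy f (\<phi> a) + ennreal 1 * energy f (\<phi> a)"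
    by (rule energy_on_compose[OF zero_less_one \<phi> f a]) auto
  also have "\<dots> = ennreal compose_const * energy f (\<phi> a)"
    using split_const_pos[of 1] by (simp add: compose_const_def distrib_right)
  finally have 1: "energy (\<lambda>z. f (\<phi> z)) a \<le> ennreal compose_const * energy f (\<phi> a)" .
  have "(1 - (norm a)\<^sup>2) powr (\<alpha> * p) \<le> (distortion * (1 - (norm (\<phi> a))\<^sup>2)) powr (\<alpha> * p)"
    using one_minus_norm_sq_distortion[OF a] one_minus_norm_sq_pos[OF a] params
    by (intro powr_mono2) auto
  also have "\<dots> = distortion powr (\<alpha> * p) * (1 - (norm (\<phi> a))\<^sup>2) powr (\<alpha> * p)"
    using distortion_ge_1 one_minus_norm_sq_pos[OF b] by (intro powr_mult)
  finally have 2: "ennreal ((1 - (norm a)\<^sup>2) powr (\<alpha> * p)) \<le> ennreal (distortion powr (\<alpha> * p) * (1 - (norm (\<phi> a))\<^sup>2) powr (\<alpha> * p))"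
    by (rule ennreal_leI)
  have "scaled_energy (\<lambda>z. f (\<phi> z)) a \<le>
    ennreal (distortion powr (\<alpha> * p) * (1 - (norm (\<phi> a))\<^sup>2) powr (\<alpha> * p)) * (ennreal compose_const * energy f (\<phi> a))"
    unfolding scaled_energy_def by (intro mult_mono 1 2) auto
  also have "\<dots> = ennreal (compose_const * distortion powr (\<alpha> * p)) * scaled_energy f (\<phi> a)"
    using compose_const_pos by (simp add: scaled_energy_def ennreal_mult mult_ac)
  finally show ?thesis .
qed

lemma M_space_compose:
  assumes \<phi>: "disk_selfmap \<phi>" "inj_on \<phi> disk" and f: "f \<in> M_space \<alpha> p s"
  shows "(\<lambda>z. f (\<phi> z)) \<in> M_space \<alpha> p s"
proof -
  interpret disk_selfmap \<phi> by (rule \<phi>)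
  define K where "K = compose_const"
  note K = compose_const_pos[folded K_def] scaled_energy_compose[folded K_def]
  define C where "C = K * distortion powr (\<alpha> * p)"
  have C: "0 \<le> C" using K by (simp add: C_def)
  show ?thesis
  proof (rule M_spaceI)
    show "(\<lambda>z. f (\<phi> z)) holomorphic_on disk"
      by (rule holomorphic_compose_selfmap[OF \<phi>(1) M_space_holomorphic[OF f]])
    fix a assume a: "a \<in> disk"
    have "scaled_energy (\<lambda>z. f (\<phi> z)) a \<le> ennreal C * scaled_energy f (\<phi> a)"
      unfolding C_def by (rule K(2)[OF \<phi> M_space_holomorphic[OF f] a])
    also have "\<dots> \<le> ennreal C * ennreal (M_norm \<alpha> p s f powr p)"
      using a by (intro mult_left_mono scaled_energy_le_M_norm f) auto
    finally show "scaled_energy (\<lambda>z. f (\<phi> z)) a \<le> ennreal (C * M_norm \<alpha> p s f powr p)"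
      using C by (simp add: ennreal_mult)
  qed
qed

text \<open>Littlewood subordination with the constant map 0 is the mean value inequality for powers
  of the modulus; it is applied to the derivative of \<open>f \<circ> disk_aut a\<close>, whose
  value at the origin is the Bloch density of \<open>f\<close> at \<open>a\<close>.\<close>

lemma bloch_bound:
  obtains c where "0 < c"
    "\<And>f a. f holomorphic_on disk \<Longrightarrow> a \<in> disk \<Longrightarrow>
      ennreal (c * (norm (deriv f a) * (1 - (norm a)\<^sup>2) powr (1 + \<alpha>)) powr p) \<le> scaled_energy f a"
proof -
  define v where "v x = (1 - x\<^sup>2) powr s" for x :: real
  have v: "v \<in> borel_measurable borel" "\<And>x. 0 \<le> v x" unfolding v_def by auto
  \<comment> \<open>A lower bound for the mass of the radial weight: on the ball of radius 1/2 the
    weight is at least \<open>(3/4) powr s\<close>, as \<open>s\<close> is not negative.\<close>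
  define c where "c = (3/4) powr s * measure lborel (ball (0::complex) (1/2))"
  have c: "0 < c" by (simp add: c_def content_ball_pos)
  have v_meas: "(\<lambda>z. ennreal (v (norm z))) \<in> borel_measurable dA"
    by (rule measurable_borel_disk_measure) (use v(1) in measurable)
  have cv: "ennreal c \<le> (\<integral>\<^sup>+z. ennreal (v (norm z)) \<partial>dA)"
  proof -
    have "ennreal c = ennreal ((3/4) powr s) * emeasure lborel (ball (0::complex) (1/2))"
    proof -
      have "emeasure lborel (ball (0::complex) (1/2)) = ennreal (measure lborel (ball (0::complex) (1/2)))"
        by (rule emeasure_eq_ennreal_measure) (use emeasure_lborel_ball_finite[of "0::complex" "1/2"] in auto)
      then show ?thesis by (simp add: c_def ennreal_mult)
    qed
    also have "\<dots> = (\<integral>\<^sup>+z. ennreal ((3/4) powr s) * indicator (ball (0::complex) (1/2)) z \<partial>lborel)"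
      by (simp add: nn_integral_cmult_indicator)
    also have "\<dots> \<le> (\<integral>\<^sup>+z\<in>disk. ennreal (v (norm z)) \<partial>lborel)"
    proof (rule nn_integral_mono)
      fix z :: complex
      show "ennreal ((3/4) powr s) * indicator (ball (0::complex) (1/2)) z \<le> ennreal (v (norm z)) * indicator disk z"
      proof (cases "norm z < 1 / 2")
        case True
        have "(norm z)\<^sup>2 \<le> (1/2)\<^sup>2" using True by (intro power_mono) auto
        then have "(3/4) powr s \<le> v (norm z)"
          unfolding v_def using params by (intro powr_mono2) (auto simp: power2_eq_square)
        then show ?thesis using True by (auto simp: indicator_def intro: ennreal_leI)
      qed (simp add: indicator_def)
    qed
    finally show ?thesis by (simp add: nn_integral_disk_measure)
  qed
  show ?thesis
  proof (rule that[OF c])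
    fix f a assume f: "f holomorphic_on disk" and a: "a \<in> disk"
    define h where "h w = deriv f (disk_aut a w) * deriv (disk_aut a) w" for w
    have h: "h holomorphic_on disk"
    proof -
      have "(\<lambda>w. deriv f (disk_aut a w)) holomorphic_on disk"
        by (rule holomorphic_compose_selfmap[OF disk_aut_selfmap[OF a]]) (intro holomorphic_deriv f open_ball)
      then show ?thesis unfolding h_def
        by (intro holomorphic_intros holomorphic_deriv disk_aut_holomorphic a open_ball)
    qed
    have "ennreal (norm (h 0) powr p) * ennreal c \<le> ennreal (norm (h 0) powr p) * (\<integral>\<^sup>+z. ennreal (v (norm z)) \<partial>dA)"
      by (intro mult_left_mono cv) auto
    also have "\<dots> = (\<integral>\<^sup>+z. ennreal (norm (h 0) powr p * v (norm z)) \<partial>dA)"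
      using v_meas v by (simp add: nn_integral_cmult ennreal_mult)
    also have "\<dots> \<le> (\<integral>\<^sup>+z. ennreal (norm (h z) powr p * v (norm z)) \<partial>dA)"
      by (rule littlewood_subordination[OF h, of "\<lambda>_. 0"]) (use params v in \<open>auto simp: disk_selfmap_def\<close>)
    also have "\<dots> = energy f a"
      unfolding h_def v_def by (rule energy_shift[OF f a])
    finally have 1: "ennreal (norm (h 0) powr p) * ennreal c \<le> energy f a" .
    have h0: "norm (h 0) = norm (deriv f a) * (1 - (norm a)\<^sup>2)"
      using norm_deriv_disk_aut[OF a, of 0] by (simp add: h_def norm_mult)
    have y: "0 < 1 - (norm a)\<^sup>2" by (rule one_minus_norm_sq_pos[OF a])
    have "c * (norm (deriv f a) * (1 - (norm a)\<^sup>2) powr (1 + \<alpha>)) powr p = (1 - (norm a)\<^sup>2) powr (\<alpha> * p) * (norm (h 0) powr p * c)"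
      using y by (simp add: h0 powr_add powr_mult powr_powr)
    then have "ennreal (c * (norm (deriv f a) * (1 - (norm a)\<^sup>2) powr (1 + \<alpha>)) powr p) =
       ennreal ((1 - (norm a)\<^sup>2) powr (\<alpha> * p)) * (ennreal (norm (h 0) powr p) * ennreal c)"
      using c by (simp add: ennreal_mult mult_ac)
    also have "\<dots> \<le> scaled_energy f a"
      unfolding scaled_energy_def by (intro mult_left_mono 1) auto
    finally show "ennreal (c * (norm (deriv f a) * (1 - (norm a)\<^sup>2) powr (1 + \<alpha>)) powr p) \<le> scaled_energy f a" .
  qed
qed

text \<open>Obtained by bounding the derivative through the Bloch density on the closed ball that
  contains \<open>b\<close>. It controls the term \<open>norm (f (\<phi> 0))\<close> in the norm of
  a composition.\<close>

lemma M_space_point_eval: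
  assumes b: "b \<in> disk"
  obtains C where "0 \<le> C" "\<And>f. f \<in> M_space \<alpha> p s \<Longrightarrow> norm (f b) \<le> C * M_norm \<alpha> p s f"
proof -
  obtain c where c: "0 < c"
    "\<And>f a. f holomorphic_on disk \<Longrightarrow> a \<in> disk \<Longrightarrow>
      ennreal (c * (norm (deriv f a) * (1 - (norm a)\<^sup>2) powr (1 + \<alpha>)) powr p) \<le> scaled_energy f a"
    using bloch_bound by blast
  define y where "y = (1 - (norm b)\<^sup>2) powr (1 + \<alpha>)"
  have y: "0 < y" using one_minus_norm_sq_pos[OF b] by (simp add: y_def)
  define D where "D = (1 / c) powr (1 / p) / y"
  have D: "0 \<le> D" using y by (simp add: D_def)
  show ?thesis
  proof (rule that[of "1 + D"])
    fix f assume f: "f \<in> M_space \<alpha> p s"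
    define N where "N = M_norm \<alpha> p s f"
    have N: "0 \<le> N" unfolding N_def by (rule M_norm_nonneg[OF f])
    have fh: "f holomorphic_on disk" by (rule M_space_holomorphic[OF f])
    have "norm (deriv f w) \<le> D * N" if w: "w \<in> cball 0 (norm b)" for w
    proof -
      have wd: "w \<in> disk" using w b by auto
      have "ennreal (c * (norm (deriv f w) * (1 - (norm w)\<^sup>2) powr (1 + \<alpha>)) powr p) \<le> ennreal (N powr p)"
        using order_trans[OF c(2)[OF fh wd] scaled_energy_le_M_norm[OF f wd]] by (simp add: N_def)
      then have "(norm (deriv f w) * (1 - (norm w)\<^sup>2) powr (1 + \<alpha>)) powr p \<le> N powr p / c"
        using c(1) by (simp add: field_simps)
      then have "((norm (deriv f w) * (1 - (norm w)\<^sup>2) powr (1 + \<alpha>)) powr p) powr (1 / p) \<le> (N powr p / c) powr (1 / p)"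
        using params by (intro powr_mono2) auto
      then have 1: "norm (deriv f w) * (1 - (norm w)\<^sup>2) powr (1 + \<alpha>) \<le> N * (1 / c) powr (1 / p)"
        using params c(1) N by (simp add: powr_powr powr_divide powr_mult)
      have "y \<le> (1 - (norm w)\<^sup>2) powr (1 + \<alpha>)"
        unfolding y_def using w b one_minus_norm_sq_pos[OF b] params
        by (intro powr_mono2) (auto intro!: power_mono)
      then have "norm (deriv f w) * y \<le> norm (deriv f w) * (1 - (norm w)\<^sup>2) powr (1 + \<alpha>)"
        by (intro mult_left_mono) auto
      with 1 have "norm (deriv f w) * y \<le> N * (1 / c) powr (1 / p)" by simp
      then show ?thesis using y by (simp add: D_def field_simps)
    qed
    then have "norm (f b - f 0) \<le> D * N * norm (b - 0)"
      by (intro field_differentiable_bound[of "cball 0 (norm b)" f "deriv f"])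
         (use b fh in \<open>auto intro!: DERIV_subset[OF holomorphic_derivI[of _ disk]]\<close>)
    also have "\<dots> \<le> D * N * 1" using b D N by (intro mult_left_mono) auto
    finally have "norm (f b - f 0) \<le> D * N" by simp
    moreover have "norm (f b) \<le> norm (f 0) + norm (f b - f 0)"
      using norm_triangle_ineq[of "f 0" "f b - f 0"] by simp
    moreover have "norm (f 0) \<le> N" unfolding N_def by (rule norm_0_le_M_norm[OF f])
    ultimately show "norm (f b) \<le> (1 + D) * M_norm \<alpha> p s f"
      by (simp add: N_def algebra_simps)
  qed (use D in auto)
qed

lemma M_norm_compose:
  assumes \<phi>: "disk_selfmap \<phi>" "inj_on \<phi> disk"
  obtains B where "0 \<le> B" "\<And>f. f \<in> M_space \<alpha> p s \<Longrightarrow> M_norm \<alpha> p s (\<lambda>z. f (\<phi> z)) \<le> B * M_norm \<alpha> p s f"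
proof -
  interpret disk_selfmap \<phi> by (rule \<phi>)
  define K where "K = compose_const"
  note K = compose_const_pos[folded K_def] scaled_energy_compose[folded K_def]
  define C where "C = K * distortion powr (\<alpha> * p)"
  have C: "0 \<le> C" using K by (simp add: C_def)
  obtain D where D: "0 \<le> D" "\<And>f. f \<in> M_space \<alpha> p s \<Longrightarrow> norm (f (\<phi> 0)) \<le> D * M_norm \<alpha> p s f"
    using M_space_point_eval[of "\<phi> 0"] in_disk[of 0] by (metis mem_ball_0 norm_zero zero_less_one)
  show ?thesis
  proof (rule that[of "D + C powr (1 / p)"])
    fix f assume f: "f \<in> M_space \<alpha> p s"
    have en: "scaled_energy (\<lambda>z. f (\<phi> z)) a \<le> ennreal ((C powr (1 / p) * M_norm \<alpha> p s f) powr p)" if a: "a \<in> disk" for a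
    proof -
      have "scaled_energy (\<lambda>z. f (\<phi> z)) a \<le> ennreal C * scaled_energy f (\<phi> a)"
        unfolding C_def by (rule K(2)[OF \<phi> M_space_holomorphic[OF f] a])
      also have "\<dots> \<le> ennreal C * ennreal (M_norm \<alpha> p s f powr p)"
        using a by (intro mult_left_mono scaled_energy_le_M_norm f) auto
      also have "\<dots> = ennreal (C * M_norm \<alpha> p s f powr p)" using C by (simp add: ennreal_mult)
      also have "C * M_norm \<alpha> p s f powr p = (C powr (1 / p) * M_norm \<alpha> p s f) powr p"
        using C params M_norm_nonneg[OF f] by (simp add: powr_mult powr_powr)
      finally show ?thesis .
    qed
    have "M_norm \<alpha> p s (\<lambda>z. f (\<phi> z)) \<le> norm (f (\<phi> 0)) + C powr (1 / p) * M_norm \<alpha> p s f"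
    proof (rule M_norm_le[OF M_space_compose[OF \<phi> f] en])
      show "0 \<le> C powr (1 / p) * M_norm \<alpha> p s f"
        by (intro mult_nonneg_nonneg M_norm_nonneg f) simp
    qed
    then show "M_norm \<alpha> p s (\<lambda>z. f (\<phi> z)) \<le> (D + C powr (1 / p)) * M_norm \<alpha> p s f"
      using D(2)[OF f] by (simp add: algebra_simps)
  qed (use D in auto)
qed

text \<open>Changes the base point to 0, where \<open>aut_jac\<close> is 1. It has two uses: a
  bounded cost \<open>J\<close> for base points in a compact part, and a small \<open>J\<close> when
  the base point approaches the circle while \<open>G\<close> stays inside.\<close>

lemma energy_on_aut_jac_le:
  assumes f: "f holomorphic_on disk" and G: "G \<in> sets borel"
    and J: "\<And>z. z \<in> G \<Longrightarrow> z \<in> disk \<Longrightarrow> 0 \<le> aut_jac b z \<and> aut_jac b z \<le> J"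
  shows "energy_on G f b \<le> ennreal (J powr q) * energy_on G f 0"
proof -
  have "energy_on G f b \<le> (\<integral>\<^sup>+z. ennreal (J powr q) * (ennreal (density f 0 z) * indicator G z) \<partial>dA)"
    unfolding energy_on_def
  proof (rule nn_integral_mono)
    fix z assume "z \<in> space dA"
    then have z: "z \<in> disk" by simp
    show "ennreal (density f b z) * indicator G z \<le> ennreal (J powr q) * (ennreal (density f 0 z) * indicator G z)"
    proof (cases "z \<in> G")
      case True
      have "aut_jac b z powr q \<le> J powr q"
        using J[OF True z] params by (intro powr_mono2) auto
      then have "aut_jac b z powr q * density f 0 z \<le> J powr q * density f 0 z"
        by (intro mult_right_mono) auto
      then have "density f b z \<le> J powr q * density f 0 z"
        by (simp add: density_def mult_ac)
      then show ?thesis using True by (simp add: ennreal_leI flip: ennreal_mult)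
    qed simp
  qed
  also have "\<dots> = ennreal (J powr q) * energy_on G f 0"
    unfolding energy_on_def by (intro nn_integral_cmult energy_on_measurable f G) auto
  finally show ?thesis .
qed

lemma energy_on_aut_jac_le_radius:
  assumes f: "f holomorphic_on disk" and G: "G \<in> sets borel" and b: "b \<in> disk" "norm b \<le> R" and R: "R < 1"
  shows "energy_on G f b \<le> ennreal ((1 / (1 - R)\<^sup>2) powr q) * energy_on G f 0"
proof (rule energy_on_aut_jac_le[OF f G])
  fix z assume "z \<in> disk"
  have "aut_jac b z \<le> (1 - (norm b)\<^sup>2) / (1 - norm b)\<^sup>2" by (rule aut_jac_le(2)[OF b(1) \<open>z \<in> disk\<close>])
  also have "\<dots> \<le> 1 / (1 - R)\<^sup>2"
    using b R by (intro frac_le power_mono) auto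
  finally show "0 \<le> aut_jac b z \<and> aut_jac b z \<le> 1 / (1 - R)\<^sup>2"
    using aut_jac_pos[OF b(1) \<open>z \<in> disk\<close>] by simp
qed

text \<open>For \<open>a\<close> near the circle either \<open>\<phi> a\<close> is near the circle
  too, and the decay of \<open>f\<close> is inherited, or \<open>\<phi> a\<close> stays in a compact
  part. In the second case the energy of the composition is split along an annulus: its image
  carries little energy of \<open>f\<close>, and off the annulus the kernel with pole
  \<open>a\<close> is uniformly small.\<close>

lemma m_space_compose:
  assumes \<phi>: "disk_selfmap \<phi>" "inj_on \<phi> disk" and f: "f \<in> m_space \<alpha> p s"
  shows "(\<lambda>z. f (\<phi> z)) \<in> m_space \<alpha> p s"
proof -
  interpret disk_selfmap \<phi> by (rule \<phi>)
  have fM: "f \<in> M_space \<alpha> p s" using f by (simp add: m_space_iff)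
  have fh: "f holomorphic_on disk" by (rule M_space_holomorphic[OF fM])
  have gM: "(\<lambda>z. f (\<phi> z)) \<in> M_space \<alpha> p s" by (rule M_space_compose[OF \<phi> fM])
  have gh: "(\<lambda>z. f (\<phi> z)) holomorphic_on disk" by (rule M_space_holomorphic[OF gM])
  have fin: "energy f 0 < \<infinity>" "energy (\<lambda>z. f (\<phi> z)) 0 < \<infinity>"
    using M_space_finite[OF fM, of 0] M_space_finite[OF gM, of 0] by (simp_all add: scaled_energy_def)
  define K where "K = compose_const"
  note K = compose_const_pos[folded K_def] scaled_energy_compose[folded K_def]
  define C where "C = K * distortion powr (\<alpha> * p)"
  have C: "0 < C" using K distortion_ge_1 by (simp add: C_def)
  have "\<exists>R<1. \<forall>a\<in>disk. R < norm a \<longrightarrow> scaled_energy (\<lambda>z. f (\<phi> z)) a \<le> ennreal e" if e: "0 < e" for e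
  proof -
    obtain R' where R': "R' < 1" "\<And>b. b \<in> disk \<Longrightarrow> R' < norm b \<Longrightarrow> scaled_energy f b \<le> ennreal (e / C)"
      using f C e unfolding m_space_iff by (meson divide_pos_pos)
    define Q where "Q = (1 / (1 - R')\<^sup>2) powr q"
    have Q: "0 < Q" using R' by (simp add: Q_def)
    \<comment> \<open>The order of choices is essential: \<open>\<eta>\<close> tames the non-local
      term and thereby fixes \<open>L\<close>; only then is the annulus chosen, small relative to
      \<open>L * Q\<close>.\<close>
    obtain \<eta> where \<eta>: "0 < \<eta>" "ennreal Q * (ennreal \<eta> * energy f 0) \<le> ennreal (e / 3)"
      using ennreal_le_fraction[OF fin(1) Q, of "e / 3"] e by auto
    define L where "L = split_const \<eta>"
    note L = split_const_pos[OF \<eta>(1), folded L_def] energy_on_compose[OF \<eta>(1), folded L_def]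
    define E where "E n = {z::complex. exhaust_radius n < norm z}" for n
    have E: "E n \<in> sets borel" for n unfolding E_def by measurable
    \<comment> \<open>These images need not lie near the circle. By injectivity each point leaves
      them eventually, which is all that dominated convergence asks for.\<close>
    define G where "G n = \<phi> ` (E n \<inter> disk)" for n
    have G: "G n \<in> sets borel" for n
      unfolding G_def by (rule inj_holomorphic_image_borel[OF open_ball holo \<phi>(2)]) (use E in auto)
    have "0 < e / (3 * L * Q)" using e L Q by simp
    have ev: "eventually (\<lambda>n. z \<notin> G n) sequentially" if "z \<in> disk" for z
    proof (cases "z \<in> \<phi> ` disk")
      case True
      then obtain w where w: "w \<in> disk" "z = \<phi> w" by auto
      have "eventually (\<lambda>n. norm w < exhaust_radius n) sequentially"
        using w by (intro eventually_exhaust_radius) auto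
      then show ?thesis
      proof eventually_elim
        case (elim n)
        show ?case
        proof
          assume "z \<in> G n"
          then obtain w' where "w' \<in> E n" "w' \<in> disk" "\<phi> w' = \<phi> w" by (auto simp: G_def w)
          then have "w' = w" using \<phi>(2) w by (auto dest: inj_onD)
          then show False using elim \<open>w' \<in> E n\<close> by (simp add: E_def)
        qed
      qed
    next
      case False
      then have "z \<notin> G n" for n by (auto simp: G_def)
      then show ?thesis by simp
    qed
    have "(\<lambda>z. ennreal (density f 0 z)) \<in> borel_measurable dA"
      using density_measurable[OF fh, of 0] by simp
    moreover have "(\<integral>\<^sup>+z. ennreal (density f 0 z) \<partial>dA) < \<infinity>"
      using fin(1) by (simp add: energy_on_def)
    ultimately obtain n where n: "(\<integral>\<^sup>+z\<in>G n. ennreal (density f 0 z) \<partial>dA) \<le> ennreal (e / (3 * L * Q))"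
      using nn_integral_vanishing_sets[of "\<lambda>z. ennreal (density f 0 z)" G "e / (3 * L * Q)"] G ev \<open>0 < e / (3 * L * Q)\<close>
      by blast
    define R1 where "R1 = exhaust_radius n"
    have R1: "0 < R1" "R1 < 1" using exhaust_radius by (auto simp: R1_def)
    obtain d where d: "0 < d" "ennreal d * energy (\<lambda>z. f (\<phi> z)) 0 \<le> ennreal (e / 3)"
      using ennreal_le_fraction[OF fin(2) zero_less_one, of "e / 3"] e by auto
    \<comment> \<open>Solves \<open>(\<delta> / (1 - R1)\<^sup>2) powr q = d\<close>, so that the
      kernel costs at most the factor \<open>d\<close> on the inner disk.\<close>
    define \<delta> where "\<delta> = d powr (1 / q) * (1 - R1)\<^sup>2"
    have \<delta>: "0 < \<delta>" using d R1 by (simp add: \<delta>_def)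
    \<comment> \<open>Radius beyond which \<open>1 - (norm a)\<^sup>2 \<le> \<delta>\<close>; the
      maximum covers the case \<open>\<delta> > 1\<close>.\<close>
    define R where "R = sqrt (max 0 (1 - \<delta>))"
    have "R < 1" using \<delta> by (simp add: R_def)
    moreover have "scaled_energy (\<lambda>z. f (\<phi> z)) a \<le> ennreal e" if a: "a \<in> disk" "R < norm a" for a
    proof (cases "R' < norm (\<phi> a)")
      case True
      have "scaled_energy (\<lambda>z. f (\<phi> z)) a \<le> ennreal C * scaled_energy f (\<phi> a)"
        unfolding C_def by (rule K(2)[OF \<phi> fh a(1)])
      also have "\<dots> \<le> ennreal C * ennreal (e / C)"
        using a True by (intro mult_left_mono R') auto
      also have "\<dots> = ennreal e" using C e by (simp flip: ennreal_mult)
      finally show ?thesis .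
    next
      case False
      then have b: "\<phi> a \<in> disk" "norm (\<phi> a) \<le> R'" using a by auto
      have 1: "energy_on (E n) (\<lambda>z. f (\<phi> z)) a \<le> ennreal (e / 3) + ennreal (e / 3)"
      proof -
        have "energy_on (E n) (\<lambda>z. f (\<phi> z)) a \<le> ennreal L * energy_on (G n) f (\<phi> a) + ennreal \<eta> * energy f (\<phi> a)"
          by (rule L(2)[OF \<phi> fh a(1) E G]) (simp add: G_def)
        also have "\<dots> \<le> ennreal L * (ennreal Q * energy_on (G n) f 0) + ennreal \<eta> * (ennreal Q * energy f 0)"
          unfolding Q_def by (intro add_mono mult_left_mono energy_on_aut_jac_le_radius fh G b R') auto
        also have "\<dots> \<le> ennreal L * (ennreal Q * ennreal (e / (3 * L * Q))) + ennreal (e / 3)"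
          using n \<eta>(2) by (intro add_mono mult_left_mono) (auto simp: energy_on_def mult_ac)
        also have "ennreal L * (ennreal Q * ennreal (e / (3 * L * Q))) = ennreal (e / 3)"
          using L Q e by (simp flip: ennreal_mult)
        finally show ?thesis .
      qed
      have 2: "energy_on (- E n) (\<lambda>z. f (\<phi> z)) a \<le> ennreal (e / 3)"
      proof -
        have "1 - (norm a)\<^sup>2 \<le> \<delta>"
        proof -
          have "R\<^sup>2 \<le> (norm a)\<^sup>2" using a by (intro power_mono) (auto simp: R_def)
          then show ?thesis by (simp add: R_def split: if_splits)
        qed
        have "energy_on (- E n) (\<lambda>z. f (\<phi> z)) a \<le> ennreal ((\<delta> / (1 - R1)\<^sup>2) powr q) * energy_on (- E n) (\<lambda>z. f (\<phi> z)) 0"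
        proof (rule energy_on_aut_jac_le[OF gh])
          fix z assume z: "z \<in> - E n" "z \<in> disk"
          then have "norm z \<le> R1" by (simp add: E_def R1_def)
          have "aut_jac a z \<le> (1 - (norm a)\<^sup>2) / (1 - norm z)\<^sup>2" by (rule aut_jac_le(1)[OF a(1) z(2)])
          also have "\<dots> \<le> \<delta> / (1 - R1)\<^sup>2"
            using \<open>1 - (norm a)\<^sup>2 \<le> \<delta>\<close> \<delta> R1 \<open>norm z \<le> R1\<close> by (intro frac_le power_mono) auto
          finally show "0 \<le> aut_jac a z \<and> aut_jac a z \<le> \<delta> / (1 - R1)\<^sup>2"
            using aut_jac_pos[OF a(1) z(2)] by simp
        qed (use E in auto)
        also have "(\<delta> / (1 - R1)\<^sup>2) powr q = d"
          using R1 d params by (simp add: \<delta>_def powr_powr)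
        also have "ennreal d * energy_on (- E n) (\<lambda>z. f (\<phi> z)) 0 \<le> ennreal d * energy (\<lambda>z. f (\<phi> z)) 0"
          by (intro mult_left_mono energy_on_le_energy) auto
        also have "\<dots> \<le> ennreal (e / 3)" by (rule d(2))
        finally show ?thesis .
      qed
      have "scaled_energy (\<lambda>z. f (\<phi> z)) a \<le> energy (\<lambda>z. f (\<phi> z)) a"
        by (rule scaled_energy_le_energy[OF a(1)])
      also have "\<dots> = energy_on (E n) (\<lambda>z. f (\<phi> z)) a + energy_on (- E n) (\<lambda>z. f (\<phi> z)) a"
        by (rule energy_on_split[OF gh a(1) E])
      also have "\<dots> \<le> (ennreal (e / 3) + ennreal (e / 3)) + ennreal (e / 3)"
        by (intro add_mono 1 2)
      also have "\<dots> = ennreal e" using e by (simp flip: ennreal_plus)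
      finally show ?thesis .
    qed
    ultimately show ?thesis by blast
  qed
  then show ?thesis using gM by (simp add: m_space_iff)
qed

end

section \<open>Semigroups of self-maps\<close>

lemma cauchy_deriv_bound:
  assumes g: "g holomorphic_on disk" and R: "0 \<le> R" "R < R2" "R2 < 1"
    and B: "\<And>z. z \<in> cball 0 R2 \<Longrightarrow> norm (g z) \<le> B" and z: "z \<in> cball 0 R"
  shows "norm (deriv g z) \<le> B / (R2 - R)"
proof -
  have sub: "cball z (R2 - R) \<subseteq> cball 0 R2"
  proof
    fix x assume "x \<in> cball z (R2 - R)"
    moreover have "norm x \<le> norm z + norm (x - z)" by (rule norm_triangle_sub)
    ultimately show "x \<in> cball 0 R2" using z by (simp add: dist_norm norm_minus_commute)
  qed
  also have "\<dots> \<subseteq> disk" using R by auto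
  finally have sub': "cball z (R2 - R) \<subseteq> disk" .
  have "norm ((deriv ^^ 1) g z) \<le> fact 1 * B / (R2 - R) ^ 1"
  proof (rule Cauchy_inequality)
    show "g holomorphic_on ball z (R2 - R)"
      using g sub' ball_subset_cball by (blast intro: holomorphic_on_subset)
    show "continuous_on (cball z (R2 - R)) g"
      using g sub' by (blast intro: holomorphic_on_subset holomorphic_on_imp_continuous_on)
    show "norm (g x) \<le> B" if "norm (z - x) = R2 - R" for x
      using sub that by (intro B) (auto simp: dist_norm subset_iff)
  qed (use R in auto)
  then show ?thesis by simp
qed

lemma selfmap_displacement:
  assumes \<psi>: "disk_selfmap \<psi>" and z0: "z0 \<in> disk" "\<psi> z0 \<noteq> z0" and r: "r < 1" and R: "R < 1"
  obtains a where "a \<in> disk" "R < norm a" "r \<le> norm (disk_aut a (\<psi> a))"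
proof (rule ccontr)
  note found = that
  assume neg: "\<not> thesis"
  interpret disk_selfmap \<psi> by (rule \<psi>)
  define r' where "r' = max r 0"
  have r': "r' < 1" "0 \<le> r'" using r by (auto simp: r'_def)
  have le: "norm (\<psi> a - a) \<le> r' / (1 - r') * (1 - (norm a)\<^sup>2)" if a: "a \<in> disk" "R < norm a" for a
  proof -
    have "norm (disk_aut a (\<psi> a)) \<le> r'" using neg found[of a] a by (force simp: r'_def)
    then have 1: "norm (a - \<psi> a) \<le> r' * norm (1 - cnj a * \<psi> a)"
      using one_minus_cnj_mult_nz[of a "\<psi> a"] a by (simp add: disk_aut_def norm_divide divide_le_eq)
    \<comment> \<open>Expressing the denominator of the pseudohyperbolic distance through the
      displacement lets the displacement be absorbed on the left, as \<open>r' < 1\<close>; it is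
      then of the order of \<open>1 - (norm a)\<^sup>2\<close>.\<close>
    have "1 - cnj a * \<psi> a = of_real (1 - (norm a)\<^sup>2) + cnj a * (a - \<psi> a)"
      unfolding of_real_diff of_real_1 complex_norm_square by (simp add: algebra_simps)
    then have "norm (1 - cnj a * \<psi> a) \<le> norm (of_real (1 - (norm a)\<^sup>2) :: complex) + norm (cnj a * (a - \<psi> a))"
      by (metis norm_triangle_ineq)
    also have "norm (of_real (1 - (norm a)\<^sup>2) :: complex) = 1 - (norm a)\<^sup>2"
      using one_minus_norm_sq_pos[OF a(1)] by (subst norm_of_real) simp
    also have "norm (cnj a * (a - \<psi> a)) \<le> norm (a - \<psi> a)"
      using a by (simp add: norm_mult mult_left_le_one_le)
    finally have "norm (a - \<psi> a) \<le> r' * (1 - (norm a)\<^sup>2 + norm (a - \<psi> a))"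
      using 1 r' by (meson mult_left_mono add_left_mono order_trans)
    then have "(1 - r') * norm (a - \<psi> a) \<le> r' * (1 - (norm a)\<^sup>2)"
      by (simp add: algebra_simps)
    then show ?thesis using r' by (simp add: norm_minus_commute field_simps)
  qed
  have "norm (\<psi> z0 - z0) \<le> e" if e: "0 < e" for e
  proof -
    define c where "c = r' / (1 - r')"
    have c: "0 \<le> c" using r' by (simp add: c_def)
    \<comment> \<open>Any radius beyond \<open>t\<close> encloses \<open>z0\<close>, lies in the
      range where \<open>le\<close> holds and makes the boundary bound at most \<open>e\<close>. The
      \<open>c + 1\<close> avoids division by zero when \<open>r'\<close> is 0.\<close>
    define t where "t = max (max R (norm z0)) (1 - e / (2 * (c + 1)))"
    have "t < 1" using R z0 e c by (auto simp: t_def)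
    define \<rho> where "\<rho> = (1 + t) / 2"
    have \<rho>: "t < \<rho>" "\<rho> < 1" using \<open>t < 1\<close> by (auto simp: \<rho>_def)
    have pos: "0 < \<rho>" using \<rho> norm_ge_zero[of z0] unfolding t_def by linarith
    have "norm (\<psi> z0 - z0) \<le> c * (1 - \<rho>\<^sup>2)"
    proof (rule maximum_modulus_frontier[of "\<lambda>z. \<psi> z - z" "cball 0 \<rho>"])
      show "(\<lambda>z. \<psi> z - z) holomorphic_on interior (cball 0 \<rho>)"
        using \<rho> by (intro holomorphic_intros holomorphic_on_subset[OF holo]) auto
      show "continuous_on (closure (cball 0 \<rho>)) (\<lambda>z. \<psi> z - z)"
        using \<rho> by (intro continuous_intros holomorphic_on_imp_continuous_on holomorphic_on_subset[OF holo]) auto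
      show "norm (\<psi> z - z) \<le> c * (1 - \<rho>\<^sup>2)" if "z \<in> frontier (cball 0 \<rho>)" for z
        using that le[of z] pos \<rho> unfolding c_def t_def by (auto simp: frontier_cball)
      show "z0 \<in> cball 0 \<rho>" using \<rho> unfolding t_def by auto
    qed auto
    also have "\<dots> \<le> (c + 1) * (2 * (1 - \<rho>))"
    proof (rule mult_mono)
      have "(1 - \<rho>) * (1 + \<rho>) \<le> (1 - \<rho>) * 2" using \<rho> by (intro mult_left_mono) auto
      then show "1 - \<rho>\<^sup>2 \<le> 2 * (1 - \<rho>)" by (simp add: power2_eq_square algebra_simps)
      show "0 \<le> 1 - \<rho>\<^sup>2" using pos \<rho> by (simp add: power_le_one)
    qed (use c in auto)
    also have "1 - \<rho> \<le> e / (2 * (c + 1))" using \<rho> unfolding t_def by linarith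
    then have "(c + 1) * (2 * (1 - \<rho>)) \<le> (c + 1) * (2 * (e / (2 * (c + 1))))"
      using c by (intro mult_left_mono) auto
    also have "\<dots> = e" using c by (simp add: field_simps)
    finally show ?thesis .
  qed
  then have "norm (\<psi> z0 - z0) \<le> 0" by (rule field_le_epsilon) simp
  then show False using z0 by simp
qed

section \<open>Univalence and boundary behaviour of semigroups\<close>

locale disk_semigroup =
  fixes \<phi> :: "real \<Rightarrow> complex \<Rightarrow> complex"
  assumes semigroup: "selfmap_semigroup \<phi>"
begin

lemma selfmap: "0 \<le> t \<Longrightarrow> disk_selfmap (\<phi> t)"
  using semigroup by (simp add: selfmap_semigroup_def disk_selfmap_def)

lemma in_disk [simp]: "0 \<le> t \<Longrightarrow> norm z < 1 \<Longrightarrow> norm (\<phi> t z) < 1"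
  by (rule disk_selfmap.in_disk[OF selfmap])

lemma at_0: "norm z < 1 \<Longrightarrow> \<phi> 0 z = z"
  using semigroup by (simp add: selfmap_semigroup_def)

lemma add: "0 \<le> t \<Longrightarrow> 0 \<le> u \<Longrightarrow> norm z < 1 \<Longrightarrow> \<phi> (t + u) z = \<phi> t (\<phi> u z)"
  using semigroup by (simp add: selfmap_semigroup_def)

lemma uniformly_near_identity:
  assumes "R < 1" "0 < e"
  obtains d where "0 < d" "\<And>t z. 0 < t \<Longrightarrow> t < d \<Longrightarrow> z \<in> cball 0 R \<Longrightarrow> norm (\<phi> t z - z) < e"
proof -
  have "compact (cball (0::complex) R)" "cball (0::complex) R \<subseteq> disk" using assms by auto
  then have "uniform_limit (cball 0 R) \<phi> (\<lambda>z. z) (at_right 0)"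
    using semigroup by (auto simp: selfmap_semigroup_def)
  then have "eventually (\<lambda>t. \<forall>z\<in>cball 0 R. dist (\<phi> t z) z < e) (at_right 0)"
    using assms(2) by (rule uniform_limitD)
  then show ?thesis using that by (auto simp: eventually_at_right_field dist_norm)
qed

text \<open>By Cauchy's estimate the derivative of \<open>\<phi> t z - z\<close> is at most 1/2 on
  the smaller ball, so \<open>\<phi> t\<close> perturbs the identity by a strict contraction and
  cannot identify two points.\<close>

lemma inj_on_cball_small:
  assumes "R < 1"
  obtains d where "0 < d" "\<And>t. 0 < t \<Longrightarrow> t < d \<Longrightarrow> inj_on (\<phi> t) (cball 0 R)"
proof -
  define R1 where "R1 = max R 0"
  define R2 where "R2 = (1 + R1) / 2"
  have R: "0 \<le> R1" "R1 < R2" "R2 < 1" using assms by (auto simp: R1_def R2_def)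
  obtain d where d: "0 < d" "\<And>t z. 0 < t \<Longrightarrow> t < d \<Longrightarrow> z \<in> cball 0 R2 \<Longrightarrow> norm (\<phi> t z - z) < (R2 - R1) / 2"
    using uniformly_near_identity[OF R(3), of "(R2 - R1) / 2"] R by auto
  show ?thesis
  proof (rule that[OF d(1)])
    fix t assume t: "0 < t" "t < d"
    interpret disk_selfmap "\<phi> t" by (rule selfmap) (use t in simp)
    define g where "g z = \<phi> t z - z" for z
    have g: "g holomorphic_on disk" unfolding g_def by (intro holomorphic_intros holo)
    have dg: "norm (deriv g z) \<le> 1 / 2" if "z \<in> cball 0 R1" for z
    proof -
      have "norm (deriv g z) \<le> ((R2 - R1) / 2) / (R2 - R1)"
        by (rule cauchy_deriv_bound[OF g R _ that]) (use d(2)[OF t] in \<open>auto simp: g_def intro: less_imp_le\<close>)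
      also have "\<dots> = 1 / 2" using R by (simp add: field_simps)
      finally show ?thesis .
    qed
    show "inj_on (\<phi> t) (cball 0 R)"
    proof (rule inj_onI)
      fix x y assume xy: "x \<in> cball 0 R" "y \<in> cball 0 R" "\<phi> t x = \<phi> t y"
      have "norm (g x - g y) \<le> 1 / 2 * norm (x - y)"
        by (rule field_differentiable_bound[of "cball 0 R1" g "deriv g"])
           (use R g dg xy in \<open>auto simp: R1_def intro!: DERIV_subset[OF holomorphic_derivI[of _ disk]]\<close>)
      also have "norm (g x - g y) = norm (x - y)"
        using xy(3) by (simp add: g_def norm_minus_commute)
      finally show "x = y" by simp
    qed
  qed
qed

lemma distortion_small:
  obtains d where "0 < d" "\<And>t. 0 \<le> t \<Longrightarrow> t < d \<Longrightarrow> norm (\<phi> t 0) \<le> 1/2 \<and> disk_selfmap.distortion (\<phi> t) \<le> 3"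
proof -
  obtain d where d: "0 < d" "\<And>t z. 0 < t \<Longrightarrow> t < d \<Longrightarrow> z \<in> cball 0 0 \<Longrightarrow> norm (\<phi> t z - z) < 1/2"
    using uniformly_near_identity[of 0 "1/2"] by auto
  have "norm (\<phi> t 0) \<le> 1/2" if "0 \<le> t" "t < d" for t
    using d(2)[of t 0] that by (cases "t = 0") (auto simp: at_0)
  then show ?thesis
    using that[OF d(1)] disk_selfmap.distortion_le_3[OF selfmap] by blast
qed

text \<open>In a time step shorter than \<open>d\<close> the quantity
  \<open>1 - (norm v)\<^sup>2\<close> shrinks by a factor of at most 3, and finitely many steps of
  length at most \<open>d / 2\<close> reach every time up to \<open>T\<close>. The resulting compact
  ball is where injectivity for small times is applied.\<close>

lemma orbit_bounded:
  assumes "norm w < 1" "0 \<le> T"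
  obtains m where "0 < m" "\<And>u. 0 \<le> u \<Longrightarrow> u \<le> T \<Longrightarrow> m \<le> 1 - (norm (\<phi> u w))\<^sup>2"
proof -
  obtain d where d: "0 < d" "\<And>t. 0 \<le> t \<Longrightarrow> t < d \<Longrightarrow> norm (\<phi> t 0) \<le> 1/2 \<and> disk_selfmap.distortion (\<phi> t) \<le> 3"
    using distortion_small by blast
  have one: "1 - (norm v)\<^sup>2 \<le> 3 * (1 - (norm (\<phi> u v))\<^sup>2)" if "norm v < 1" "0 \<le> u" "u < d" for u v
  proof -
    have "1 - (norm v)\<^sup>2 \<le> disk_selfmap.distortion (\<phi> u) * (1 - (norm (\<phi> u v))\<^sup>2)"
      using disk_selfmap.one_minus_norm_sq_distortion[OF selfmap] that by simp
    also have "\<dots> \<le> 3 * (1 - (norm (\<phi> u v))\<^sup>2)"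
      using d(2)[of u] that one_minus_norm_sq_pos[of "\<phi> u v"] by (intro mult_right_mono) auto
    finally show ?thesis .
  qed
  have iter: "1 - (norm w)\<^sup>2 \<le> 3 ^ n * (1 - (norm (\<phi> u w))\<^sup>2)" if "0 \<le> u" "u \<le> real n * (d / 2)" for n u
    using that
  proof (induction n arbitrary: u)
    case 0
    then show ?case using assms by (simp add: at_0)
  next
    case (Suc n)
    define v where "v = min u (d / 2)"
    have v: "0 \<le> v" "v < d" "0 \<le> u - v" "u - v \<le> real n * (d / 2)"
      using Suc.prems d(1) by (auto simp: v_def min_def algebra_simps)
    have "1 - (norm w)\<^sup>2 \<le> 3 ^ n * (1 - (norm (\<phi> (u - v) w))\<^sup>2)" by (rule Suc.IH) (use v in auto)
    also have "\<dots> \<le> 3 ^ n * (3 * (1 - (norm (\<phi> v (\<phi> (u - v) w)))\<^sup>2))"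
      using v assms by (intro mult_left_mono one) auto
    also have "\<phi> v (\<phi> (u - v) w) = \<phi> u w" using add[of v "u - v" w] v assms by simp
    finally show ?case by (simp add: algebra_simps)
  qed
  obtain n where n: "T / (d / 2) < real n" using reals_Archimedean2 by blast
  then have n': "T \<le> real n * (d / 2)" using d(1) by (simp add: field_simps)
  show ?thesis
  proof (rule that[of "(1 - (norm w)\<^sup>2) / 3 ^ n"])
    show "0 < (1 - (norm w)\<^sup>2) / 3 ^ n" using one_minus_norm_sq_pos[of w] assms by simp
    show "(1 - (norm w)\<^sup>2) / 3 ^ n \<le> 1 - (norm (\<phi> u w))\<^sup>2" if "0 \<le> u" "u \<le> T" for u
      using iter[of u n] that n' by (simp add: field_simps)
  qed
qed

lemma inj_on_disk:
  assumes T: "0 \<le> T"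
  shows "inj_on (\<phi> T) disk"
proof (rule inj_onI)
  fix x y assume xy: "x \<in> disk" "y \<in> disk" "\<phi> T x = \<phi> T y"
  show "x = y"
  proof (cases "T = 0")
    case True
    then show ?thesis using xy by (simp add: at_0)
  next
    case False
    obtain m1 where m1: "0 < m1" "\<And>u. 0 \<le> u \<Longrightarrow> u \<le> T \<Longrightarrow> m1 \<le> 1 - (norm (\<phi> u x))\<^sup>2"
      using orbit_bounded[of x T] xy T by auto
    obtain m2 where m2: "0 < m2" "\<And>u. 0 \<le> u \<Longrightarrow> u \<le> T \<Longrightarrow> m2 \<le> 1 - (norm (\<phi> u y))\<^sup>2"
      using orbit_bounded[of y T] xy T by auto
    define R where "R = sqrt (1 - min m1 m2)"
    have R: "R < 1" using m1(1) m2(1) by (simp add: R_def)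
    have orb: "\<phi> u x \<in> cball 0 R" "\<phi> u y \<in> cball 0 R" if "0 \<le> u" "u \<le> T" for u
      using m1(2)[OF that] m2(2)[OF that] by (auto simp: R_def intro!: real_le_rsqrt)
    obtain d where d: "0 < d" "\<And>t. 0 < t \<Longrightarrow> t < d \<Longrightarrow> inj_on (\<phi> t) (cball 0 R)"
      using inj_on_cball_small[OF R] by blast
    obtain n where n: "T / d < real n" using reals_Archimedean2 by blast
    have "0 < T" using T False by simp
    have "0 < n" using n \<open>0 < T\<close> d(1) by (metis divide_pos_pos gr0I not_less_iff_gr_or_eq of_nat_0)
    define h where "h = T / real n"
    have h: "0 < h" "h < d" "real n * h = T"
      using n \<open>0 < T\<close> \<open>0 < n\<close> d(1) by (auto simp: h_def field_simps)
    \<comment> \<open>Equality of the two orbits is pulled back by one step \<open>h\<close> at a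
      time, from \<open>T\<close> down to 0; each step needs injectivity only on the ball that
      contains both orbits.\<close>
    have "\<phi> (real k * h) x = \<phi> (real k * h) y \<Longrightarrow> k \<le> n \<Longrightarrow> x = y" for k
    proof (induction k)
      case 0
      then show ?case using xy by (simp add: at_0)
    next
      case (Suc k)
      have "real k * h \<le> real n * h" using Suc.prems h by (intro mult_right_mono) auto
      then have kh: "0 \<le> real k * h" "real k * h \<le> T" using h by auto
      have e: "\<phi> (real (Suc k) * h) v = \<phi> h (\<phi> (real k * h) v)" if "v \<in> disk" for v
        using add[of h "real k * h" v] kh h that by (simp add: algebra_simps)
      have "\<phi> h (\<phi> (real k * h) x) = \<phi> h (\<phi> (real k * h) y)"
        using Suc.prems(1) e xy by simp
      then have "\<phi> (real k * h) x = \<phi> (real k * h) y"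
        using d(2)[OF h(1,2)] orb[OF kh] by (meson inj_onD)
      then show ?case using Suc by simp
    qed
    from this[of n] show ?thesis using xy(3) h by simp
  qed
qed

text \<open>Points near the circle are not moved far inside for small times: the image of a slightly larger
  disk already covers a given compact disk (Brouwer), and the maps are injective.\<close>

lemma boundary_preserved:
  assumes "R' < 1"
  obtains R d where "R < 1" "0 < d" "R' \<le> R" "\<And>t a. 0 < t \<Longrightarrow> t < d \<Longrightarrow> a \<in> disk \<Longrightarrow> R < norm a \<Longrightarrow> R' < norm (\<phi> t a)"
proof -
  define R where "R = (1 + max R' 0) / 2"
  have R: "0 < R" "R' < R" "R < 1" using assms by (auto simp: R_def)
  obtain d where d: "0 < d" "\<And>t z. 0 < t \<Longrightarrow> t < d \<Longrightarrow> z \<in> cball 0 R \<Longrightarrow> norm (\<phi> t z - z) < R - R'"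
    using uniformly_near_identity[OF R(3), of "R - R'"] R by auto
  show ?thesis
  proof (rule that[OF R(3) d(1)])
    fix t a assume t: "0 < t" "t < d" and a: "a \<in> disk" "R < norm a"
    interpret disk_selfmap "\<phi> t" by (rule selfmap) (use t in simp)
    show "R' < norm (\<phi> t a)"
    proof (rule ccontr)
      assume "\<not> R' < norm (\<phi> t a)"
      then have w: "norm (\<phi> t a) \<le> R'" by simp
      \<comment> \<open>A fixed point of \<open>x - \<phi> t x + \<phi> t a\<close> is a preimage of
        \<open>\<phi> t a\<close>. The displacement is below \<open>R - R'\<close> and the target
        has norm at most \<open>R'\<close>, so the closed ball is mapped into itself.\<close>
      obtain x where x: "x \<in> cball 0 R" "x - \<phi> t x + \<phi> t a = x"
      proof (rule brouwer[of "cball 0 R" "\<lambda>x. x - \<phi> t x + \<phi> t a"])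
        show "continuous_on (cball 0 R) (\<lambda>x. x - \<phi> t x + \<phi> t a)"
          using R by (intro continuous_intros holomorphic_on_imp_continuous_on holomorphic_on_subset[OF holo]) auto
        have "norm (x - \<phi> t x + \<phi> t a) \<le> R" if "x \<in> cball 0 R" for x
        proof -
          have "norm (x - \<phi> t x + \<phi> t a) \<le> norm (x - \<phi> t x) + norm (\<phi> t a)" by (rule norm_triangle_ineq)
          then show ?thesis using d(2)[OF t that] w by (simp add: norm_minus_commute)
        qed
        then show "(\<lambda>x. x - \<phi> t x + \<phi> t a) \<in> cball 0 R \<rightarrow> cball 0 R" by auto
      qed (use R in auto)
      then have "\<phi> t x = \<phi> t a" by (simp add: algebra_simps)
      then have "x = a"
        using inj_on_disk[of t] t a x(1) R by (auto dest!: inj_onD)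
      then show False using x(1) a by simp
    qed
  qed (use R in simp)
qed

text \<open>If all maps with times below \<open>d\<close> were the identity, the semigroup law would
  spread this to every time in steps of at most \<open>d / 2\<close>.\<close>

lemma small_nontrivial_time:
  assumes "nontrivial_semigroup \<phi>" "0 < d"
  obtains t z where "0 < t" "t < d" "z \<in> disk" "\<phi> t z \<noteq> z"
proof (rule ccontr)
  note found = that
  assume neg: "\<not> thesis"
  have id: "\<phi> t z = z" if "0 \<le> t" "t < d" "norm z < 1" for t z
  proof (rule ccontr)
    assume ne: "\<phi> t z \<noteq> z"
    then have "t \<noteq> 0" using at_0 that by auto
    then show False using neg found[of t z] that ne by auto
  qed
  have iter: "\<phi> t z = z" if "0 \<le> t" "t \<le> real n * (d / 2)" "norm z < 1" for n t z
    using that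
  proof (induction n arbitrary: t)
    case 0
    then show ?case by (simp add: at_0)
  next
    case (Suc n)
    define v where "v = min t (d / 2)"
    have v: "0 \<le> v" "v < d" "0 \<le> t - v" "t - v \<le> real n * (d / 2)"
      using Suc.prems assms(2) by (auto simp: v_def min_def algebra_simps)
    have "\<phi> t z = \<phi> v (\<phi> (t - v) z)" using add[of v "t - v" z] v Suc.prems by simp
    also have "\<dots> = z" using Suc.IH[of "t - v"] id v Suc.prems by simp
    finally show ?case .
  qed
  obtain t z where tz: "0 \<le> t" "z \<in> disk" "\<phi> t z \<noteq> z"
    using assms(1) by (auto simp: nontrivial_semigroup_def)
  obtain n where "t / (d / 2) < real n" using reals_Archimedean2 by blast
  then have "t \<le> real n * (d / 2)" using assms(2) by (simp add: field_simps)
  then show False using iter tz by simp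
qed

end

section \<open>Strong continuity\<close>

locale semigroup_params = admissible_params p s \<alpha> + disk_semigroup \<phi>
  for p s \<alpha> :: real and \<phi> :: "real \<Rightarrow> complex \<Rightarrow> complex"
begin

lemma compose_tendsto_uniform:
  assumes f: "f holomorphic_on disk" and R: "R < 1" and e: "0 < e"
  shows "eventually (\<lambda>t. \<forall>z\<in>cball 0 R. norm (f (\<phi> t z) - f z) \<le> e) (at_right 0)"
proof -
  define R2 where "R2 = (1 + R) / 2"
  have R2: "R < R2" "R2 < 1" using R by (auto simp: R2_def)
  have "continuous_on (cball 0 R2) f"
    using R2 by (intro holomorphic_on_imp_continuous_on holomorphic_on_subset[OF f]) auto
  then have "uniformly_continuous_on (cball 0 R2) f"
    by (rule compact_uniformly_continuous) auto
  then obtain d where d: "0 < d" "\<And>x y. x \<in> cball 0 R2 \<Longrightarrow> y \<in> cball 0 R2 \<Longrightarrow> dist y x < d \<Longrightarrow> dist (f y) (f x) < e"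
    unfolding uniformly_continuous_on_def using e by metis
  have "0 < min d (R2 - R)" using d R2 by auto
  then obtain d' where d': "0 < d'" "\<And>t z. 0 < t \<Longrightarrow> t < d' \<Longrightarrow> z \<in> cball 0 R \<Longrightarrow> norm (\<phi> t z - z) < min d (R2 - R)"
    using uniformly_near_identity[OF R] by blast
  have "norm (f (\<phi> t z) - f z) \<le> e" if "0 < t" "t < d'" "z \<in> cball 0 R" for t z
  proof -
    have n: "norm (\<phi> t z - z) < min d (R2 - R)" by (rule d'(2)[OF that])
    have "norm (\<phi> t z) \<le> norm z + norm (\<phi> t z - z)" using norm_triangle_ineq[of z "\<phi> t z - z"] by simp
    then have "\<phi> t z \<in> cball 0 R2" using n that(3) by auto
    moreover have "z \<in> cball 0 R2" using that(3) R2 by auto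
    ultimately show ?thesis using d(2)[of z "\<phi> t z"] n by (auto simp: dist_norm)
  qed
  then show ?thesis using d'(1) unfolding eventually_at_right_field by blast
qed

lemma diff_holomorphic:
  "f holomorphic_on disk \<Longrightarrow> 0 \<le> t \<Longrightarrow> (\<lambda>z. f (\<phi> t z) - f z) holomorphic_on disk"
  by (rule holomorphic_on_diff[OF holomorphic_compose_selfmap[OF selfmap]])

lemma diff_M_space:
  "f \<in> M_space \<alpha> p s \<Longrightarrow> 0 \<le> t \<Longrightarrow> (\<lambda>z. f (\<phi> t z) - f z) \<in> M_space \<alpha> p s"
  by (rule M_space_diff[OF M_space_compose[OF selfmap inj_on_disk]])

lemma eventually_at_right_0_pos: "eventually (\<lambda>t::real. 0 < t) (at_right 0)"
  by (rule eventually_at_right_less)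

text \<open>Strong continuity at the base point 0, which requires no decay. For small times the
  annulus \<open>E\<close> is mapped into \<open>G n\<close>, where \<open>f\<close> has little
  energy, so both terms of the difference are small there; inside, derivatives converge
  uniformly.\<close>

lemma energy_diff_tendsto_0:
  assumes f: "f holomorphic_on disk" and fin: "energy f 0 < \<infinity>" and e: "0 < e"
  shows "eventually (\<lambda>t. energy (\<lambda>z. f (\<phi> t z) - f z) 0 \<le> ennreal e) (at_right 0)"
proof -
  define c where "c = 2 powr p"
  have c: "0 < c" by (simp add: c_def)
  \<comment> \<open>On the annulus three terms of size \<open>e1\<close> arise, multiplied by
    \<open>c\<close>; their total 3/8 of \<open>e\<close> fits into the half reserved for
    it.\<close>
  define e1 where "e1 = e / (8 * c)"
  have e1: "0 < e1" using e c by (simp add: e1_def)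
  \<comment> \<open>The cost of moving the base point from \<open>\<phi> t 0\<close> to 0; for small
    times \<open>\<phi> t 0\<close> lies in the ball of radius 1/2, so the cost is independent of
    \<open>t\<close>.\<close>
  define Q where "Q = (1 / (1 - 1/2)\<^sup>2) powr q"
  have Q: "0 < Q" by (simp add: Q_def)
  obtain \<eta> where \<eta>: "0 < \<eta>" "ennreal Q * (ennreal \<eta> * energy f 0) \<le> ennreal e1"
    using ennreal_le_fraction[OF fin Q e1] by auto
  define L where "L = split_const \<eta>"
  note L = split_const_pos[OF \<eta>(1), folded L_def] energy_on_compose[OF \<eta>(1), folded L_def]
  define G where "G n = {z::complex. exhaust_radius n < norm z}" for n
  have G: "G n \<in> sets borel" for n unfolding G_def by measurable
  have ev: "eventually (\<lambda>n. z \<notin> G n) sequentially" if "z \<in> disk" for z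
  proof -
    have "eventually (\<lambda>n. norm z < exhaust_radius n) sequentially"
      using that by (intro eventually_exhaust_radius) auto
    then show ?thesis by eventually_elim (simp add: G_def)
  qed
  \<comment> \<open>The first bound serves \<open>f\<close> itself, the second its composition,
    which picks up the factors \<open>L\<close> and \<open>Q\<close>.\<close>
  define e2 where "e2 = min e1 (e1 / (L * Q))"
  have e2: "0 < e2" using e1 L Q by (simp add: e2_def)
  have "(\<lambda>z. ennreal (density f 0 z)) \<in> borel_measurable dA"
    using density_measurable[OF f, of 0] by simp
  moreover have "(\<integral>\<^sup>+z. ennreal (density f 0 z) \<partial>dA) < \<infinity>"
    using fin by (simp add: energy_on_def)
  ultimately obtain n where "(\<integral>\<^sup>+z\<in>G n. ennreal (density f 0 z) \<partial>dA) \<le> ennreal e2"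
    using nn_integral_vanishing_sets[of "\<lambda>z. ennreal (density f 0 z)" G e2] G ev e2 by blast
  then have n: "energy_on (G n) f 0 \<le> ennreal e2" by (simp add: energy_on_def)
  obtain R d where R: "R < 1" "0 < d" "exhaust_radius n \<le> R"
    "\<And>t a. 0 < t \<Longrightarrow> t < d \<Longrightarrow> a \<in> disk \<Longrightarrow> R < norm a \<Longrightarrow> exhaust_radius n < norm (\<phi> t a)"
    using boundary_preserved[OF exhaust_radius(2)] by metis
  have R0: "0 < R" using R(3) exhaust_radius(1)[of n] by simp
  define E where "E = {z::complex. R < norm z}"
  have E: "E \<in> sets borel" unfolding E_def by measurable
  have EG: "E \<subseteq> G n" using R(3) by (auto simp: E_def G_def)
  obtain d0 where d0: "0 < d0" "ennreal d0 * emeasure dA disk \<le> ennreal (e / 2)"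
    using ennreal_le_fraction[OF emeasure_disk_measure_finite zero_less_one, of "e / 2"] e by auto
  \<comment> \<open>With derivatives of modulus at most \<open>\<kappa>\<close> the density off the
    annulus is at most \<open>d0\<close>, whose integral over the disk is at most
    \<open>e / 2\<close>.\<close>
  define \<kappa> where "\<kappa> = d0 powr (1 / p)"
  have \<kappa>: "0 < \<kappa>" "\<kappa> powr p = d0" using d0 params by (auto simp: \<kappa>_def powr_powr)
  define R2 where "R2 = (1 + R) / 2"
  have R2: "R < R2" "R2 < 1" using R by (auto simp: R2_def)
  obtain d1 where d1: "0 < d1" "\<And>t. 0 \<le> t \<Longrightarrow> t < d1 \<Longrightarrow> norm (\<phi> t 0) \<le> 1/2 \<and> disk_selfmap.distortion (\<phi> t) \<le> 3"
    using distortion_small by blast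
  have "eventually (\<lambda>t. \<forall>z\<in>cball 0 R2. norm (f (\<phi> t z) - f z) \<le> \<kappa> * (R2 - R)) (at_right 0)"
    using \<kappa> R2 by (intro compose_tendsto_uniform f) auto
  moreover have "eventually (\<lambda>t. t < min d d1) (at_right (0::real))"
    using R(2) d1(1) by (intro order_tendstoD[OF tendsto_ident_at]) auto
  ultimately show ?thesis
    using eventually_at_right_0_pos
  proof eventually_elim
    case (elim t)
    then have t: "0 < t" "t < d" "t < d1" "0 \<le> t" by auto
    have ft: "(\<lambda>z. f (\<phi> t z)) holomorphic_on disk"
      by (rule holomorphic_compose_selfmap[OF selfmap[OF t(4)] f])
    note gt = diff_holomorphic[OF f t(4)]
    have b: "\<phi> t 0 \<in> disk" "norm (\<phi> t 0) \<le> 1/2" using t d1(2)[of t] by auto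
    have half: "1 / 2 < (1::real)" by simp
    have "energy_on E (\<lambda>z. f (\<phi> t z)) 0 \<le> ennreal L * energy_on (G n) f (\<phi> t 0) + ennreal \<eta> * energy f (\<phi> t 0)"
      by (rule L(2)[OF selfmap[OF t(4)] inj_on_disk[OF t(4)] f _ E G])
         (use R(4)[OF t(1,2)] in \<open>auto simp: E_def G_def\<close>)
    also have "\<dots> \<le> ennreal L * (ennreal Q * energy_on (G n) f 0) + ennreal \<eta> * (ennreal Q * energy f 0)"
      unfolding Q_def by (intro add_mono mult_left_mono energy_on_aut_jac_le_radius f G b half) auto
    also have "\<dots> \<le> ennreal L * (ennreal Q * ennreal (e1 / (L * Q))) + ennreal e1"
    proof (intro add_mono mult_left_mono)
      show "energy_on (G n) f 0 \<le> ennreal (e1 / (L * Q))"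
        using n by (rule order_trans) (simp add: e2_def ennreal_leI)
      show "ennreal \<eta> * (ennreal Q * energy f 0) \<le> ennreal e1"
        using \<eta>(2) by (simp add: mult_ac)
    qed auto
    also have "ennreal L * (ennreal Q * ennreal (e1 / (L * Q))) = ennreal e1"
      using L(1) Q e1 by (simp flip: ennreal_mult)
    finally have 1: "energy_on E (\<lambda>z. f (\<phi> t z)) 0 \<le> ennreal e1 + ennreal e1" .
    have 2: "energy_on E f 0 \<le> ennreal e1"
    proof -
      have "energy_on E f 0 \<le> energy_on (G n) f 0" using EG by (intro energy_on_mono) auto
      also have "\<dots> \<le> ennreal e1" using n by (rule order_trans) (simp add: e2_def ennreal_leI)
      finally show ?thesis .
    qed
    have "energy_on E (\<lambda>z. f (\<phi> t z) + (-1) * f z) 0 \<le> ennreal c * (energy_on E (\<lambda>z. f (\<phi> t z)) 0 + energy_on E (\<lambda>z. (-1) * f z) 0)"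
      unfolding c_def by (intro energy_on_add ft E holomorphic_intros f) auto
    also have "energy_on E (\<lambda>z. (-1) * f z) 0 = energy_on E f 0"
      by (subst energy_on_cmult[OF f _ E]) auto
    also have "ennreal c * (energy_on E (\<lambda>z. f (\<phi> t z)) 0 + energy_on E f 0) \<le> ennreal c * ((ennreal e1 + ennreal e1) + ennreal e1)"
      by (intro mult_left_mono add_mono 1 2) auto
    also have "\<dots> = ennreal (c * (e1 + e1 + e1))"
      using c e1 by (simp only: ennreal_mult ennreal_plus less_imp_le add_nonneg_nonneg)
    also have "\<dots> \<le> ennreal (e / 2)" using c e by (intro ennreal_leI) (simp add: e1_def field_simps)
    finally have 3: "energy_on E (\<lambda>z. f (\<phi> t z) - f z) 0 \<le> ennreal (e / 2)" by simp
    have "energy_on (- E) (\<lambda>z. f (\<phi> t z) - f z) 0 \<le> (\<integral>\<^sup>+z. ennreal d0 \<partial>dA)"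
      unfolding energy_on_def
    proof (rule nn_integral_mono)
      fix z assume "z \<in> space dA"
      then have z: "z \<in> disk" by simp
      show "ennreal (density (\<lambda>z. f (\<phi> t z) - f z) 0 z) * indicator (- E) z \<le> ennreal d0"
      proof (cases "z \<in> E")
        case False
        then have zR: "z \<in> cball 0 R" by (simp add: E_def)
        have "norm (deriv (\<lambda>z. f (\<phi> t z) - f z) z) \<le> \<kappa> * (R2 - R) / (R2 - R)"
          by (rule cauchy_deriv_bound[OF gt _ R2 _ zR]) (use R0 elim(1) in auto)
        then have "norm (deriv (\<lambda>z. f (\<phi> t z) - f z) z) powr p \<le> \<kappa> powr p"
          using R2 params by (intro powr_mono2) auto
        moreover have "(1 - (norm z)\<^sup>2) powr s \<le> 1"
          using one_minus_norm_sq_pos[OF z] params by (intro powr_le1) auto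
        ultimately have "norm (deriv (\<lambda>z. f (\<phi> t z) - f z) z) powr p * (1 - (norm z)\<^sup>2) powr s \<le> \<kappa> powr p * 1"
          by (intro mult_mono) auto
        then show ?thesis using False by (simp add: density_def \<kappa> ennreal_leI)
      qed simp
    qed
    also have "\<dots> = ennreal d0 * emeasure dA disk" by simp
    also have "\<dots> \<le> ennreal (e / 2)" by (rule d0(2))
    finally have 4: "energy_on (- E) (\<lambda>z. f (\<phi> t z) - f z) 0 \<le> ennreal (e / 2)" .
    have "energy (\<lambda>z. f (\<phi> t z) - f z) 0 = energy_on E (\<lambda>z. f (\<phi> t z) - f z) 0 + energy_on (- E) (\<lambda>z. f (\<phi> t z) - f z) 0"
      by (rule energy_on_split[OF gt _ E]) simp
    also have "\<dots> \<le> ennreal (e / 2) + ennreal (e / 2)" by (intro add_mono 3 4)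
    also have "\<dots> = ennreal e" using e by (simp flip: ennreal_plus)
    finally show ?case .
  qed
qed

lemma scaled_energy_compose_small:
  obtains K d where "0 < K" "0 < d"
    "\<And>t f a. 0 < t \<Longrightarrow> t < d \<Longrightarrow> f holomorphic_on disk \<Longrightarrow> a \<in> disk \<Longrightarrow>
      scaled_energy (\<lambda>z. f (\<phi> t z)) a \<le> ennreal K * scaled_energy f (\<phi> t a)"
proof -
  define K where "K = compose_const"
  note K = compose_const_pos[folded K_def] scaled_energy_compose[folded K_def]
  obtain d where d: "0 < d" "\<And>t. 0 \<le> t \<Longrightarrow> t < d \<Longrightarrow> norm (\<phi> t 0) \<le> 1/2 \<and> disk_selfmap.distortion (\<phi> t) \<le> 3"
    using distortion_small by blast
  show ?thesis
  proof (rule that[of "K * 3 powr (\<alpha> * p)" d])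
    fix t f a assume *: "0 < t" "t < d" "f holomorphic_on disk" "a \<in> disk"
    interpret T: disk_selfmap "\<phi> t" by (rule selfmap) (use * in simp)
    have "scaled_energy (\<lambda>z. f (\<phi> t z)) a \<le> ennreal (K * T.distortion powr (\<alpha> * p)) * scaled_energy f (\<phi> t a)"
      using * by (intro K T.disk_selfmap_axioms inj_on_disk) auto
    also have "\<dots> \<le> ennreal (K * 3 powr (\<alpha> * p)) * scaled_energy f (\<phi> t a)"
      using d(2)[of t] * T.distortion_ge_1 params K(1)
      by (intro mult_right_mono ennreal_leI mult_left_mono powr_mono2) auto
    finally show "scaled_energy (\<lambda>z. f (\<phi> t z)) a \<le> ennreal (K * 3 powr (\<alpha> * p)) * scaled_energy f (\<phi> t a)" .
  qed (use K d in auto)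
qed

abbreviation cont_space :: "(complex \<Rightarrow> complex) set" where
  "cont_space \<equiv> strong_cont_space \<phi> (M_space \<alpha> p s) (M_norm \<alpha> p s)"

lemma eventually_diff_M_space:
  "f \<in> M_space \<alpha> p s \<Longrightarrow> eventually (\<lambda>t. (\<lambda>z. f (\<phi> t z) - f z) \<in> M_space \<alpha> p s) (at_right 0)"
  using eventually_at_right_0_pos by eventually_elim (simp add: diff_M_space)

text \<open>The value at 0 converges and the difference belongs to the space in any case, so the
  uniform smallness of the energies is the only genuine condition.\<close>

lemma cont_space_iff:
  "f \<in> cont_space \<longleftrightarrow> f \<in> M_space \<alpha> p s \<and>
    (\<forall>e>0. eventually (\<lambda>t. \<forall>a\<in>disk. scaled_energy (\<lambda>z. f (\<phi> t z) - f z) a \<le> ennreal e) (at_right 0))"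
proof (cases "f \<in> M_space \<alpha> p s")
  case True
  have "((\<lambda>t. f (\<phi> t 0) - f 0) \<longlongrightarrow> 0) (at_right 0)"
  proof (rule tendstoI)
    fix e :: real assume "0 < e"
    then have "eventually (\<lambda>t. \<forall>z\<in>cball 0 0. norm (f (\<phi> t z) - f z) \<le> e / 2) (at_right 0)"
      by (intro compose_tendsto_uniform M_space_holomorphic[OF True]) auto
    then show "eventually (\<lambda>t. dist (f (\<phi> t 0) - f 0) 0 < e) (at_right 0)"
      by eventually_elim (use \<open>0 < e\<close> in auto)
  qed
  then show ?thesis
    using True eventually_diff_M_space[OF True] M_norm_tendsto_0_iff[OF eventually_diff_M_space[OF True]]
    by (simp add: strong_cont_space_def)
qed (simp add: strong_cont_space_def)

text \<open>For \<open>a\<close> near the circle both terms of the difference are small separately,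
  the composed one because \<open>\<phi> t a\<close> is still near the circle. For the remaining
  \<open>a\<close> the base point is moved to 0 at the bounded cost \<open>Q\<close>.\<close>

theorem m_space_subset_cont_space: "m_space \<alpha> p s \<subseteq> cont_space"
proof
  fix f assume fm: "f \<in> m_space \<alpha> p s"
  then have fM: "f \<in> M_space \<alpha> p s" by (simp add: m_space_iff)
  then have f: "f holomorphic_on disk" by (rule M_space_holomorphic)
  have fin: "energy f 0 < \<infinity>" using M_space_finite[OF fM, of 0] by (simp add: scaled_energy_def)
  obtain K d where K: "0 < K" "0 < d"
    "\<And>t f a. 0 < t \<Longrightarrow> t < d \<Longrightarrow> f holomorphic_on disk \<Longrightarrow> a \<in> disk \<Longrightarrow>
      scaled_energy (\<lambda>z. f (\<phi> t z)) a \<le> ennreal K * scaled_energy f (\<phi> t a)"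
    using scaled_energy_compose_small by blast
  have "eventually (\<lambda>t. \<forall>a\<in>disk. scaled_energy (\<lambda>z. f (\<phi> t z) - f z) a \<le> ennreal e) (at_right 0)" if e: "0 < e" for e
  proof -
    define c where "c = 2 powr p"
    have c: "0 < c" by (simp add: c_def)
    define e1 where "e1 = e / (2 * c)"
    have e1: "0 < e1" using e c by (simp add: e1_def)
    \<comment> \<open>The bound \<open>e1\<close> is for \<open>f\<close> at \<open>a\<close>, and
      \<open>e1 / K\<close> for \<open>f\<close> at \<open>\<phi> t a\<close>, where composition
      costs the factor \<open>K\<close>.\<close>
    then have "0 < min e1 (e1 / K)" using K by simp
    then obtain R' where R': "R' < 1" "\<And>b. b \<in> disk \<Longrightarrow> R' < norm b \<Longrightarrow> scaled_energy f b \<le> ennreal (min e1 (e1 / K))"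
      using fm unfolding m_space_iff by meson
    obtain R d' where R: "R < 1" "0 < d'" "R' \<le> R"
      "\<And>t a. 0 < t \<Longrightarrow> t < d' \<Longrightarrow> a \<in> disk \<Longrightarrow> R < norm a \<Longrightarrow> R' < norm (\<phi> t a)"
      using boundary_preserved[OF R'(1)] by metis
    define Q where "Q = (1 / (1 - R)\<^sup>2) powr q"
    have Q: "0 < Q" using R by (simp add: Q_def)
    have "eventually (\<lambda>t. energy (\<lambda>z. f (\<phi> t z) - f z) 0 \<le> ennreal (e / Q)) (at_right 0)"
      using e Q by (intro energy_diff_tendsto_0 f fin) auto
    moreover have "eventually (\<lambda>t. t < min d d') (at_right (0::real))"
      using R(2) K(2) by (intro order_tendstoD[OF tendsto_ident_at]) auto
    ultimately show ?thesis
      using eventually_at_right_0_pos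
    proof eventually_elim
      case (elim t)
      then have t: "0 < t" "t < d" "t < d'" "0 \<le> t" by auto
      have ft: "(\<lambda>z. f (\<phi> t z)) holomorphic_on disk"
        by (rule holomorphic_compose_selfmap[OF selfmap[OF t(4)] f])
      show ?case
      proof
        fix a assume a: "a \<in> disk"
        show "scaled_energy (\<lambda>z. f (\<phi> t z) - f z) a \<le> ennreal e"
        proof (cases "R < norm a")
          case True
          have "scaled_energy f a \<le> ennreal (min e1 (e1 / K))"
            using True R(3) by (intro R' a) auto
          then have 1: "scaled_energy f a \<le> ennreal e1"
            by (rule order_trans) (simp add: ennreal_leI)
          have "scaled_energy (\<lambda>z. f (\<phi> t z)) a \<le> ennreal K * scaled_energy f (\<phi> t a)"
            by (rule K(3)[OF t(1,2) f a])
          also have "\<dots> \<le> ennreal K * ennreal (min e1 (e1 / K))"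
            using a t R(4)[OF t(1,3) a True] by (intro mult_left_mono R') auto
          also have "\<dots> \<le> ennreal K * ennreal (e1 / K)" by (intro mult_left_mono ennreal_leI) auto
          also have "\<dots> = ennreal e1" using K e1 by (simp flip: ennreal_mult)
          finally have 2: "scaled_energy (\<lambda>z. f (\<phi> t z)) a \<le> ennreal e1" .
          have "scaled_energy (\<lambda>z. f (\<phi> t z) - f z) a \<le> ennreal c * (scaled_energy (\<lambda>z. f (\<phi> t z)) a + scaled_energy f a)"
            unfolding c_def by (rule scaled_energy_diff[OF ft f a])
          also have "\<dots> \<le> ennreal c * (ennreal e1 + ennreal e1)"
            by (intro mult_left_mono add_mono 1 2) auto
          also have "\<dots> = ennreal (c * (e1 + e1))"
            using c e1 by (simp only: ennreal_mult ennreal_plus less_imp_le add_nonneg_nonneg)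
          also have "c * (e1 + e1) = e" using c by (simp add: e1_def)
          finally show ?thesis .
        next
          case False
          have "scaled_energy (\<lambda>z. f (\<phi> t z) - f z) a \<le> energy (\<lambda>z. f (\<phi> t z) - f z) a"
            by (rule scaled_energy_le_energy[OF a])
          also have "\<dots> \<le> ennreal Q * energy (\<lambda>z. f (\<phi> t z) - f z) 0"
            unfolding Q_def
            by (rule energy_on_aut_jac_le_radius[OF diff_holomorphic[OF f t(4)] _ a _ R(1)]) (use False in auto)
          also have "\<dots> \<le> ennreal Q * ennreal (e / Q)" by (intro mult_left_mono elim) auto
          also have "\<dots> = ennreal e" using Q e by (simp flip: ennreal_mult)
          finally show ?thesis .
        qed
      qed
    qed
  qed
  then show "f \<in> cont_space" using fM by (simp add: cont_space_iff)
qed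

theorem C0_semigroup_m_space: "C0_semigroup_on (m_space \<alpha> p s) (M_norm \<alpha> p s) (comp_op \<phi>)"
  unfolding C0_semigroup_on_def
proof (intro conjI allI impI ballI)
  fix t :: real and f assume t: "0 \<le> t" and f: "f \<in> m_space \<alpha> p s"
  show "comp_op \<phi> t f \<in> m_space \<alpha> p s"
    using m_space_compose[OF selfmap[OF t] inj_on_disk[OF t] f] by (simp add: comp_op_def comp_def)
next
  fix t :: real assume t: "0 \<le> t"
  obtain B where B: "\<And>f. f \<in> M_space \<alpha> p s \<Longrightarrow> M_norm \<alpha> p s (\<lambda>z. f (\<phi> t z)) \<le> B * M_norm \<alpha> p s f"
    using M_norm_compose[OF selfmap[OF t] inj_on_disk[OF t]] by metis
  show "\<exists>B. \<forall>f\<in>m_space \<alpha> p s. M_norm \<alpha> p s (comp_op \<phi> t f) \<le> B * M_norm \<alpha> p s f"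
    using B by (intro exI[of _ B]) (auto simp: comp_op_def comp_def m_space_def)
next
  fix f assume "f \<in> m_space \<alpha> p s"
  then have "f \<in> cont_space" using m_space_subset_cont_space by blast
  then show "((\<lambda>t. M_norm \<alpha> p s (\<lambda>z. comp_op \<phi> t f z - f z)) \<longlongrightarrow> 0) (at_right 0)"
    by (simp add: strong_cont_space_def comp_op_def)
next
  fix t u :: real and f z assume "0 \<le> t" "0 \<le> u" "z \<in> disk"
  then show "comp_op \<phi> (t + u) f z = comp_op \<phi> t (comp_op \<phi> u f) z"
    using add[of u t z] by (simp add: comp_op_def add.commute)
qed (auto simp: comp_op_def at_0)

text \<open>Limits are handled by the three-term argument: for small times composition costs one
  common factor \<open>K\<close> on scaled energies, so the approximation error stays small after
  composition, uniformly in \<open>t\<close>.\<close>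

theorem closed_subspace_cont_space: "closed_subspace_of cont_space (M_space \<alpha> p s) (M_norm \<alpha> p s)"
  unfolding closed_subspace_of_def
proof (intro conjI allI impI ballI)
  show "cont_space \<subseteq> M_space \<alpha> p s" by (auto simp: strong_cont_space_def)
next
  have z: "scaled_energy (\<lambda>_. 0) a = 0" if "a \<in> disk" for a
    using scaled_energy_cmult[of "\<lambda>_. 0" a 0] that params by simp
  have "(\<lambda>_. 0) \<in> M_space \<alpha> p s" by (rule M_spaceI[of _ 0]) (auto simp: z)
  then show "(\<lambda>_. 0) \<in> cont_space" by (auto simp: cont_space_iff z)
next
  fix f g assume f: "f \<in> cont_space" and g: "g \<in> cont_space"
  then have M: "f \<in> M_space \<alpha> p s" "g \<in> M_space \<alpha> p s" by (auto simp: cont_space_iff)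
  note hol = M_space_holomorphic[OF M(1)] M_space_holomorphic[OF M(2)]
  have "eventually (\<lambda>t. \<forall>a\<in>disk. scaled_energy (\<lambda>z. (f (\<phi> t z) + g (\<phi> t z)) - (f z + g z)) a \<le> ennreal e) (at_right 0)"
    if e: "0 < e" for e
  proof -
    define c where "c = 2 powr p"
    have c: "0 < c" by (simp add: c_def)
    have ec: "0 < e / (2 * c)" using e c by simp
    then have "eventually (\<lambda>t. \<forall>a\<in>disk. scaled_energy (\<lambda>z. f (\<phi> t z) - f z) a \<le> ennreal (e / (2 * c))) (at_right 0)"
      "eventually (\<lambda>t. \<forall>a\<in>disk. scaled_energy (\<lambda>z. g (\<phi> t z) - g z) a \<le> ennreal (e / (2 * c))) (at_right 0)"
      using f g by (auto simp: cont_space_iff)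
    then show ?thesis
      using eventually_at_right_0_pos
    proof eventually_elim
      case (elim t)
      show ?case
      proof
        fix a assume a: "a \<in> disk"
        have "scaled_energy (\<lambda>z. (f (\<phi> t z) + g (\<phi> t z)) - (f z + g z)) a =
           scaled_energy (\<lambda>z. (f (\<phi> t z) - f z) + (g (\<phi> t z) - g z)) a"
          by (rule scaled_energy_cong) simp
        also have "\<dots> \<le> ennreal c * (scaled_energy (\<lambda>z. f (\<phi> t z) - f z) a + scaled_energy (\<lambda>z. g (\<phi> t z) - g z) a)"
          unfolding c_def using elim by (intro scaled_energy_add diff_holomorphic hol a) auto
        also have "\<dots> \<le> ennreal c * (ennreal (e / (2 * c)) + ennreal (e / (2 * c)))"
          using elim a by (intro mult_left_mono add_mono) auto
        also have "\<dots> = ennreal (c * (e / (2 * c) + e / (2 * c)))"           using c ec by (simp only: ennreal_mult ennreal_plus less_imp_le add_nonneg_nonneg)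
        also have "c * (e / (2 * c) + e / (2 * c)) = e" using c by (simp add: field_simps)
        finally show "scaled_energy (\<lambda>z. (f (\<phi> t z) + g (\<phi> t z)) - (f z + g z)) a \<le> ennreal e" .
      qed
    qed
  qed
  then show "(\<lambda>z. f z + g z) \<in> cont_space" using M_space_add[OF M] by (simp add: cont_space_iff)
next
  fix c f assume f: "f \<in> cont_space"
  then have M: "f \<in> M_space \<alpha> p s" by (auto simp: cont_space_iff)
  have "eventually (\<lambda>t. \<forall>a\<in>disk. scaled_energy (\<lambda>z. c * f (\<phi> t z) - c * f z) a \<le> ennreal e) (at_right 0)"
    if e: "0 < e" for e
  proof -
    \<comment> \<open>The added 1 keeps the divisor positive when \<open>c\<close> is 0.\<close>
    define k where "k = norm c powr p + 1"
    have k: "0 < k" by (simp add: k_def add_nonneg_pos)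
    have "0 < e / k" using e k by simp
    then have "eventually (\<lambda>t. \<forall>a\<in>disk. scaled_energy (\<lambda>z. f (\<phi> t z) - f z) a \<le> ennreal (e / k)) (at_right 0)"
      using f by (auto simp: cont_space_iff)
    then show ?thesis
      using eventually_at_right_0_pos
    proof eventually_elim
      case (elim t)
      show ?case
      proof
        fix a assume a: "a \<in> disk"
        have "scaled_energy (\<lambda>z. c * f (\<phi> t z) - c * f z) a = scaled_energy (\<lambda>z. c * (f (\<phi> t z) - f z)) a"
          by (rule scaled_energy_cong) (simp add: algebra_simps)
        also have "\<dots> = ennreal (norm c powr p) * scaled_energy (\<lambda>z. f (\<phi> t z) - f z) a"
          using elim by (intro scaled_energy_cmult diff_holomorphic M_space_holomorphic[OF M] a) auto
        also have "\<dots> \<le> ennreal k * ennreal (e / k)"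
          using elim a by (intro mult_mono) (auto simp: k_def ennreal_leI)
        also have "\<dots> = ennreal e" using k e by (simp flip: ennreal_mult)
        finally show "scaled_energy (\<lambda>z. c * f (\<phi> t z) - c * f z) a \<le> ennreal e" .
      qed
    qed
  qed
  then show "(\<lambda>z. c * f z) \<in> cont_space" using M_space_cmult[OF M] by (simp add: cont_space_iff)
next
  fix F f assume *: "(\<forall>n::nat. F n \<in> cont_space) \<and> f \<in> M_space \<alpha> p s \<and> (\<lambda>n. M_norm \<alpha> p s (\<lambda>z. F n z - f z)) \<longlonglongrightarrow> 0"
  then have F: "F n \<in> cont_space" and M: "F n \<in> M_space \<alpha> p s" and f: "f \<in> M_space \<alpha> p s" for n
    by (auto simp: cont_space_iff)
  note hol = M_space_holomorphic[OF M] M_space_holomorphic[OF f]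
  have D: "(\<lambda>z. F n z - f z) \<in> M_space \<alpha> p s" for n by (rule M_space_diff[OF M f])
  note Dh = M_space_holomorphic[OF D]
  obtain K d where K: "0 < K" "0 < d"
    "\<And>t f a. 0 < t \<Longrightarrow> t < d \<Longrightarrow> f holomorphic_on disk \<Longrightarrow> a \<in> disk \<Longrightarrow>
      scaled_energy (\<lambda>z. f (\<phi> t z)) a \<le> ennreal K * scaled_energy f (\<phi> t a)"
    using scaled_energy_compose_small by blast
  have "eventually (\<lambda>t. \<forall>a\<in>disk. scaled_energy (\<lambda>z. f (\<phi> t z) - f z) a \<le> ennreal e) (at_right 0)" if e: "0 < e" for e
  proof -
    define c where "c = 2 powr p"
    have c: "0 < c" by (simp add: c_def)
    \<comment> \<open>Solves \<open>c * (e1 + c * (K * e1 + e1)) = e\<close>, the total produced by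
      two nested additions and one composition.\<close>
    define e1 where "e1 = e / (c * (1 + c * (K + 1)))"
    have e1: "0 < e1" using e c K by (simp add: e1_def add_pos_pos)
    have "eventually (\<lambda>n. \<forall>a\<in>disk. scaled_energy (\<lambda>z. F n z - f z) a \<le> ennreal e1) sequentially"
      using * M_norm_tendsto_0_iff[of "\<lambda>n z. F n z - f z" sequentially] D e1 by auto
    then obtain n where n: "\<And>a. a \<in> disk \<Longrightarrow> scaled_energy (\<lambda>z. F n z - f z) a \<le> ennreal e1"
      unfolding eventually_sequentially by blast
    have "eventually (\<lambda>t. \<forall>a\<in>disk. scaled_energy (\<lambda>z. F n (\<phi> t z) - F n z) a \<le> ennreal e1) (at_right 0)"
      using F[of n] e1 by (simp add: cont_space_iff)
    moreover have "eventually (\<lambda>t. t < d) (at_right (0::real))"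
      using K(2) by (intro order_tendstoD[OF tendsto_ident_at]) auto
    ultimately show ?thesis
      using eventually_at_right_0_pos
    proof eventually_elim
      case (elim t)
      then have t: "0 < t" "t < d" "0 \<le> t" by auto
      show ?case
      proof
        fix a assume a: "a \<in> disk"
        have ca: "\<phi> t a \<in> disk" using a t by simp
        have Dt: "(\<lambda>z. F n (\<phi> t z) - f (\<phi> t z)) holomorphic_on disk"
          by (rule holomorphic_compose_selfmap[OF selfmap[OF t(3)] Dh])
        have "scaled_energy (\<lambda>z. F n (\<phi> t z) - f (\<phi> t z)) a \<le> ennreal K * scaled_energy (\<lambda>z. F n z - f z) (\<phi> t a)"
          by (rule K(3)[OF t(1,2) Dh a])
        also have "\<dots> \<le> ennreal K * ennreal e1" by (intro mult_left_mono n ca) auto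
        finally have 1: "scaled_energy (\<lambda>z. F n (\<phi> t z) - f (\<phi> t z)) a \<le> ennreal K * ennreal e1" .
        have "scaled_energy (\<lambda>z. (F n (\<phi> t z) - f (\<phi> t z)) - (F n z - f z)) a \<le>
          ennreal c * (scaled_energy (\<lambda>z. F n (\<phi> t z) - f (\<phi> t z)) a + scaled_energy (\<lambda>z. F n z - f z) a)"
          unfolding c_def by (rule scaled_energy_diff[OF Dt Dh a])
        also have "\<dots> \<le> ennreal c * (ennreal K * ennreal e1 + ennreal e1)"
          by (intro mult_left_mono add_mono 1 n a) auto
        finally have 2: "scaled_energy (\<lambda>z. (F n (\<phi> t z) - f (\<phi> t z)) - (F n z - f z)) a \<le> ennreal c * (ennreal K * ennreal e1 + ennreal e1)" .
        have "scaled_energy (\<lambda>z. f (\<phi> t z) - f z) a =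
          scaled_energy (\<lambda>z. (F n (\<phi> t z) - F n z) - ((F n (\<phi> t z) - f (\<phi> t z)) - (F n z - f z))) a"
          by (rule scaled_energy_cong) simp
        also have "\<dots> \<le> ennreal c * (scaled_energy (\<lambda>z. F n (\<phi> t z) - F n z) a + scaled_energy (\<lambda>z. (F n (\<phi> t z) - f (\<phi> t z)) - (F n z - f z)) a)"
          unfolding c_def by (intro scaled_energy_diff diff_holomorphic hol t a holomorphic_on_diff Dt Dh)
        also have "\<dots> \<le> ennreal c * (ennreal e1 + ennreal c * (ennreal K * ennreal e1 + ennreal e1))"
          using elim(1) a by (intro mult_left_mono add_mono 2) auto
        also have "\<dots> = ennreal (c * (e1 + c * (K * e1 + e1)))"
          using c K(1) e1 by (simp only: ennreal_mult ennreal_plus less_imp_le add_nonneg_nonneg mult_nonneg_nonneg)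
        also have "c * (e1 + c * (K * e1 + e1)) = e1 * (c * (1 + c * (K + 1)))" by (simp add: algebra_simps)
        also have "\<dots> = e"
        proof -
          have "0 < c * (1 + c * (K + 1))" using c K by (simp add: add_pos_pos)
          then have "c * (1 + c * (K + 1)) \<noteq> 0" by (rule less_imp_neq[symmetric])
          then show ?thesis unfolding e1_def times_divide_eq_left by (rule nonzero_mult_div_cancel_right)
        qed
        finally show "scaled_energy (\<lambda>z. f (\<phi> t z) - f z) a \<le> ennreal e" .
      qed
    qed
  qed
  then show "f \<in> cont_space" using f by (simp add: cont_space_iff)
qed

end

section \<open>Kernel estimates\<close>

text \<open>For a negative exponent the disk is exhausted by the dyadic sets \<open>A n\<close>, of
  area proportional to \<open>(1/2) ^ n\<close>; the integrand is dominated by a series over them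
  that is geometric with ratio \<open>2 powr (- \<beta> - 1)\<close>, below 1 precisely because
  \<open>- 1 < \<beta>\<close>.\<close>

lemma nn_integral_disk_powr_finite:
  fixes \<beta> :: real
  assumes \<beta>: "- 1 < \<beta>"
  shows "(\<integral>\<^sup>+z. ennreal ((1 - (norm z)\<^sup>2) powr \<beta>) \<partial>dA) < \<infinity>"
proof (cases "0 \<le> \<beta>")
  case True
  have "(\<integral>\<^sup>+z. ennreal ((1 - (norm z)\<^sup>2) powr \<beta>) \<partial>dA) \<le> (\<integral>\<^sup>+z. 1 \<partial>dA)"
  proof (rule nn_integral_mono)
    fix z assume "z \<in> space dA"
    then have "(1 - (norm z)\<^sup>2) powr \<beta> \<le> 1"
      using True one_minus_norm_sq_pos[of z] by (intro powr_le1) auto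
    then show "ennreal ((1 - (norm z)\<^sup>2) powr \<beta>) \<le> 1"
      using ennreal_leI by fastforce
  qed
  also have "\<dots> < \<infinity>" using emeasure_disk_measure_finite by simp
  finally show ?thesis .
next
  case False
  define V where "V = measure lborel (ball (0::complex) 1)"
  define A where "A n = {z::complex. 1 - (norm z)\<^sup>2 \<le> (1/2) ^ n}" for n :: nat
  have A[measurable]: "A n \<in> sets borel" for n unfolding A_def by measurable
  define c where "c n = 2 powr (- \<beta> * real (n + 1))" for n :: nat
  have emA: "emeasure lborel (A n \<inter> disk) = ennreal (V * (1/2) ^ n)" for n
  proof -
    define r where "r = sqrt (1 - (1/2) ^ n)"
    have r: "0 \<le> r" "r \<le> 1" "r\<^sup>2 = 1 - (1/2) ^ n" by (auto simp: r_def power_le_one)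
    have r_iff: "1 - (norm z)\<^sup>2 \<le> (1/2) ^ n \<longleftrightarrow> r \<le> norm z" for z :: complex
    proof -
      have "r \<le> norm z \<longleftrightarrow> r\<^sup>2 \<le> (norm z)\<^sup>2" using r(1) by (intro power_mono_iff[symmetric]) auto
      then show ?thesis using r by linarith
    qed
    have "A n \<inter> disk = ball 0 1 - ball 0 r"
      unfolding A_def r_iff by (rule set_eqI) (simp add: not_less conj_commute)
    moreover have "ball 0 r \<subseteq> ball (0::complex) 1" using r(2) by (rule subset_ball)
    ultimately have "emeasure lborel (A n \<inter> disk) = emeasure lborel (ball (0::complex) 1) - emeasure lborel (ball (0::complex) r)"
      using emeasure_lborel_ball_finite[of "0::complex" r] by (simp only:) (rule emeasure_Diff; simp)
    also have "emeasure lborel (ball (0::complex) \<rho>) = ennreal (V * \<rho>\<^sup>2)" if "0 \<le> \<rho>" for \<rho>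
      using that emeasure_ball[of \<rho> "0::complex"] content_ball[of 1 "0::complex"] by (simp add: V_def)
    then have "emeasure lborel (ball (0::complex) 1) - emeasure lborel (ball (0::complex) r) = ennreal (V * 1\<^sup>2) - ennreal (V * r\<^sup>2)"
      using r by (metis zero_le_one)
    also have "\<dots> = ennreal (V * (1/2) ^ n)"
    proof -
      have "0 \<le> V * r\<^sup>2" by (simp add: V_def)
      then have "ennreal (V * 1\<^sup>2) - ennreal (V * r\<^sup>2) = ennreal (V * 1\<^sup>2 - V * r\<^sup>2)" by (rule ennreal_minus)
      then show ?thesis by (simp add: r(3) algebra_simps)
    qed
    finally show ?thesis .
  qed
  have pw: "ennreal ((1 - (norm z)\<^sup>2) powr \<beta>) \<le> (\<Sum>n. ennreal (c n) * indicator (A n) z)" if z: "z \<in> disk" for z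
  proof -
    define x where "x = 1 - (norm z)\<^sup>2"
    have x: "0 < x" "x \<le> 1" using one_minus_norm_sq_pos[OF z] by (auto simp: x_def)
    \<comment> \<open>With \<open>N = Suc n\<close> this places \<open>x\<close> between
      \<open>(1/2) ^ Suc n\<close> and \<open>(1/2) ^ n\<close>: the upper bound puts
      \<open>z\<close> into \<open>A n\<close>, the lower one bounds the power, whence the exponent
      \<open>n + 1\<close> in \<open>c\<close>.\<close>
    define N where "N = (LEAST n. (1/2) ^ n < x)"
    have ex: "\<exists>n. (1/2) ^ n < x" using x by (intro real_arch_pow_inv) auto
    have N: "(1/2) ^ N < x" unfolding N_def using ex by (rule LeastI_ex)
    then have "N \<noteq> 0" using x by (intro notI) auto
    then obtain n where n: "N = Suc n" by (cases N) auto
    have "\<not> (1/2) ^ n < x" using not_less_Least[of n "\<lambda>n. (1/2) ^ n < x"] n by (simp add: N_def)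
    then have "z \<in> A n" by (simp add: A_def x_def)
    have "x powr \<beta> \<le> ((1/2) ^ N) powr \<beta>"
      using N False by (intro powr_mono2') auto
    also have "\<dots> = c n"
      by (simp add: n c_def powr_realpow[symmetric] powr_powr powr_divide powr_minus_divide[symmetric] del: power_Suc) (simp add: algebra_simps)
    finally have "ennreal (x powr \<beta>) \<le> ennreal (c n) * indicator (A n) z"
      using \<open>z \<in> A n\<close> by (simp add: ennreal_leI)
    also have "\<dots> = (\<Sum>i\<in>{n}. ennreal (c i) * indicator (A i) z)" by (subst sum.insert) simp_all
    also have "\<dots> \<le> (\<Sum>i. ennreal (c i) * indicator (A i) z)" by (intro sum_le_suminf summableI) auto
    finally show ?thesis by (simp add: x_def)
  qed
  have "(\<integral>\<^sup>+z. ennreal ((1 - (norm z)\<^sup>2) powr \<beta>) \<partial>dA) \<le> (\<integral>\<^sup>+z. (\<Sum>n. ennreal (c n) * indicator (A n) z) \<partial>dA)"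
    by (intro nn_integral_mono pw) simp
  also have "\<dots> = (\<Sum>n. \<integral>\<^sup>+z. ennreal (c n) * indicator (A n) z \<partial>dA)"
    by (intro nn_integral_suminf measurable_borel_disk_measure) measurable
  also have "\<dots> = (\<Sum>n. ennreal (c n * (V * (1/2) ^ n)))"
  proof (rule suminf_cong)
    fix n
    have "(\<integral>\<^sup>+z. ennreal (c n) * indicator (A n) z \<partial>dA) = (\<integral>\<^sup>+z. ennreal (c n) * indicator (A n \<inter> disk) z \<partial>lborel)"
      unfolding nn_integral_disk_measure by (intro nn_integral_cong) (simp add: indicator_def)
    also have "\<dots> = ennreal (c n) * ennreal (V * (1/2) ^ n)"
      by (simp add: nn_integral_cmult_indicator emA)
    also have "\<dots> = ennreal (c n * (V * (1/2) ^ n))" by (simp add: ennreal_mult c_def V_def)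
    finally show "(\<integral>\<^sup>+z. ennreal (c n) * indicator (A n) z \<partial>dA) = ennreal (c n * (V * (1/2) ^ n))" .
  qed
  also have "\<dots> < \<infinity>"
  proof -
    define r where "r = 2 powr (- \<beta> - 1)"
    have r: "0 \<le> r" "r < 1" using \<beta> by (auto simp: r_def powr_less_one)
    have half: "(1/2::real) ^ n = 2 powr (- real n)" for n
      by (simp add: powr_minus_divide powr_realpow power_one_over)
    have c_eq: "c n * (V * (1/2) ^ n) = (V * 2 powr (- \<beta>)) * r ^ n" for n
    proof -
      have "r ^ n = 2 powr ((- \<beta> - 1) * real n)" by (simp add: r_def powr_powr flip: powr_realpow)
      then have "(V * 2 powr (- \<beta>)) * r ^ n = V * 2 powr (- \<beta> + (- \<beta> - 1) * real n)"
        by (simp only: powr_add mult.assoc)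
      also have "- \<beta> + (- \<beta> - 1) * real n = - \<beta> * real (n + 1) + - real n" by (simp add: algebra_simps)
      also have "V * 2 powr (- \<beta> * real (n + 1) + - real n) = c n * (V * (1/2) ^ n)"
        by (simp only: powr_add half c_def mult_ac)
      finally show ?thesis by (rule sym)
    qed
    have "summable (\<lambda>n. c n * (V * (1/2) ^ n))"
      unfolding c_eq using r by (intro summable_mult summable_geometric) auto
    then have "(\<Sum>n. ennreal (c n * (V * (1/2) ^ n))) \<noteq> top"
      by (intro ennreal_suminf_neq_top) (auto simp: c_def V_def)
    then show ?thesis by (simp add: less_top)
  qed
  finally show ?thesis .
qed

text \<open>If the weighted sum is \<open>t\<close>, each \<open>x n\<close> is at most
  \<open>(1/2) ^ Suc n\<close> times \<open>t powr (1 / p)\<close>, and these bounds sum to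
  \<open>t powr (1 / p)\<close>. This plays the part of Hoelder's inequality for a series; the
  growing weights are paid for later by fast decay of bump energies.\<close>

lemma powr_suminf_le:
  fixes x :: "nat \<Rightarrow> real"
  assumes x: "\<And>n. 0 \<le> x n" "summable x" and p: "0 < p"
  shows "ennreal (suminf x powr p) \<le> (\<Sum>n. ennreal (2 powr (real (n + 1) * p)) * ennreal (x n powr p))"
    (is "_ \<le> ?T")
proof (cases "?T = \<infinity>")
  case False
  then obtain t where t: "?T = ennreal t" "0 \<le> t" by (cases ?T) auto
  have "x n \<le> (1/2) ^ Suc n * t powr (1 / p)" for n
  proof -
    define y where "y = 2 powr real (n + 1) * x n"
    have y: "0 \<le> y" using x by (simp add: y_def)
    have yp: "2 powr (real (n + 1) * p) * x n powr p = y powr p"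
      using x by (simp add: y_def powr_mult powr_powr)
    have "ennreal (y powr p) = (\<Sum>i\<in>{n}. ennreal (2 powr (real (i + 1) * p)) * ennreal (x i powr p))"
      by (simp only: yp[symmetric] sum.insert sum.empty) (simp add: ennreal_mult)
    also have "\<dots> \<le> ennreal t"
      unfolding t(1)[symmetric] by (intro sum_le_suminf summableI) auto
    finally have "y powr p \<le> t" using t by simp
    then have "(y powr p) powr (1 / p) \<le> t powr (1 / p)" using p by (intro powr_mono2) auto
    then have "y \<le> t powr (1 / p)" using y p by (simp add: powr_powr)
    moreover have "2 powr real (n + 1) = 2 ^ Suc n" by (subst powr_realpow) auto
    ultimately show ?thesis by (simp add: y_def power_one_over field_simps)
  qed
  moreover have "(\<lambda>n. (1/2) ^ Suc n * t powr (1 / p)) sums (1 * t powr (1 / p))"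
    by (intro sums_mult2 power_half_series)
  ultimately have "suminf x \<le> t powr (1 / p)"
    using x(2) by (metis (no_types, lifting) mult_1 sums_iff suminf_le)
  then have "suminf x powr p \<le> (t powr (1 / p)) powr p"
    using p suminf_nonneg[OF x(2,1)] by (intro powr_mono2) auto
  then have "suminf x powr p \<le> t" using t p by (simp add: powr_powr)
  then show ?thesis unfolding t(1) by (rule ennreal_leI)
qed simp

section \<open>Bump functions and their energies\<close>

context admissible_params
begin

text \<open>The function \<open>(1 - (norm a)\<^sup>2)\<close> divided by the power
  \<open>2 + \<alpha>\<close> of \<open>1 - cnj a * z\<close>, with the principal branch, as the
  base has positive real part. It is used as a derivative and is normalised to have Bloch density 1
  at \<open>a\<close>.\<close>

definition bump :: "complex \<Rightarrow> complex \<Rightarrow> complex" where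
  "bump a z = of_real (1 - (norm a)\<^sup>2) * exp (- of_real (2 + \<alpha>) * Ln (1 - cnj a * z))"

lemma norm_bump:
  assumes "a \<in> disk" "z \<in> disk"
  shows "norm (bump a z) = (1 - (norm a)\<^sup>2) * norm (1 - cnj a * z) powr (- (2 + \<alpha>))"
proof -
  have "norm (of_real (1 - (norm a)\<^sup>2) :: complex) = 1 - (norm a)\<^sup>2"
    using one_minus_norm_sq_pos[OF assms(1)] by (subst norm_of_real) simp
  moreover have "Re (- of_real (2 + \<alpha>) * Ln (1 - cnj a * z)) = - (2 + \<alpha>) * ln (norm (1 - cnj a * z))"
    using one_minus_cnj_mult_nz[OF assms] by (simp add: algebra_simps del: of_real_add)
  ultimately show ?thesis
    using one_minus_cnj_mult_nz[OF assms] unfolding bump_def by (simp only: norm_mult norm_exp_eq_Re) (simp add: powr_def)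
qed

lemma bump_holomorphic:
  assumes a: "a \<in> disk"
  shows "bump a holomorphic_on disk"
proof -
  have "1 - cnj a * z \<notin> \<real>\<^sub>\<le>\<^sub>0" if z: "z \<in> disk" for z
  proof -
    have "norm a * norm z \<le> norm z" using a by (intro mult_left_le_one_le) auto
    then have "norm (cnj a * z) < 1" using z by (simp add: norm_mult)
    then have "Re (cnj a * z) < 1" using complex_Re_le_cmod[of "cnj a * z"] by linarith
    then show ?thesis by (simp add: complex_nonpos_Reals_iff)
  qed
  then show ?thesis unfolding bump_def[abs_def] by (intro holomorphic_intros) auto
qed

lemma norm_bump_self:
  assumes a: "a \<in> disk"
  shows "norm (bump a a) * (1 - (norm a)\<^sup>2) powr (1 + \<alpha>) = 1"
proof -
  define y where "y = 1 - (norm a)\<^sup>2"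
  have y: "0 < y" using one_minus_norm_sq_pos[OF a] by (simp add: y_def)
  have "1 - cnj a * a = of_real y"
    unfolding y_def of_real_diff of_real_1 complex_norm_square by (simp add: mult.commute)
  then have "norm (1 - cnj a * a) = y" using y by simp
  then have "norm (bump a a) * y powr (1 + \<alpha>) = y powr 1 * y powr (- (2 + \<alpha>)) * y powr (1 + \<alpha>)"
    using norm_bump[OF a a] y by (simp add: y_def)
  also have "\<dots> = y powr (1 + - (2 + \<alpha>) + (1 + \<alpha>))" by (simp only: powr_add)
  also have "\<dots> = 1" using y by simp
  finally show ?thesis by (simp add: y_def)
qed

lemma one_minus_norm_sq_le:
  assumes "a \<in> disk" "z \<in> disk"
  shows "1 - (norm z)\<^sup>2 \<le> 2 * norm (1 - cnj a * z)" "1 - (norm a)\<^sup>2 \<le> 2 * norm (1 - cnj a * z)"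
proof -
  have le: "1 - x\<^sup>2 \<le> 2 * (1 - x)" for x :: real
  proof -
    have "2 * (1 - x) - (1 - x\<^sup>2) = (1 - x)\<^sup>2" by (simp add: power2_eq_square algebra_simps)
    then show ?thesis using zero_le_power2[of "1 - x"] by linarith
  qed
  show "1 - (norm z)\<^sup>2 \<le> 2 * norm (1 - cnj a * z)" "1 - (norm a)\<^sup>2 \<le> 2 * norm (1 - cnj a * z)"
    using le[of "norm z"] le[of "norm a"] norm_one_minus_cnj_mult[of a z] assms by auto
qed

text \<open>The exponent 2 in the denominator produces the Moebius invariant factor. The remaining
  factor \<open>(y / w) powr \<alpha>\<close> is bounded by \<open>2 powr \<alpha>\<close>, so the
  Bloch density of a bump decays with the pseudohyperbolic distance from \<open>a\<close>.\<close>

lemma bump_le: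
  assumes a: "a \<in> disk" and z: "z \<in> disk"
  shows "norm (bump a z) * (1 - (norm z)\<^sup>2) powr (1 + \<alpha>) \<le> 2 powr \<alpha> * (1 - (norm (disk_aut a z))\<^sup>2)"
proof -
  define y where "y = 1 - (norm z)\<^sup>2"
  define w where "w = norm (1 - cnj a * z)"
  have y: "0 < y" using one_minus_norm_sq_pos[OF z] by (simp add: y_def)
  have w: "0 < w" using one_minus_cnj_mult_nz[OF a z] by (simp add: w_def)
  have yw: "y / w \<le> 2" using one_minus_norm_sq_le(1)[OF a z] w by (simp add: y_def w_def divide_le_eq)
  have B: "0 \<le> 1 - (norm a)\<^sup>2" using one_minus_norm_sq_pos[OF a] by simp
  have "y powr (1 + \<alpha>) = y * y powr \<alpha>" using y by (simp add: powr_add)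
  moreover have "w powr (- (2 + \<alpha>)) = w powr (- 2) * w powr (- \<alpha>)" by (simp add: powr_add[symmetric])
  ultimately have "norm (bump a z) * y powr (1 + \<alpha>) = (1 - (norm a)\<^sup>2) * (w powr (- 2) * w powr (- \<alpha>)) * (y * y powr \<alpha>)"
    unfolding norm_bump[OF a z] w_def[symmetric] by (simp only:)
  also have "\<dots> = (y * ((1 - (norm a)\<^sup>2) / w\<^sup>2)) * (y / w) powr \<alpha>"
    using y w by (simp add: powr_minus_divide powr_divide powr_numeral)
  also have "\<dots> \<le> (y * ((1 - (norm a)\<^sup>2) / w\<^sup>2)) * 2 powr \<alpha>"
    using y w B yw params by (intro mult_left_mono powr_mono2) auto
  also have "y * ((1 - (norm a)\<^sup>2) / w\<^sup>2) = 1 - (norm (disk_aut a z))\<^sup>2"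
    by (simp add: one_minus_disk_aut_sq[OF one_minus_cnj_mult_nz[OF a z]] y_def w_def aut_jac_def)
  finally show ?thesis by (simp add: y_def mult.commute)
qed

text \<open>Separates the weight from the function, so that energies of bumps can be estimated with
  the bump itself in the place of a derivative.\<close>

definition weight :: "complex \<Rightarrow> complex \<Rightarrow> real" where
  "weight b z = (1 - (norm b)\<^sup>2) powr (\<alpha> * p) * (1 - (norm z)\<^sup>2) powr s * aut_jac b z powr q"

lemma weight_nonneg [simp]: "0 \<le> weight b z"
  by (simp add: weight_def)

lemma weight_measurable:
  assumes "b \<in> disk"
  shows "weight b \<in> borel_measurable dA"
proof -
  have "density (\<lambda>z. z) b \<in> borel_measurable dA"
    by (intro density_measurable assms holomorphic_intros)
  then have "(\<lambda>z. (1 - (norm b)\<^sup>2) powr (\<alpha> * p) * density (\<lambda>z. z) b z) \<in> borel_measurable dA"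
    by measurable
  then show ?thesis by (simp add: density_def weight_def[abs_def] mult_ac)
qed

lemma scaled_energy_weight:
  assumes "f holomorphic_on disk" "b \<in> disk"
  shows "scaled_energy f b = (\<integral>\<^sup>+z. ennreal (norm (deriv f z) powr p) * ennreal (weight b z) \<partial>dA)"
proof -
  have "(\<lambda>z. ennreal (density f b z)) \<in> borel_measurable dA"
    using density_measurable[OF assms] by simp
  then have "scaled_energy f b = (\<integral>\<^sup>+z. ennreal ((1 - (norm b)\<^sup>2) powr (\<alpha> * p)) * ennreal (density f b z) \<partial>dA)"
    unfolding scaled_energy_def energy_on_def by (subst nn_integral_cmult[symmetric]) auto
  also have "\<dots> = (\<integral>\<^sup>+z. ennreal (norm (deriv f z) powr p) * ennreal (weight b z) \<partial>dA)"
    by (intro nn_integral_cong) (simp add: density_def weight_def mult_ac flip: ennreal_mult)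
  finally show ?thesis .
qed

definition bump_energy :: "complex \<Rightarrow> complex \<Rightarrow> ennreal" where
  "bump_energy a b = (\<integral>\<^sup>+z. ennreal (norm (bump a z) powr p) * ennreal (weight b z) \<partial>dA)"

lemma bump_powr_measurable:
  "a \<in> disk \<Longrightarrow> (\<lambda>z. ennreal (norm (bump a z) powr p)) \<in> borel_measurable dA"
  using bergman_measurable[OF holomorphic_on_imp_continuous_on[OF bump_holomorphic], of a "\<lambda>_. 1" p] by simp

text \<open>The powers of \<open>y\<close> and \<open>J\<close> are distributed so that only
  invariant quantities survive, together with \<open>y powr (- 2)\<close>, the density of the
  invariant area. The one other factor, a power of \<open>J * B\<close>, is bounded because
  \<open>J * B \<le> 4\<close>; the constant is 8 as 2 times 4.\<close>

lemma bump_weight_le: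
  assumes a: "a \<in> disk" and b: "b \<in> disk" and z: "z \<in> disk"
  shows "norm (bump a z) powr p * weight b z \<le> 8 powr (\<alpha> * p) *
     ((1 - (norm (disk_aut a z))\<^sup>2) powr p * (1 - (norm (disk_aut b z))\<^sup>2) powr (q - \<alpha> * p) * (1 - (norm z)\<^sup>2) powr (- 2))"
proof -
  define y where "y = 1 - (norm z)\<^sup>2"
  define B where "B = 1 - (norm b)\<^sup>2"
  define J where "J = aut_jac b z"
  define ta where "ta = 1 - (norm (disk_aut a z))\<^sup>2"
  define tb where "tb = 1 - (norm (disk_aut b z))\<^sup>2"
  define x where "x = norm (bump a z)"
  have pos: "0 < y" "0 < B" "0 < J" "0 < ta" "0 < tb" "0 \<le> x"
    using one_minus_norm_sq_pos aut_jac_pos[OF b z] a b z disk_aut_in_disk by (auto simp: y_def B_def J_def ta_def tb_def x_def)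
  have tb: "tb = y * J"
    using one_minus_disk_aut_sq[OF one_minus_cnj_mult_nz[OF b z]] by (simp add: tb_def y_def J_def)
  have JB: "J * B \<le> 4"
  proof -
    define w where "w = norm (1 - cnj b * z)"
    have w: "0 < w" using one_minus_cnj_mult_nz[OF b z] by (simp add: w_def)
    have "B / w \<le> 2" using one_minus_norm_sq_le(2)[OF b z] w by (simp add: B_def w_def divide_le_eq)
    then have "(B / w)\<^sup>2 \<le> 2\<^sup>2" using pos w by (intro power_mono) auto
    moreover have "(B / w)\<^sup>2 = J * B" by (simp add: J_def aut_jac_def B_def w_def power2_eq_square)
    ultimately show ?thesis by simp
  qed
  have "x * y powr (1 + \<alpha>) \<le> 2 powr \<alpha> * ta"
    using bump_le[OF a z] by (simp add: x_def y_def ta_def)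
  then have "(x * y powr (1 + \<alpha>)) powr p \<le> (2 powr \<alpha> * ta) powr p"
    using pos params by (intro powr_mono2) auto
  then have 1: "x powr p * y powr ((1 + \<alpha>) * p) \<le> 2 powr (\<alpha> * p) * ta powr p"
    using pos by (simp add: powr_mult powr_powr)
  have ys: "y powr s = y powr ((1 + \<alpha>) * p) * y powr (- 2) * y powr (q - \<alpha> * p)"
    by (simp add: powr_add[symmetric] q_def algebra_simps)
  have Jq: "J powr q = J powr (\<alpha> * p) * J powr (q - \<alpha> * p)"
    by (simp add: powr_add[symmetric])
  have "x powr p * weight b z = (x powr p * y powr ((1 + \<alpha>) * p)) * ((J * B) powr (\<alpha> * p)) * (tb powr (q - \<alpha> * p) * y powr (- 2))"
    using pos unfolding weight_def y_def[symmetric] B_def[symmetric] J_def[symmetric] ys Jq tb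
    by (simp add: powr_mult mult_ac)
  also have "\<dots> \<le> (2 powr (\<alpha> * p) * ta powr p) * (4 powr (\<alpha> * p)) * (tb powr (q - \<alpha> * p) * y powr (- 2))"
  proof (rule mult_right_mono, rule mult_mono[OF 1])
    show "(J * B) powr (\<alpha> * p) \<le> 4 powr (\<alpha> * p)"
      using pos JB params by (intro powr_mono2) auto
  qed auto
  also have "\<dots> = (2 powr (\<alpha> * p) * 4 powr (\<alpha> * p)) * (ta powr p * tb powr (q - \<alpha> * p) * y powr (- 2))"
    by (simp only: mult_ac)
  also have "2 powr (\<alpha> * p) * 4 powr (\<alpha> * p) = (8::real) powr (\<alpha> * p)"
    by (simp flip: powr_mult)
  finally show ?thesis by (simp add: x_def ta_def tb_def y_def)
qed

text \<open>By Moebius invariance the energy of a bump depends only on the pseudohyperbolic position of \<open>b\<close>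
  relative to \<open>a\<close>.\<close>

definition kernel :: "complex \<Rightarrow> complex \<Rightarrow> real" where
  "kernel c u = (1 - (norm u)\<^sup>2) powr (p - 2) * ((1 - (norm u)\<^sup>2) * aut_jac c u) powr (q - \<alpha> * p)"

lemma bump_energy_le_kernel:
  assumes a: "a \<in> disk" and b: "b \<in> disk"
  shows "bump_energy a b \<le> ennreal (8 powr (\<alpha> * p)) * (\<integral>\<^sup>+u. ennreal (kernel (disk_aut a b) u) \<partial>dA)"
proof -
  define H where "H z = (1 - (norm (disk_aut a z))\<^sup>2) powr p * (1 - (norm (disk_aut b z))\<^sup>2) powr (q - \<alpha> * p) * (1 - (norm z)\<^sup>2) powr (- 2)" for z
  have H_meas: "(\<lambda>z. ennreal (H z)) \<in> borel_measurable dA"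
  proof -
    have ca: "continuous_on disk (\<lambda>z. 1 - (norm (disk_aut c z))\<^sup>2)" if "c \<in> disk" for c
      by (intro continuous_intros holomorphic_on_imp_continuous_on disk_aut_holomorphic that)
    have "continuous_on disk H"
      unfolding H_def[abs_def]
    proof (intro continuous_on_mult)
      show "continuous_on disk (\<lambda>z. (1 - (norm (disk_aut a z))\<^sup>2) powr p)"
        using one_minus_norm_sq_pos[OF disk_aut_in_disk[OF a]]
        by (intro continuous_on_powr ca a continuous_intros) (force simp: less_le)
      show "continuous_on disk (\<lambda>z. (1 - (norm (disk_aut b z))\<^sup>2) powr (q - \<alpha> * p))"
        using one_minus_norm_sq_pos[OF disk_aut_in_disk[OF b]]
        by (intro continuous_on_powr ca b continuous_intros) (force simp: less_le)
      show "continuous_on disk (\<lambda>z. (1 - (norm z)\<^sup>2) powr (- 2))"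
        using one_minus_norm_sq_pos
        by (intro continuous_on_powr continuous_intros) (force simp: less_le)
    qed
    from measurable_disk_measureI[OF this] show ?thesis by measurable
  qed
  have "bump_energy a b \<le> (\<integral>\<^sup>+z. ennreal (8 powr (\<alpha> * p)) * ennreal (H z) \<partial>dA)"
    unfolding bump_energy_def
  proof (rule nn_integral_mono)
    fix z assume "z \<in> space dA"
    then have "norm (bump a z) powr p * weight b z \<le> 8 powr (\<alpha> * p) * H z"
      unfolding H_def by (intro bump_weight_le a b) simp
    then show "ennreal (norm (bump a z) powr p) * ennreal (weight b z) \<le> ennreal (8 powr (\<alpha> * p)) * ennreal (H z)"
      by (simp add: ennreal_leI H_def flip: ennreal_mult)
  qed
  also have "\<dots> = ennreal (8 powr (\<alpha> * p)) * (\<integral>\<^sup>+z. ennreal (H z) \<partial>dA)"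
    by (rule nn_integral_cmult[OF H_meas])
  also have "(\<integral>\<^sup>+z. ennreal (H z) \<partial>dA) = (\<integral>\<^sup>+z. ennreal (H z) * indicator (disk_aut a ` disk) z \<partial>dA)"
    by (intro nn_integral_cong) (simp add: disk_aut_image[OF a])
  also have "\<dots> = (\<integral>\<^sup>+u. ennreal (H (disk_aut a u)) * ennreal ((norm (deriv (disk_aut a) u))\<^sup>2) \<partial>dA)"
    by (rule nn_integral_disk_selfmap[symmetric])
       (use a disk_aut_holomorphic inj_on_disk_aut disk_aut_image H_meas in auto)
  also have "\<dots> \<le> (\<integral>\<^sup>+u. ennreal (kernel (disk_aut a b) u) \<partial>dA)"
  proof (rule nn_integral_mono)
    fix u assume "u \<in> space dA"
    then have u: "u \<in> disk" by simp
    note z = disk_aut_in_disk[OF a u] and c = disk_aut_in_disk[OF a b]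
    define y where "y = 1 - (norm u)\<^sup>2"
    define J where "J = aut_jac a u"
    have pos: "0 < y" "0 < J" using one_minus_norm_sq_pos[OF u] aut_jac_pos[OF a u] by (auto simp: y_def J_def)
    have yz: "1 - (norm (disk_aut a u))\<^sup>2 = y * J"
      using one_minus_disk_aut_sq[OF one_minus_cnj_mult_nz[OF a u]] by (simp add: y_def J_def)
    have "1 - (norm (disk_aut b (disk_aut a u)))\<^sup>2 = (1 - (norm (disk_aut a u))\<^sup>2) * aut_jac b (disk_aut a u)"
      by (rule one_minus_disk_aut_sq[OF one_minus_cnj_mult_nz[OF b z]])
    also have "\<dots> \<le> y * aut_jac (disk_aut a b) u"
      using disk_selfmap.schwarz_pick_jac[OF disk_aut_selfmap[OF a] b z]
      by (simp add: disk_aut_involution[OF a u] y_def)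
    finally have tb: "1 - (norm (disk_aut b (disk_aut a u)))\<^sup>2 \<le> y * aut_jac (disk_aut a b) u" .
    have "H (disk_aut a u) * J\<^sup>2 = y powr p * (1 - (norm (disk_aut b (disk_aut a u)))\<^sup>2) powr (q - \<alpha> * p) * ((y * J) powr (- 2) * J\<^sup>2)"
      by (simp add: H_def disk_aut_involution[OF a u] yz) (simp add: y_def)
    \<comment> \<open>Invariance of the hyperbolic area: the Jacobian of the substitution
      cancels.\<close>
    also have "(y * J) powr (- 2) * J\<^sup>2 = y powr (- 2)"
      using pos by (simp add: powr_minus_divide powr_numeral power_mult_distrib)
    also have "y powr p * (1 - (norm (disk_aut b (disk_aut a u)))\<^sup>2) powr (q - \<alpha> * p) * y powr (- 2) \<le>
        y powr p * (y * aut_jac (disk_aut a b) u) powr (q - \<alpha> * p) * y powr (- 2)"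
      using one_minus_norm_sq_pos[OF disk_aut_in_disk[OF b z]] tb params
      by (intro mult_right_mono mult_left_mono powr_mono2) auto
    also have "\<dots> = kernel (disk_aut a b) u"
      using pos by (simp add: kernel_def y_def[symmetric] powr_diff powr_minus_divide powr_numeral)
    finally show "ennreal (H (disk_aut a u)) * ennreal ((norm (deriv (disk_aut a) u))\<^sup>2) \<le> ennreal (kernel (disk_aut a b) u)"
      by (simp add: norm_deriv_disk_aut[OF a u] J_def H_def ennreal_leI flip: ennreal_mult)
  qed
  finally show ?thesis by (simp add: mult_left_mono)
qed

definition kernel_mass :: ennreal where
  "kernel_mass = (\<integral>\<^sup>+u. ennreal ((1 - (norm u)\<^sup>2) powr (p - 2)) \<partial>dA)"

text \<open>The exponent \<open>p - 2\<close> exceeds -1 because \<open>1 < p\<close>.\<close>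

lemma kernel_mass_finite: "kernel_mass < \<infinity>"
  unfolding kernel_mass_def using params by (intro nn_integral_disk_powr_finite) auto

lemma kernel_le:
  assumes "c \<in> disk" "u \<in> disk"
  shows "kernel c u \<le> (1 - (norm u)\<^sup>2) powr (p - 2)"
proof -
  have "(1 - (norm u)\<^sup>2) * aut_jac c u \<le> 1"
    using one_minus_disk_aut_sq[OF one_minus_cnj_mult_nz[OF assms]] zero_le_power2[of "norm (disk_aut c u)"] by linarith
  then have "((1 - (norm u)\<^sup>2) * aut_jac c u) powr (q - \<alpha> * p) \<le> 1"
    using one_minus_norm_sq_pos[OF assms(2)] aut_jac_pos[OF assms] params by (intro powr_le1) auto
  then show ?thesis unfolding kernel_def by (simp add: mult_left_le)
qed

lemma bump_energy_bounded:
  obtains K where "0 \<le> K" "\<And>a b. a \<in> disk \<Longrightarrow> b \<in> disk \<Longrightarrow> bump_energy a b \<le> ennreal K"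
proof -
  define K where "K = enn2real (ennreal (8 powr (\<alpha> * p)) * kernel_mass)"
  show ?thesis
  proof (rule that[of K])
    fix a b assume ab: "a \<in> disk" "b \<in> disk"
    have "bump_energy a b \<le> ennreal (8 powr (\<alpha> * p)) * (\<integral>\<^sup>+u. ennreal (kernel (disk_aut a b) u) \<partial>dA)"
      by (rule bump_energy_le_kernel[OF ab])
    also have "\<dots> \<le> ennreal (8 powr (\<alpha> * p)) * kernel_mass"
      unfolding kernel_mass_def
      by (intro mult_left_mono nn_integral_mono ennreal_leI kernel_le disk_aut_in_disk ab) auto
    also have "\<dots> = ennreal K"
      unfolding K_def using kernel_mass_finite by (simp add: ennreal_mult_less_top)
    finally show "bump_energy a b \<le> ennreal K" .
  qed (simp add: K_def)
qed

text \<open>As \<open>disk_aut a b\<close> approaches the circle, the kernel tends to 0 uniformly on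
  compact sets of \<open>u\<close>, thanks to the positive exponent \<open>q - \<alpha> * p\<close>;
  near the circle it is dominated by an integrable function that does not depend on \<open>a\<close>
  and \<open>b\<close>.\<close>

lemma bump_energy_small:
  assumes e: "0 < e"
  obtains r where "r < 1" "\<And>a b. a \<in> disk \<Longrightarrow> b \<in> disk \<Longrightarrow> r \<le> norm (disk_aut a b) \<Longrightarrow> bump_energy a b \<le> ennreal e"
proof -
  define C where "C = 8 powr (\<alpha> * p)"
  have C: "0 < C" by (simp add: C_def)
  define \<delta> where "\<delta> = q - \<alpha> * p"
  have \<delta>: "0 < \<delta>" using params by (simp add: \<delta>_def)
  define e1 where "e1 = e / (2 * C)"
  have e1: "0 < e1" using e C by (simp add: e1_def)
  define F where "F u = ennreal ((1 - (norm u)\<^sup>2) powr (p - 2))" for u :: complex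
  have F_meas: "F \<in> borel_measurable dA"
    unfolding F_def[abs_def] by (rule measurable_borel_disk_measure) measurable
  define G where "G n = {z::complex. exhaust_radius n < norm z}" for n
  have G: "G n \<in> sets borel" for n unfolding G_def by measurable
  have ev: "eventually (\<lambda>n. z \<notin> G n) sequentially" if "z \<in> disk" for z
  proof -
    have "eventually (\<lambda>n. norm z < exhaust_radius n) sequentially"
      using that by (intro eventually_exhaust_radius) auto
    then show ?thesis by eventually_elim (simp add: G_def)
  qed
  obtain n where n: "(\<integral>\<^sup>+z\<in>G n. F z \<partial>dA) \<le> ennreal e1"
    using nn_integral_vanishing_sets[of F G e1] F_meas kernel_mass_finite G ev e1
    unfolding kernel_mass_def F_def[symmetric] by blast
  define R where "R = exhaust_radius n"
  have R: "0 < R" "R < 1" using exhaust_radius by (auto simp: R_def)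
  obtain d where d: "0 < d" "ennreal d * kernel_mass \<le> ennreal e1"
    using ennreal_le_fraction[OF kernel_mass_finite zero_less_one e1] by auto
  \<comment> \<open>Solves \<open>(h / (1 - R)\<^sup>2) powr \<delta> = d\<close>; the radius
    \<open>r\<close> then enforces \<open>1 - (norm c)\<^sup>2 \<le> h\<close>.\<close>
  define h where "h = d powr (1 / \<delta>) * (1 - R)\<^sup>2"
  have h: "0 < h" using d R by (simp add: h_def)
  define r where "r = sqrt (max 0 (1 - h))"
  have r: "r < 1" "0 \<le> r" using h by (auto simp: r_def)
  show ?thesis
  proof (rule that[OF r(1)])
    fix a b assume ab: "a \<in> disk" "b \<in> disk" "r \<le> norm (disk_aut a b)"
    define c where "c = disk_aut a b"
    have c: "c \<in> disk" using disk_aut_in_disk[OF ab(1,2)] by (simp add: c_def)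
    have ch: "1 - (norm c)\<^sup>2 \<le> h"
    proof -
      have "r\<^sup>2 \<le> (norm c)\<^sup>2" using ab(3) r by (intro power_mono) (auto simp: c_def)
      then show ?thesis by (simp add: r_def split: if_splits)
    qed
    have "(\<integral>\<^sup>+u. ennreal (kernel c u) \<partial>dA) \<le> (\<integral>\<^sup>+u. (F u * indicator (G n) u + ennreal d * F u) \<partial>dA)"
    proof (rule nn_integral_mono)
      fix u assume "u \<in> space dA"
      then have u: "u \<in> disk" by simp
      show "ennreal (kernel c u) \<le> F u * indicator (G n) u + ennreal d * F u"
      proof (cases "u \<in> G n")
        case True
        have "ennreal (kernel c u) \<le> F u" unfolding F_def by (intro ennreal_leI kernel_le c u)
        then show ?thesis using True by (simp add: add_increasing2)
      next
        case False
        then have uR: "norm u \<le> R" by (simp add: G_def R_def)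
        have y: "0 < 1 - (norm u)\<^sup>2" "1 - (norm u)\<^sup>2 \<le> 1" using one_minus_norm_sq_pos[OF u] by auto
        have "(1 - (norm u)\<^sup>2) * aut_jac c u \<le> aut_jac c u"
          using y aut_jac_pos[OF c u] by (intro mult_left_le_one_le) auto
        also have "\<dots> \<le> (1 - (norm c)\<^sup>2) / (1 - norm u)\<^sup>2" by (rule aut_jac_le(1)[OF c u])
        also have "\<dots> \<le> h / (1 - R)\<^sup>2" using ch h R uR by (intro frac_le power_mono) auto
        also have "\<dots> = d powr (1 / \<delta>)" using R by (simp add: h_def)
        finally have "((1 - (norm u)\<^sup>2) * aut_jac c u) powr \<delta> \<le> (d powr (1 / \<delta>)) powr \<delta>"
          using y aut_jac_pos[OF c u] \<delta> by (intro powr_mono2) auto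
        also have "\<dots> = d" using d \<delta> by (simp add: powr_powr)
        finally have "kernel c u \<le> (1 - (norm u)\<^sup>2) powr (p - 2) * d"
          unfolding kernel_def \<delta>_def by (intro mult_left_mono) auto
        then have "ennreal (kernel c u) \<le> ennreal d * F u"
          using d by (simp add: F_def ennreal_leI mult.commute flip: ennreal_mult)
        then show ?thesis using False by simp
      qed
    qed
    also have "\<dots> = (\<integral>\<^sup>+u. F u * indicator (G n) u \<partial>dA) + ennreal d * kernel_mass"
    proof -
      have "(\<lambda>u. F u * indicator (G n) u) \<in> borel_measurable dA"
        using F_meas indicator_disk_measurable[OF G] by measurable
      then show ?thesis using F_meas by (simp add: nn_integral_add nn_integral_cmult kernel_mass_def F_def[symmetric])
    qed
    also have "\<dots> \<le> ennreal e1 + ennreal e1" by (intro add_mono n d)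
    finally have 1: "(\<integral>\<^sup>+u. ennreal (kernel c u) \<partial>dA) \<le> ennreal e1 + ennreal e1" .
    have "bump_energy a b \<le> ennreal C * (\<integral>\<^sup>+u. ennreal (kernel c u) \<partial>dA)"
      unfolding C_def c_def by (rule bump_energy_le_kernel[OF ab(1,2)])
    also have "\<dots> \<le> ennreal C * (ennreal e1 + ennreal e1)" by (intro mult_left_mono 1) auto
    also have "\<dots> = ennreal (C * (e1 + e1))"
      using C e1 by (simp only: ennreal_mult ennreal_plus less_imp_le add_nonneg_nonneg)
    also have "C * (e1 + e1) = e" using C by (simp add: e1_def)
    finally show "bump_energy a b \<le> ennreal e" .
  qed
qed

text \<open>Sums of bumps with disjoint pseudohyperbolic neighbourhoods stay in the space: near any \<open>b\<close> at most one
  bump is large.\<close>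

lemma bump_series_M_space:
  assumes f: "f holomorphic_on disk" "\<And>z. z \<in> disk \<Longrightarrow> deriv f z = (\<Sum>n. bump (a n) z)"
    and summ: "\<And>z. z \<in> disk \<Longrightarrow> summable (\<lambda>n. norm (bump (a n) z))"
    and a: "\<And>n. a n \<in> disk"
    and sep: "\<And>b. b \<in> disk \<Longrightarrow> \<exists>m. \<forall>n. n \<noteq> m \<longrightarrow> bump_energy (a n) b \<le> ennreal (2 powr (- (real (n + 1) * (p + 1))))"
  shows "f \<in> M_space \<alpha> p s"
proof -
  obtain K where K: "0 \<le> K" "\<And>a b. a \<in> disk \<Longrightarrow> b \<in> disk \<Longrightarrow> bump_energy a b \<le> ennreal K"
    using bump_energy_bounded by blast
  define c where "c n = 2 powr (real (n + 1) * p)" for n :: nat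
  show ?thesis
  proof (rule M_spaceI[OF f(1)])
    fix b assume b: "b \<in> disk"
    obtain m where m: "\<And>n. n \<noteq> m \<Longrightarrow> bump_energy (a n) b \<le> ennreal (2 powr (- (real (n + 1) * (p + 1))))"
      using sep[OF b] by blast
    \<comment> \<open>The exceptional bump, which is merely bounded in energy, is taken out of the
      series and treated separately.\<close>
    define x where "x n z = (if n = m then 0 else norm (bump (a n) z))" for n z
    define w where "w z = ennreal (weight b z)" for z
    have w_meas: "w \<in> borel_measurable dA"
      unfolding w_def using weight_measurable[OF b] by measurable
    have pw: "ennreal (norm (deriv f z) powr p) * w z \<le>
      ennreal (2 powr p) * (ennreal (norm (bump (a m) z) powr p) * w z + (\<Sum>n. ennreal (c n) * (ennreal (x n z powr p) * w z)))"
      if z: "z \<in> disk" for z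
    proof -
      define u where "u = norm (bump (a m) z)"
      have "(\<lambda>n. if n = m then u else 0) sums u" by (rule sums_single)
      moreover have xs: "summable (\<lambda>n. x n z)"
        by (rule summable_comparison_test'[OF summ[OF z], of 0]) (simp add: x_def)
      ultimately have "(\<lambda>n. (if n = m then u else 0) + x n z) sums (u + (\<Sum>n. x n z))"
        by (intro sums_add summable_sums)
      moreover have "(\<lambda>n. (if n = m then u else 0) + x n z) = (\<lambda>n. norm (bump (a n) z))"
        by (auto simp: x_def u_def)
      ultimately have "(\<Sum>n. norm (bump (a n) z)) = u + (\<Sum>n. x n z)" by (simp add: sums_iff)
      then have le: "norm (deriv f z) \<le> u + (\<Sum>n. x n z)"
        using summable_norm[OF summ[OF z]] f(2)[OF z] by simp
      define v where "v = (\<Sum>n. x n z)"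
      have uv: "0 \<le> u" "0 \<le> v" unfolding u_def v_def using xs by (auto intro!: suminf_nonneg simp: x_def)
      have "norm (deriv f z) powr p \<le> (2 * max u v) powr p"
        using le params by (intro powr_mono2) (auto simp: v_def)
      also have "\<dots> = 2 powr p * max u v powr p" using uv by (simp add: powr_mult)
      also have "\<dots> \<le> 2 powr p * (u powr p + v powr p)"
        by (intro mult_left_mono) (auto simp: max_def)
      finally have "ennreal (norm (deriv f z) powr p) \<le> ennreal (2 powr p) * (ennreal (u powr p) + ennreal (v powr p))"
        by (simp add: ennreal_leI flip: ennreal_mult ennreal_plus)
      also have "\<dots> \<le> ennreal (2 powr p) * (ennreal (u powr p) + (\<Sum>n. ennreal (c n) * ennreal (x n z powr p)))"
        unfolding v_def c_def using xs params by (intro mult_left_mono add_mono powr_suminf_le) (auto simp: x_def)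
      finally have "ennreal (norm (deriv f z) powr p) * w z \<le>
        (ennreal (2 powr p) * (ennreal (u powr p) + (\<Sum>n. ennreal (c n) * ennreal (x n z powr p)))) * w z"
        by (intro mult_right_mono) auto
      also have "\<dots> = ennreal (2 powr p) * (ennreal (u powr p) * w z + (\<Sum>n. ennreal (c n) * ennreal (x n z powr p)) * w z)"
        by (simp only: distrib_right mult.assoc)
      also have "(\<Sum>n. ennreal (c n) * ennreal (x n z powr p)) * w z = (\<Sum>n. ennreal (c n) * (ennreal (x n z powr p) * w z))"
        by (simp add: ennreal_suminf_multc[symmetric] mult.assoc)
      finally show ?thesis by (simp add: u_def)
    qed
    have bm: "(\<lambda>z. ennreal (norm (bump (a n) z) powr p) * w z) \<in> borel_measurable dA" for n
      using bump_powr_measurable[OF a] w_meas by measurable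
    have xm: "(\<lambda>z. ennreal (x n z powr p) * w z) \<in> borel_measurable dA" for n
      using bm[of n] params by (cases "n = m") (auto simp: x_def)
    have xe: "ennreal (c n) * (\<integral>\<^sup>+z. ennreal (x n z powr p) * w z \<partial>dA) \<le> ennreal ((1/2) ^ Suc n)" for n
    proof (cases "n = m")
      case True
      then show ?thesis using params by (simp add: x_def)
    next
      case False
      then have "(\<integral>\<^sup>+z. ennreal (x n z powr p) * w z \<partial>dA) = bump_energy (a n) b"
        by (simp add: x_def bump_energy_def w_def)
      also have "\<dots> \<le> ennreal (2 powr (- (real (n + 1) * (p + 1))))" by (rule m[OF False])
      finally have "ennreal (c n) * (\<integral>\<^sup>+z. ennreal (x n z powr p) * w z \<partial>dA) \<le>
        ennreal (c n) * ennreal (2 powr (- (real (n + 1) * (p + 1))))" by (intro mult_left_mono) auto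
      \<comment> \<open>The exponent \<open>p + 1\<close> in the separation hypothesis beats the
        weight \<open>c n\<close> by exactly one factor \<open>2 powr (n + 1)\<close>, leaving a
        geometric series of sum 1.\<close>
      also have "\<dots> = ennreal (2 powr (real (n + 1) * p + - (real (n + 1) * (p + 1))))"
        by (simp only: c_def powr_add ennreal_mult powr_ge_zero)
      also have "real (n + 1) * p + - (real (n + 1) * (p + 1)) = - real (Suc n)" by (simp add: algebra_simps)
      also have "2 powr (- real (Suc n)) = (1/2) ^ Suc n"
        by (simp only: powr_minus_divide powr_realpow zero_less_numeral power_one_over)
      finally show ?thesis .
    qed
    have "scaled_energy f b = (\<integral>\<^sup>+z. ennreal (norm (deriv f z) powr p) * w z \<partial>dA)"
      unfolding w_def by (rule scaled_energy_weight[OF f(1) b])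
    also have "\<dots> \<le> (\<integral>\<^sup>+z. ennreal (2 powr p) * (ennreal (norm (bump (a m) z) powr p) * w z + (\<Sum>n. ennreal (c n) * (ennreal (x n z powr p) * w z))) \<partial>dA)"
      by (intro nn_integral_mono pw) simp
    also have "\<dots> = ennreal (2 powr p) * ((\<integral>\<^sup>+z. ennreal (norm (bump (a m) z) powr p) * w z \<partial>dA) +
        (\<integral>\<^sup>+z. (\<Sum>n. ennreal (c n) * (ennreal (x n z powr p) * w z)) \<partial>dA))"
    proof -
      have "(\<lambda>z. \<Sum>n. ennreal (c n) * (ennreal (x n z powr p) * w z)) \<in> borel_measurable dA"
        using xm by measurable
      then show ?thesis using bm by (simp add: nn_integral_cmult nn_integral_add)
    qed
    also have "(\<integral>\<^sup>+z. (\<Sum>n. ennreal (c n) * (ennreal (x n z powr p) * w z)) \<partial>dA) =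
       (\<Sum>n. ennreal (c n) * (\<integral>\<^sup>+z. ennreal (x n z powr p) * w z \<partial>dA))"
      using xm by (simp add: nn_integral_suminf nn_integral_cmult)
    also have "\<dots> \<le> (\<Sum>n. ennreal ((1/2) ^ Suc n))"
      by (intro suminf_le summableI xe)
    also have "\<dots> = ennreal 1"
      by (intro suminf_ennreal_eq power_half_series) auto
    also have "(\<integral>\<^sup>+z. ennreal (norm (bump (a m) z) powr p) * w z \<partial>dA) \<le> ennreal K"
      using K(2)[OF a b] by (simp add: bump_energy_def w_def)
    finally have "scaled_energy f b \<le> ennreal (2 powr p) * (ennreal K + ennreal 1)"
      by (simp add: mult_left_mono add_mono)
    then show "scaled_energy f b \<le> ennreal (2 powr p * (K + 1))"
      using K by (simp add: ennreal_mult)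
  qed
qed

end

section \<open>Properness\<close>

text \<open>For \<open>norm b < R\<close> the kernel \<open>aut_jac a b\<close> is at most a
  constant times \<open>1 - (norm a)\<^sup>2\<close>, so for \<open>a\<close> close to the circle
  such a \<open>b\<close> has pseudohyperbolic distance from \<open>a\<close> at least
  \<open>r\<close>.\<close>

lemma pseudo_ball_far:
  assumes r: "r < 1" and R: "R < 1"
  obtains \<eta> where "0 < \<eta>" "\<And>a b. a \<in> disk \<Longrightarrow> b \<in> disk \<Longrightarrow> 1 - (norm a)\<^sup>2 < \<eta> \<Longrightarrow> norm (disk_aut a b) < r \<Longrightarrow> R \<le> norm b"
proof -
  define \<eta> where "\<eta> = (1 - (max r 0)\<^sup>2) * (1 - max R 0)\<^sup>2"
  have "0 < \<eta>" using r R by (auto simp: \<eta>_def max_def power_less_one_iff abs_square_less_1)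
  then show ?thesis
  proof (rule that)
    fix a b assume ab: "a \<in> disk" "b \<in> disk" and lt: "1 - (norm a)\<^sup>2 < \<eta>" "norm (disk_aut a b) < r"
    show "R \<le> norm b"
    proof (rule ccontr)
      assume "\<not> R \<le> norm b"
      have y: "0 < 1 - (norm b)\<^sup>2" "1 - (norm b)\<^sup>2 \<le> 1" using one_minus_norm_sq_pos[OF ab(2)] by auto
      have "(norm (disk_aut a b))\<^sup>2 < (max r 0)\<^sup>2" using lt(2) by (intro power_strict_mono) auto
      then have "1 - (max r 0)\<^sup>2 < (1 - (norm b)\<^sup>2) * aut_jac a b"
        using one_minus_disk_aut_sq[OF one_minus_cnj_mult_nz[OF ab]] by simp
      also have "\<dots> \<le> aut_jac a b" using y aut_jac_pos[OF ab] by (intro mult_left_le_one_le) auto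
      also have "\<dots> \<le> (1 - (norm a)\<^sup>2) / (1 - norm b)\<^sup>2" by (rule aut_jac_le(1)[OF ab])
      also have "\<dots> \<le> (1 - (norm a)\<^sup>2) / (1 - max R 0)\<^sup>2"
      proof -
        have "norm b \<le> max R 0" "max R 0 < 1" using \<open>\<not> R \<le> norm b\<close> R by auto
        then show ?thesis using one_minus_norm_sq_pos[OF ab(1)] ab(2)
          by (intro divide_left_mono power_mono mult_pos_pos zero_less_power) auto
      qed
      also have "\<dots> < 1 - (max r 0)\<^sup>2"
        using lt(1) R by (simp add: \<eta>_def divide_less_eq max_def)
      finally show False .
    qed
  qed
qed

text \<open>The counterpart with \<open>a\<close> fixed: by \<open>aut_jac_commute\<close> the roles
  of the two points are exchanged, and \<open>b\<close> near the circle is far from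
  \<open>a\<close>.\<close>

lemma pseudo_ball_inside:
  assumes a: "a \<in> disk" and r: "r < 1"
  obtains R where "R < 1" "\<And>b. b \<in> disk \<Longrightarrow> norm (disk_aut a b) < r \<Longrightarrow> norm b < R"
proof -
  define k where "k = (1 - (max r 0)\<^sup>2) * (1 - norm a)\<^sup>2"
  have k: "0 < k" using r a by (auto simp: k_def max_def power_less_one_iff abs_square_less_1)
  define R where "R = sqrt (1 - min k 1)"
  show ?thesis
  proof (rule that[of R])
    show "R < 1" using k by (simp add: R_def)
    fix b assume b: "b \<in> disk" and lt: "norm (disk_aut a b) < r"
    have "(norm (disk_aut a b))\<^sup>2 < (max r 0)\<^sup>2" using lt by (intro power_strict_mono) auto
    then have "1 - (max r 0)\<^sup>2 < (1 - (norm b)\<^sup>2) * aut_jac a b"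
      using one_minus_disk_aut_sq[OF one_minus_cnj_mult_nz[OF a b]] by simp
    also have "\<dots> = (1 - (norm a)\<^sup>2) * aut_jac b a" by (rule aut_jac_commute)
    also have "\<dots> \<le> aut_jac b a"
      using one_minus_norm_sq_pos[OF a] aut_jac_pos[OF b a] by (intro mult_left_le_one_le) auto
    also have "\<dots> \<le> (1 - (norm b)\<^sup>2) / (1 - norm a)\<^sup>2" by (rule aut_jac_le(1)[OF b a])
    finally have "k < 1 - (norm b)\<^sup>2" using a by (simp add: k_def less_divide_eq)
    then have "(norm b)\<^sup>2 < 1 - min k 1" by simp
    then show "norm b < R" unfolding R_def by (rule real_less_rsqrt)
  qed
qed

section \<open>Displaced and separated points, and a function that is not strongly
  continuous\<close>

context semigroup_params
begin

text \<open>The time has to be chosen before the point: a map of small positive time that is not the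
  identity displaces some point as near to the circle as desired. The bound \<open>d\<close>, fixed
  before the time, keeps the image beyond \<open>R\<close> as well.\<close>

lemma pick_displaced_point:
  assumes nt: "nontrivial_semigroup \<phi>" and r: "r < 1" and R: "R < 1" and \<tau>: "0 < \<tau>" and \<eta>: "0 < \<eta>"
  obtains t a where "0 < t" "t < \<tau>" "a \<in> disk" "1 - (norm a)\<^sup>2 \<le> \<eta>" "r \<le> norm (disk_aut a (\<phi> t a))"
    "R \<le> norm (\<phi> t a)" "\<And>b. b \<in> disk \<Longrightarrow> norm (disk_aut a b) < r \<Longrightarrow> R \<le> norm b"
proof -
  obtain R1 d where R1: "R1 < 1" "0 < d"
    "\<And>t a. 0 < t \<Longrightarrow> t < d \<Longrightarrow> a \<in> disk \<Longrightarrow> R1 < norm a \<Longrightarrow> R < norm (\<phi> t a)"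
    using boundary_preserved[OF R] by metis
  obtain t z where tz: "0 < t" "t < min d \<tau>" "z \<in> disk" "\<phi> t z \<noteq> z"
    using small_nontrivial_time[OF nt, of "min d \<tau>"] R1 \<tau> by (metis min_less_iff_conj)
  obtain \<eta>' where \<eta>': "0 < \<eta>'" "\<And>a b. a \<in> disk \<Longrightarrow> b \<in> disk \<Longrightarrow> 1 - (norm a)\<^sup>2 < \<eta>' \<Longrightarrow> norm (disk_aut a b) < r \<Longrightarrow> R \<le> norm b"
    using pseudo_ball_far[OF r R] by blast
  define h where "h = min \<eta> \<eta>'"
  have h: "0 < h" using \<eta> \<eta>' by (simp add: h_def)
  define R2 where "R2 = max R1 (sqrt (max 0 (1 - h)))"
  have R2: "R2 < 1" using R1 h by (simp add: R2_def)
  obtain a where a: "a \<in> disk" "R2 < norm a" "r \<le> norm (disk_aut a (\<phi> t a))"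
    using selfmap_displacement[OF selfmap tz(3,4) r R2] tz(1) by (metis less_imp_le)
  have "sqrt (max 0 (1 - h)) < norm a" using a(2) by (simp add: R2_def)
  then have "(sqrt (max 0 (1 - h)))\<^sup>2 < (norm a)\<^sup>2" by (intro power_strict_mono) auto
  then have "max 0 (1 - h) < (norm a)\<^sup>2" by simp
  then have ah: "1 - (norm a)\<^sup>2 < h" by linarith
  show ?thesis
  proof (rule that[OF tz(1) _ a(1) _ a(3)])
    show "R \<le> norm (\<phi> t a)" using R1(3)[OF tz(1) _ a(1)] tz(2) a(2) by (simp add: R2_def less_imp_le)
    show "R \<le> norm b" if "b \<in> disk" "norm (disk_aut a b) < r" for b
      using \<eta>'(2)[OF a(1) that(1) _ that(2)] ah by (simp add: h_def)
  qed (use tz ah in \<open>auto simp: h_def\<close>)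
qed

text \<open>The recursion carries a third component \<open>R\<close>: the n-th ball and the n-th
  image lie within radius \<open>R n\<close>, while all later balls and images lie beyond it. This
  separates the balls from each other and every image from every ball.\<close>

lemma separated_displaced_points:
  assumes nt: "nontrivial_semigroup \<phi>" and r: "\<And>n. 0 < r n" "\<And>n. r n < 1" and \<tau>: "\<And>n. 0 < \<tau> n"
  obtains t :: "nat \<Rightarrow> real" and a :: "nat \<Rightarrow> complex" where
    "\<And>n. 0 < t n" "\<And>n. t n < \<tau> n" "\<And>n. a n \<in> disk" "\<And>n. 1 - (norm (a n))\<^sup>2 \<le> (1/2) ^ n"
    "\<And>b m n. b \<in> disk \<Longrightarrow> norm (disk_aut (a m) b) < r m \<Longrightarrow> norm (disk_aut (a n) b) < r n \<Longrightarrow> m = n"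
    "\<And>m n. r m \<le> norm (disk_aut (a m) (\<phi> (t n) (a n)))"
proof -
  define P where "P n x \<longleftrightarrow> (case x of (t, a, R) \<Rightarrow> 0 < t \<and> t < \<tau> n \<and> a \<in> disk \<and> 1 - (norm a)\<^sup>2 \<le> (1/2) ^ n \<and>
     r n \<le> norm (disk_aut a (\<phi> t a)) \<and> R < 1 \<and> norm (\<phi> t a) < R \<and>
     (\<forall>b\<in>disk. norm (disk_aut a b) < r n \<longrightarrow> norm b < R))" for n :: nat and x :: "real \<times> complex \<times> real"
  define Q where "Q n x y \<longleftrightarrow> (case x of (t, a, R) \<Rightarrow> case y of (t', a', R') \<Rightarrow> R \<le> R' \<and> R \<le> norm (\<phi> t' a') \<and>
     (\<forall>b\<in>disk. norm (disk_aut a' b) < r (Suc n) \<longrightarrow> R \<le> norm b))" for n :: nat and x y :: "real \<times> complex \<times> real"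
  have step: "\<exists>t a R'. P n (t, a, R') \<and> R \<le> R' \<and> R \<le> norm (\<phi> t a) \<and> (\<forall>b\<in>disk. norm (disk_aut a b) < r n \<longrightarrow> R \<le> norm b)"
    if R: "R < 1" for n R
  proof -
    obtain t a where ta: "0 < t" "t < \<tau> n" "a \<in> disk" "1 - (norm a)\<^sup>2 \<le> (1/2) ^ n" "r n \<le> norm (disk_aut a (\<phi> t a))"
      "R \<le> norm (\<phi> t a)" "\<And>b. b \<in> disk \<Longrightarrow> norm (disk_aut a b) < r n \<Longrightarrow> R \<le> norm b"
      using pick_displaced_point[OF nt r(2)[of n] R \<tau>[of n], of "(1/2) ^ n"] by (metis zero_less_power half_gt_zero_iff zero_less_one)
    obtain R1 where R1: "R1 < 1" "\<And>b. b \<in> disk \<Longrightarrow> norm (disk_aut a b) < r n \<Longrightarrow> norm b < R1"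
      using pseudo_ball_inside[OF ta(3) r(2)[of n]] by blast
    define R' where "R' = max (max R R1) ((1 + norm (\<phi> t a)) / 2)"
    have lt: "norm (\<phi> t a) < 1" using ta by simp
    have "P n (t, a, R')"
    proof -
      have "R' < 1" "norm (\<phi> t a) < R'" using R R1(1) lt by (auto simp: R'_def less_max_iff_disj)
      moreover have "norm b < R'" if "b \<in> disk" "norm (disk_aut a b) < r n" for b
        using R1(2)[OF that] by (simp add: R'_def less_max_iff_disj)
      ultimately show ?thesis using ta(1-5) unfolding P_def by blast
    qed
    moreover have "R \<le> R'" by (simp add: R'_def)
    ultimately show ?thesis using ta by blast
  qed
  have "\<exists>F. \<forall>n. P n (F n) \<and> Q n (F n) (F (Suc n))"
  proof (rule dependent_nat_choice)
    show "\<exists>x. P 0 x" using step[of 0 0] by auto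
    fix x n assume x: "P n x"
    obtain t a R where xe: "x = (t, a, R)" by (cases x)
    have "R < 1" using x by (simp add: P_def xe)
    from step[OF this, of "Suc n"] show "\<exists>y. P (Suc n) y \<and> Q n x y"
      unfolding Q_def xe by fastforce
  qed
  then obtain F where F: "\<And>n. P n (F n)" "\<And>n. Q n (F n) (F (Suc n))" by blast
  define t where "t n = fst (F n)" for n
  define a where "a n = fst (snd (F n))" for n
  define R where "R n = snd (snd (F n))" for n
  have Fe: "F n = (t n, a n, R n)" for n by (simp add: t_def a_def R_def)
  have P: "0 < t n" "t n < \<tau> n" "a n \<in> disk" "1 - (norm (a n))\<^sup>2 \<le> (1/2) ^ n"
     "r n \<le> norm (disk_aut (a n) (\<phi> (t n) (a n)))" "norm (\<phi> (t n) (a n)) < R n"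
     "\<And>b. b \<in> disk \<Longrightarrow> norm (disk_aut (a n) b) < r n \<Longrightarrow> norm b < R n" for n
    using F(1)[of n] unfolding P_def Fe by auto
  have Q: "R n \<le> R (Suc n)" "R n \<le> norm (\<phi> (t (Suc n)) (a (Suc n)))"
     "\<And>b. b \<in> disk \<Longrightarrow> norm (disk_aut (a (Suc n)) b) < r (Suc n) \<Longrightarrow> R n \<le> norm b" for n
    using F(2)[of n] unfolding Q_def Fe by auto
  have mono: "R m \<le> R n" if "m \<le> n" for m n
    by (rule lift_Suc_mono_le[of R, OF Q(1) that])
  have far: "R m \<le> norm b" if "m < n" "b \<in> disk" "norm (disk_aut (a n) b) < r n" for m n b
  proof -
    define k where "k = n - 1"
    have k: "n = Suc k" "m \<le> k" using that(1) by (auto simp: k_def)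
    show ?thesis using Q(3)[of b k] that k mono[OF k(2)] by simp
  qed
  have disj: False if "m < n" "b \<in> disk" "norm (disk_aut (a m) b) < r m" "norm (disk_aut (a n) b) < r n" for m n b
    using far[OF that(1,2,4)] P(7)[OF that(2,3)] by simp
  have out: "r m \<le> norm (disk_aut (a m) (\<phi> (t n) (a n)))" for m n
  proof (rule ccontr)
    assume "\<not> r m \<le> norm (disk_aut (a m) (\<phi> (t n) (a n)))"
    then have lt: "norm (disk_aut (a m) (\<phi> (t n) (a n))) < r m" by simp
    have b: "\<phi> (t n) (a n) \<in> disk" using P(1,3)[of n] by simp
    \<comment> \<open>A later image lies beyond \<open>R m\<close>, outside the m-th ball; an image
      avoids its own ball by displacement; an earlier image lies within \<open>R n\<close>, which a
      later ball does not meet.\<close>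
    consider "m < n" | "m = n" | "n < m" by linarith
    then show False
    proof cases
      case 1
      define k where "k = n - 1"
      have k: "n = Suc k" "m \<le> k" using 1 by (auto simp: k_def)
      show ?thesis using Q(2)[of k] P(7)[OF b lt] mono[OF k(2)] k by simp
    next
      case 2
      then show ?thesis using P(5)[of n] lt by simp
    next
      case 3
      show ?thesis using far[OF 3 b lt] P(6)[of n] by simp
    qed
  qed
  show ?thesis
  proof (rule that[of t a])
    show "m = n" if "b \<in> disk" "norm (disk_aut (a m) b) < r m" "norm (disk_aut (a n) b) < r n" for b m n
      using disj[of m n b] disj[of n m b] that by (meson linorder_neqE_nat)
  qed (use P(1-4) out in auto)
qed

theorem cont_space_proper:
  assumes nt: "nontrivial_semigroup \<phi>"
  shows "cont_space \<subset> M_space \<alpha> p s"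
proof -
  obtain c where c: "0 < c"
    "\<And>f a. f holomorphic_on disk \<Longrightarrow> a \<in> disk \<Longrightarrow>
      ennreal (c * (norm (deriv f a) * (1 - (norm a)\<^sup>2) powr (1 + \<alpha>)) powr p) \<le> scaled_energy f a"
    using bloch_bound by blast
  obtain d where d: "0 < d" "\<And>t. 0 \<le> t \<Longrightarrow> t < d \<Longrightarrow> norm (\<phi> t 0) \<le> 1/2 \<and> disk_selfmap.distortion (\<phi> t) \<le> 3"
    using distortion_small by blast
  \<comment> \<open>The total density that the foreign bumps may contribute. Composition costs
    \<open>3 powr \<alpha>\<close> through the distortion, which leaves 1/4 at the image against 3/4
    at the point itself.\<close>
  define \<epsilon> where "\<epsilon> = 1 / (4 * 3 powr \<alpha>)"
  have "1 \<le> 3 powr \<alpha>" using params by (simp add: ge_one_powr_ge_zero)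
  then have \<epsilon>: "0 < \<epsilon>" "\<epsilon> \<le> 1/4" "3 powr \<alpha> * \<epsilon> = 1/4" by (auto simp: \<epsilon>_def field_simps)
  have "\<exists>r. 0 < r \<and> r < 1 \<and> 2 powr \<alpha> * (1 - r\<^sup>2) \<le> \<epsilon> * (1/2) ^ Suc n \<and>
     (\<forall>a\<in>disk. \<forall>b\<in>disk. r \<le> norm (disk_aut a b) \<longrightarrow> bump_energy a b \<le> ennreal (2 powr (- (real (n + 1) * (p + 1)))))" for n
  proof -
    obtain r1 where r1: "r1 < 1" "\<And>a b. a \<in> disk \<Longrightarrow> b \<in> disk \<Longrightarrow> r1 \<le> norm (disk_aut a b) \<Longrightarrow>
        bump_energy a b \<le> ennreal (2 powr (- (real (n + 1) * (p + 1))))"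
      using bump_energy_small[of "2 powr (- (real (n + 1) * (p + 1)))"] by auto
    \<comment> \<open>The minimum with 1/2 keeps \<open>sqrt (1 - h)\<close> positive, hence
      \<open>r\<close> positive, so that every point lies in its own ball.\<close>
    define h where "h = min (1/2) (\<epsilon> * (1/2) ^ Suc n / 2 powr \<alpha>)"
    have h: "0 < h" "h < 1" "2 powr \<alpha> * h \<le> \<epsilon> * (1/2) ^ Suc n"
      using \<epsilon> by (auto simp: h_def min_def field_simps)
    define r where "r = max r1 (sqrt (1 - h))"
    have "0 < sqrt (1 - h)" using h by simp
    then have "0 < r" by (rule less_le_trans) (simp add: r_def)
    moreover have "r < 1" using r1 h by (simp add: r_def)
    moreover have "1 - h \<le> r\<^sup>2"
    proof -
      have "(sqrt (1 - h))\<^sup>2 \<le> r\<^sup>2" using h by (intro power_mono) (auto simp: r_def)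
      then show ?thesis using h by simp
    qed
    then have "2 powr \<alpha> * (1 - r\<^sup>2) \<le> \<epsilon> * (1/2) ^ Suc n"
      using h(3) by (intro order_trans[OF mult_left_mono h(3)]) auto
    ultimately show ?thesis using r1 by (intro exI[of _ r]) (auto simp: r_def)
  qed
  then obtain r where r: "\<And>n. 0 < r n" "\<And>n. r n < 1" "\<And>n. 2 powr \<alpha> * (1 - (r n)\<^sup>2) \<le> \<epsilon> * (1/2) ^ Suc n"
    "\<And>n a b. a \<in> disk \<Longrightarrow> b \<in> disk \<Longrightarrow> r n \<le> norm (disk_aut a b) \<Longrightarrow> bump_energy a b \<le> ennreal (2 powr (- (real (n + 1) * (p + 1))))"
    by metis
  \<comment> \<open>The bound \<open>d\<close> keeps the distortion at most 3; the other one forces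
    the times \<open>t n\<close> to tend to 0.\<close>
  define \<tau> where "\<tau> n = min d (1 / real (Suc n))" for n
  have \<tau>: "0 < \<tau> n" for n using d(1) by (simp add: \<tau>_def)
  obtain t :: "nat \<Rightarrow> real" and a :: "nat \<Rightarrow> complex" where ta:
    "\<And>n. 0 < t n" "\<And>n. t n < \<tau> n" "\<And>n. a n \<in> disk" "\<And>n. 1 - (norm (a n))\<^sup>2 \<le> (1/2) ^ n"
    "\<And>b m n. b \<in> disk \<Longrightarrow> norm (disk_aut (a m) b) < r m \<Longrightarrow> norm (disk_aut (a n) b) < r n \<Longrightarrow> m = n"
    "\<And>m n. r m \<le> norm (disk_aut (a m) (\<phi> (t n) (a n)))"
    by (rule separated_displaced_points[of r \<tau>, OF nt r(1,2) \<tau>]) (rule that)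
  have bound: "norm (bump (a n) z) \<le> (1/2) ^ n * (1 - R) powr (- (2 + \<alpha>))" if z: "z \<in> disk" "norm z \<le> R" "R < 1" for n z R
  proof -
    have "1 - R \<le> norm (1 - cnj (a n) * z)"
      using norm_one_minus_cnj_mult(2)[of "a n" z] ta(3)[of n] z by auto
    then have "norm (1 - cnj (a n) * z) powr (- (2 + \<alpha>)) \<le> (1 - R) powr (- (2 + \<alpha>))"
      using z params by (intro powr_mono2') auto
    then show ?thesis
      unfolding norm_bump[OF ta(3) z(1)] using ta(4)[of n] one_minus_norm_sq_pos[OF ta(3)[of n]]
      by (intro mult_mono) auto
  qed
  have summM: "summable (\<lambda>n. (1/2) ^ n * C)" for C :: real
    by (intro summable_mult2 summable_geometric) auto
  have summ: "summable (\<lambda>n. norm (bump (a n) z))" if z: "z \<in> disk" for z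
    by (rule summable_comparison_test'[OF summM[of "(1 - norm z) powr (- (2 + \<alpha>))"], of 0])
       (use bound[OF z order_refl] z in simp)
  \<comment> \<open>The series is built on the level of derivatives; the test function is a
    primitive on the convex disk.\<close>
  define g where "g z = (\<Sum>n. bump (a n) z)" for z
  have gh: "g holomorphic_on disk"
  proof (rule holomorphic_uniform_sequence)
    show "(\<lambda>z. \<Sum>i<n. bump (a i) z) holomorphic_on disk" for n
      by (intro holomorphic_intros bump_holomorphic ta)
    show "\<exists>e>0. cball z e \<subseteq> disk \<and> uniform_limit (cball z e) (\<lambda>n z. \<Sum>i<n. bump (a i) z) g sequentially" if "z \<in> disk" for z
    proof -
      define e where "e = (1 - norm z) / 2"
      define R where "R = norm z + e"
      have R: "norm z + e \<le> R" "R < 1" using that by (auto simp: R_def e_def field_simps)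
      have "cball z e \<subseteq> disk"
      proof
        fix w assume "w \<in> cball z e"
        then show "w \<in> disk"
          using norm_triangle_sub[of w z] R by (simp add: dist_norm norm_minus_commute)
      qed
      then have e: "0 < e" "cball z e \<subseteq> disk" using that by (auto simp: e_def)
      have "uniform_limit (cball z e) (\<lambda>n z. \<Sum>i<n. bump (a i) z) g sequentially"
        unfolding g_def
      proof (rule Weierstrass_m_test)
        show "norm (bump (a n) w) \<le> (1/2) ^ n * (1 - R) powr (- (2 + \<alpha>))" if "w \<in> cball z e" for n w
        proof (rule bound)
          show "norm w \<le> R" using norm_triangle_sub[of w z] that R by (simp add: dist_norm norm_minus_commute)
        qed (use e that R in auto)
      qed (rule summM)
      then show ?thesis using e by blast
    qed
  qed simp
  obtain f where f: "\<And>z. z \<in> disk \<Longrightarrow> (f has_field_derivative g z) (at z)"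
    using holomorphic_convex_primitive'[OF _ _ gh] by (metis at_within_open convex_ball open_ball)
  have fh: "f holomorphic_on disk"
    using f by (meson field_differentiable_def field_differentiable_at_within holomorphic_onI)
  have df: "deriv f z = g z" if "z \<in> disk" for z
    by (rule DERIV_imp_deriv[OF f[OF that]])
  have fM: "f \<in> M_space \<alpha> p s"
  proof (rule bump_series_M_space[OF fh _ summ ta(3)])
    show "deriv f z = (\<Sum>n. bump (a n) z)" if "z \<in> disk" for z using df[OF that] by (simp add: g_def)
    fix b assume b: "b \<in> disk"
    show "\<exists>m. \<forall>n. n \<noteq> m \<longrightarrow> bump_energy (a n) b \<le> ennreal (2 powr (- (real (n + 1) * (p + 1))))"
    proof (cases "\<exists>m. norm (disk_aut (a m) b) < r m")
      case True
      then obtain m where m: "norm (disk_aut (a m) b) < r m" by blast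
      have "bump_energy (a n) b \<le> ennreal (2 powr (- (real (n + 1) * (p + 1))))" if "n \<noteq> m" for n
        using ta(5)[OF b m, of n] that by (intro r(4) ta b) (auto simp: not_less[symmetric])
      then show ?thesis by blast
    next
      case False
      then show ?thesis using r(4)[OF ta(3) b] by (auto simp: not_less)
    qed
  qed
  have small: "norm (bump (a n) z) * (1 - (norm z)\<^sup>2) powr (1 + \<alpha>) \<le> \<epsilon> * (1/2) ^ Suc n"
    if z: "z \<in> disk" "r n \<le> norm (disk_aut (a n) z)" for n z
  proof -
    have "(r n)\<^sup>2 \<le> (norm (disk_aut (a n) z))\<^sup>2" using z(2) r(1)[of n] by (intro power_mono) auto
    then have "2 powr \<alpha> * (1 - (norm (disk_aut (a n) z))\<^sup>2) \<le> 2 powr \<alpha> * (1 - (r n)\<^sup>2)"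
      by (intro mult_left_mono) auto
    then show ?thesis using bump_le[OF ta(3) z(1), of n] r(3)[of n] by linarith
  qed
  have \<epsilon>_sums: "(\<lambda>n. \<epsilon> * (1/2) ^ Suc n) sums \<epsilon>"
    using sums_mult[OF power_half_series, of \<epsilon>] by simp
  \<comment> \<open>Outside all the balls each bump contributes at most its share of
    \<open>\<epsilon>\<close>; the images of the displaced points are such points.\<close>
  have at_b: "norm (g z) * (1 - (norm z)\<^sup>2) powr (1 + \<alpha>) \<le> \<epsilon>"
    if z: "z \<in> disk" and out: "\<And>n. r n \<le> norm (disk_aut (a n) z)" for z
  proof -
    define y where "y = (1 - (norm z)\<^sup>2) powr (1 + \<alpha>)"
    have "norm (g z) * y \<le> (\<Sum>n. norm (bump (a n) z)) * y"
      unfolding g_def by (intro mult_right_mono summable_norm summ z) (simp add: y_def)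
    also have "\<dots> = (\<Sum>n. norm (bump (a n) z) * y)" by (rule suminf_mult2[OF summ[OF z]])
    also have "\<dots> \<le> (\<Sum>n. \<epsilon> * (1/2) ^ Suc n)"
      unfolding y_def by (intro suminf_le small z out summable_mult2 summ sums_summable[OF \<epsilon>_sums])
    also have "\<dots> = \<epsilon>" using \<epsilon>_sums by (simp add: sums_iff)
    finally show ?thesis by (simp add: y_def)
  qed
  \<comment> \<open>The point's own bump has density 1, and since the point lies in its own ball it
    is outside all others; their total is at most \<open>\<epsilon> \<le> 1/4\<close>.\<close>
  have at_a: "3 / 4 \<le> norm (g (a n)) * (1 - (norm (a n))\<^sup>2) powr (1 + \<alpha>)" for n
  proof -
    define y where "y = (1 - (norm (a n))\<^sup>2) powr (1 + \<alpha>)"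
    have y: "0 \<le> y" by (simp add: y_def)
    define x where "x m = (if m = n then 0 else bump (a m) (a n))" for m
    have xs: "summable (\<lambda>m. norm (x m))"
      by (rule summable_comparison_test'[OF summ[OF ta(3)[of n]], of 0]) (simp add: x_def)
    have "(\<lambda>m. (if m = n then bump (a n) (a n) else 0) + x m) sums (bump (a n) (a n) + suminf x)"
      by (intro sums_add sums_single summable_sums summable_norm_cancel[OF xs])
    moreover have "(\<lambda>m. (if m = n then bump (a n) (a n) else 0) + x m) = (\<lambda>m. bump (a m) (a n))"
      by (auto simp: x_def)
    ultimately have ge: "g (a n) = bump (a n) (a n) + suminf x" by (simp add: g_def sums_iff)
    have xsm: "norm (x m) * y \<le> \<epsilon> * (1/2) ^ Suc m" for m
    proof (cases "m = n")
      case True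
      then show ?thesis using \<epsilon> by (simp add: x_def)
    next
      case False
      have "norm (disk_aut (a n) (a n)) < r n" using r(1) by simp
      then have "r m \<le> norm (disk_aut (a m) (a n))"
        using ta(5)[OF ta(3)[of n], of m n] False by (meson not_less)
      then show ?thesis using small[OF ta(3)[of n], of m] False by (simp add: x_def y_def)
    qed
    have "norm (suminf x) * y \<le> (\<Sum>m. norm (x m)) * y" by (intro mult_right_mono summable_norm xs y)
    also have "\<dots> = (\<Sum>m. norm (x m) * y)" by (rule suminf_mult2[OF xs])
    also have "\<dots> \<le> (\<Sum>m. \<epsilon> * (1/2) ^ Suc m)"
      by (intro suminf_le xsm summable_mult2 xs sums_summable[OF \<epsilon>_sums])
    also have "\<dots> = \<epsilon>" using \<epsilon>_sums by (simp add: sums_iff)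
    finally have "norm (suminf x) * y \<le> \<epsilon>" .
    moreover have "norm (bump (a n) (a n)) - norm (suminf x) \<le> norm (g (a n))"
      unfolding ge by (rule norm_diff_ineq)
    then have "(norm (bump (a n) (a n)) - norm (suminf x)) * y \<le> norm (g (a n)) * y"
      using y by (intro mult_right_mono)
    moreover have "norm (bump (a n) (a n)) * y = 1" unfolding y_def by (rule norm_bump_self[OF ta(3)])
    ultimately show ?thesis using \<epsilon>(2) by (simp add: y_def left_diff_distrib)
  qed
  \<comment> \<open>The Bloch density of the difference at \<open>a n\<close> is at least 3/4 - 1/4,
    and \<open>bloch_bound\<close> turns this pointwise gap into a lower bound of the energy that
    does not depend on \<open>n\<close>.\<close>
  have lower: "ennreal (c * (1/2) powr p) \<le> scaled_energy (\<lambda>z. f (\<phi> (t n) z) - f z) (a n)" for n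
  proof -
    have t: "0 \<le> t n" "t n < d" using ta(1,2)[of n] by (auto simp: \<tau>_def)
    interpret T: disk_selfmap "\<phi> (t n)" by (rule selfmap[OF t(1)])
    define z where "z = a n"
    define b where "b = \<phi> (t n) z"
    have z: "z \<in> disk" using ta(3) by (simp add: z_def)
    have b: "b \<in> disk" using z by (simp add: b_def)
    define y where "y = 1 - (norm z)\<^sup>2"
    define Y where "Y = 1 - (norm b)\<^sup>2"
    have y: "0 < y" "0 < Y" using one_minus_norm_sq_pos z b by (auto simp: y_def Y_def)
    have yY: "y \<le> 3 * Y"
    proof -
      have "y \<le> T.distortion * Y" using T.one_minus_norm_sq_distortion[OF z] by (simp add: y_def Y_def b_def)
      also have "\<dots> \<le> 3 * Y" using d(2)[OF t] y by (intro mult_right_mono) auto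
      finally show ?thesis .
    qed
    have "norm (g b * deriv (\<phi> (t n)) z) * y powr (1 + \<alpha>) = norm (g b) * (norm (deriv (\<phi> (t n)) z) * y) * y powr \<alpha>"
      using y by (simp add: norm_mult powr_add)
    \<comment> \<open>Schwarz-Pick for the derivative handles one power of \<open>y\<close>, the
      distortion bound \<open>y \<le> 3 * Y\<close> the remaining power
      \<open>\<alpha>\<close>.\<close>
    also have "\<dots> \<le> norm (g b) * Y * (3 * Y) powr \<alpha>"
      using T.schwarz_pick_deriv[OF z] y yY params
      by (intro mult_mono mult_left_mono powr_mono2) (auto simp: y_def Y_def b_def)
    also have "\<dots> = 3 powr \<alpha> * (norm (g b) * Y powr (1 + \<alpha>))"
      using y by (simp add: powr_add powr_mult)
    also have "\<dots> \<le> 3 powr \<alpha> * \<epsilon>"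
      unfolding Y_def using ta(6) b by (intro mult_left_mono at_b) (auto simp: b_def z_def)
    finally have up: "norm (g b * deriv (\<phi> (t n)) z) * y powr (1 + \<alpha>) \<le> 1/4" using \<epsilon>(3) by simp
    have dd: "deriv (\<lambda>z. f (\<phi> (t n) z) - f z) z = g b * deriv (\<phi> (t n)) z - g z"
    proof -
      have "(\<lambda>z. f (\<phi> (t n) z)) field_differentiable at z"
        using holomorphic_compose_selfmap[OF T.disk_selfmap_axioms fh] z
        by (intro holomorphic_on_imp_differentiable_at[of _ disk]) auto
      moreover have "f field_differentiable at z"
        using fh z by (intro holomorphic_on_imp_differentiable_at[of _ disk]) auto
      ultimately show ?thesis
        using deriv_compose_selfmap[OF T.disk_selfmap_axioms fh z] df z b by (simp add: deriv_diff b_def)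
    qed
    have "norm (g z) - norm (g b * deriv (\<phi> (t n)) z) \<le> norm (g b * deriv (\<phi> (t n)) z - g z)"
      using norm_triangle_ineq2[of "g z" "g b * deriv (\<phi> (t n)) z"] by (simp add: norm_minus_commute)
    then have "(norm (g z) - norm (g b * deriv (\<phi> (t n)) z)) * y powr (1 + \<alpha>) \<le> norm (g b * deriv (\<phi> (t n)) z - g z) * y powr (1 + \<alpha>)"
      by (intro mult_right_mono) auto
    then have "1/2 \<le> norm (deriv (\<lambda>z. f (\<phi> (t n) z) - f z) z) * y powr (1 + \<alpha>)"
      unfolding dd using up at_a[of n] by (simp add: z_def[symmetric] y_def[symmetric] left_diff_distrib)
    then have "c * (1/2) powr p \<le> c * (norm (deriv (\<lambda>z. f (\<phi> (t n) z) - f z) z) * y powr (1 + \<alpha>)) powr p"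
      using c(1) params by (intro mult_left_mono powr_mono2) auto
    then have "ennreal (c * (1/2) powr p) \<le> ennreal (c * (norm (deriv (\<lambda>z. f (\<phi> (t n) z) - f z) z) * y powr (1 + \<alpha>)) powr p)"
      by (rule ennreal_leI)
    also have "\<dots> \<le> scaled_energy (\<lambda>z. f (\<phi> (t n) z) - f z) z"
      unfolding y_def by (rule c(2)[OF diff_holomorphic[OF fh t(1)] z])
    finally show ?thesis by (simp add: z_def)
  qed
  have "f \<notin> cont_space"
  proof
    assume "f \<in> cont_space"
    moreover have pos: "0 < c * (1/2) powr p / 2" using c(1) by simp
    ultimately have "eventually (\<lambda>t. \<forall>a\<in>disk. scaled_energy (\<lambda>z. f (\<phi> t z) - f z) a \<le> ennreal (c * (1/2) powr p / 2)) (at_right 0)"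
      by (simp add: cont_space_iff)
    then obtain d' where d': "0 < d'" "\<And>t a. 0 < t \<Longrightarrow> t < d' \<Longrightarrow> a \<in> disk \<Longrightarrow>
        scaled_energy (\<lambda>z. f (\<phi> t z) - f z) a \<le> ennreal (c * (1/2) powr p / 2)"
      unfolding eventually_at_right_field by blast
    obtain n where n: "1 / real (Suc n) < d'" using d'(1) nat_approx_posE by blast
    have "t n < d'" using ta(2)[of n] n by (simp add: \<tau>_def)
    then have "ennreal (c * (1/2) powr p) \<le> ennreal (c * (1/2) powr p / 2)"
      using lower[of n] d'(2)[OF ta(1) _ ta(3)] by (meson order_trans)
    then show False using pos by simp
  qed
  then show ?thesis using fM closed_subspace_cont_space by (auto simp: closed_subspace_of_def)
qed

end

theorem theorem1p2:
  fixes p s \<alpha> :: real and \<phi> :: "real \<Rightarrow> complex \<Rightarrow> complex"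
  assumes "admissible p s \<alpha>"
    and "selfmap_semigroup \<phi>"
    and "nontrivial_semigroup \<phi>"
  shows "m_space \<alpha> p s \<subseteq> strong_cont_space \<phi> (M_space \<alpha> p s) (M_norm \<alpha> p s) \<and>
         strong_cont_space \<phi> (M_space \<alpha> p s) (M_norm \<alpha> p s) \<subset> M_space \<alpha> p s \<and>
         C0_semigroup_on (m_space \<alpha> p s) (M_norm \<alpha> p s) (comp_op \<phi>) \<and>
         closed_subspace_of (strong_cont_space \<phi> (M_space \<alpha> p s) (M_norm \<alpha> p s))
           (M_space \<alpha> p s) (M_norm \<alpha> p s)"
proof -
  interpret semigroup_params p s \<alpha> \<phi>
    using assms(1,2) by unfold_locales
  show ?thesis
    using m_space_subset_cont_space cont_space_proper[OF assms(3)] C0_semigroup_m_space closed_subspace_cont_space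
    by blast
qed

end
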